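(* Let $K$ be a field, $n>2$, $S=K[x_1,\ldots,x_n]$, and let $U\supset I$ be monomial ideals of $S$ such that $M=U/I$ is a Cohen-Macaulay $S$-module and $I$ is a primary ideal. Then $M=U/I$ is clean. In particular, $\operatorname{fdepth} M=\operatorname{depth} M=\operatorname{sdepth} M$.
   Context: Let $M$ be a finitely generated $\mathbb Z^n$-graded $S$-module. A prime filtration of $M$ is a chain $\mathcal F: 0=M_0\subset M_1\subset\cdots\subset M_r=M$ of multigraded submodules with $M_i/M_{i-1}\cong S/P_i(-a_i)$, $a_i\in\mathbb N^n$, $P_i$ a monomial prime ideal; $\operatorname{Supp}(\mathcal F)=\{P_1,\ldots,P_r\}$. $\mathcal F$ is clean if $\operatorname{Supp}(\mathcal F)=\operatorname{Min}(M)$ (the set of minimal primes of $M$), and $M$ is clean if it has a clean filtration. Set $\operatorname{fdepth}(\mathcal F)=\min\{\dim S/P:P\in\operatorname{Supp}(\mathcal F)\}$ and $\operatorname{fdepth}(M)=\max_{\mathcal F}\operatorname{fdepth}(\mathcal F)$ over all prime filtrations of $M$. For a $\mathbb Z^n$-homogeneous $y\in M$ and $Z\subset\{x_1,\ldots,x_n\}$ set $yK[Z]=\{yf:f\in K[Z]\}$; it is a Stanley space if it is a free $K[Z]$-module. A Stanley decomposition of $M$ is a presentation $\mathcal D: M=\bigoplus_{i=1}^r y_iK[Z_i]$ as a finite direct sum (of $K$-vector spaces) of Stanley spaces; $\operatorname{sdepth}(\mathcal D)=\min_i|Z_i|$, $\operatorname{sdepth}(M)=\max_{\mathcal D}\operatorname{sdepth}(\mathcal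 D)$. Cohen-Macaulay modules are nonzero. *)

theory Defs
  imports
    "HOL-Algebra.QuotRing"
    "HOL-Algebra.Module"
    "HOL-Algebra.Algebraic_Closure_Type"
    "HOL-Library.Poly_Mapping"
    "HOL-Library.Cardinality"
    "HOL-Library.Extended_Nat"
begin

section \<open>The polynomial ring and its monomial ideals\<close>

text \<open>
  The variables are indexed by a finite type \<open>'n\<close>; thus \<open>n = CARD('n)\<close>. A monomial is an
  exponent vector \<open>'n \<Rightarrow>\<^sub>0 nat\<close>.
\<close>

type_synonym ('n, 'k) mpoly = "('n \<Rightarrow>\<^sub>0 nat) \<Rightarrow>\<^sub>0 'k"

abbreviation mpoly_ring :: "('n::finite, 'k::field) mpoly ring"
  where "mpoly_ring \<equiv> ring_of_type_algebra"

definition monomial :: "('n::finite \<Rightarrow>\<^sub>0 nat) \<Rightarrow> ('n, 'k::field) mpoly"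
  where "monomial t = Poly_Mapping.single t 1"

definition variable :: "'n::finite \<Rightarrow> ('n, 'k::field) mpoly"
  where "variable i = monomial (Poly_Mapping.single i 1)"

definition graded_maximal_ideal :: "('n::finite, 'k::field) mpoly set"
  where "graded_maximal_ideal = Idl\<^bsub>mpoly_ring\<^esub> (variable ` UNIV)"

text \<open>The subring \<open>K[Z]\<close>.\<close>

definition polys_in :: "'n::finite set \<Rightarrow> ('n, 'k::field) mpoly set"
  where "polys_in Z = {f. \<forall>t \<in> Poly_Mapping.keys f. Poly_Mapping.keys t \<subseteq> Z}"

definition monomial_ideal :: "('n::finite, 'k::field) mpoly set \<Rightarrow> bool"
  where "monomial_ideal I \<longleftrightarrow> (\<exists>T. I = Idl\<^bsub>mpoly_ring\<^esub> (monomial ` T))"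

definition primary_ideal :: "('a, 'b) ring_scheme \<Rightarrow> 'a set \<Rightarrow> bool"
  where "primary_ideal R I \<longleftrightarrow> ideal I R \<and> I \<noteq> carrier R \<and>
    (\<forall>a \<in> carrier R. \<forall>b \<in> carrier R.
       a \<otimes>\<^bsub>R\<^esub> b \<in> I \<longrightarrow> a \<in> I \<or> (\<exists>m::nat. b [^]\<^bsub>R\<^esub> m \<in> I))"


section \<open>Dimension, depth and the Cohen-Macaulay property\<close>

definition krull_dim :: "('a, 'b) ring_scheme \<Rightarrow> enat"
  where "krull_dim R = Sup {enat k | k.
    \<exists>P :: nat \<Rightarrow> 'a set. (\<forall>i \<le> k. primeideal (P i) R) \<and> (\<forall>i < k. P i \<subset> P (Suc i))}"

definition annihilator :: "('a, 'r) ring_scheme \<Rightarrow> ('a, 'm, 'z) module_scheme \<Rightarrow> 'a set"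
  where "annihilator R M = {r \<in> carrier R. \<forall>x \<in> carrier M. r \<odot>\<^bsub>M\<^esub> x = \<zero>\<^bsub>M\<^esub>}"

definition module_dim :: "('a, 'r) ring_scheme \<Rightarrow> ('a, 'm, 'z) module_scheme \<Rightarrow> enat"
  where "module_dim R M = krull_dim (R Quot annihilator R M)"

definition minimal_primes :: "('a, 'r) ring_scheme \<Rightarrow> ('a, 'm, 'z) module_scheme \<Rightarrow> 'a set set"
  where "minimal_primes R M = {P. primeideal P R \<and> annihilator R M \<subseteq> P \<and>
    (\<forall>Q. primeideal Q R \<and> annihilator R M \<subseteq> Q \<and> Q \<subseteq> P \<longrightarrow> Q = P)}"

text \<open>The submodule \<open>(f\<^sub>1, \<dots>, f\<^sub>k) M\<close>.\<close>

definition seq_multiple :: "('a, 'm, 'z) module_scheme \<Rightarrow> 'a list \<Rightarrow> 'm set"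
  where "seq_multiple M fs =
    {\<Oplus>\<^bsub>M\<^esub> i \<in> {..<length fs}. (fs ! i) \<odot>\<^bsub>M\<^esub> x i | x. x \<in> {..<length fs} \<rightarrow> carrier M}"

text \<open>
  The first condition says that \<open>f\<^sub>i\<close> is a nonzerodivisor on
  \<open>M / (f\<^sub>1, \<dots>, f\<^sub>i\<^sub>-\<^sub>1) M\<close>, the second one that \<open>(f\<^sub>1, \<dots>, f\<^sub>k) M \<noteq> M\<close>.
\<close>

definition regular_sequence :: "('a, 'm, 'z) module_scheme \<Rightarrow> 'a list \<Rightarrow> bool"
  where "regular_sequence M fs \<longleftrightarrow>
    (\<forall>i < length fs. \<forall>x \<in> carrier M.
       (fs ! i) \<odot>\<^bsub>M\<^esub> x \<in> seq_multiple M (take i fs) \<longrightarrow> x \<in> seq_multiple M (take i fs)) \<and>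
    seq_multiple M fs \<noteq> carrier M"

text \<open>
  Over the polynomial ring, depth is taken with respect to the graded maximal ideal
  \<open>(x\<^sub>1, \<dots>, x\<^sub>n)\<close>, as usual for graded modules. The supremum ranges over arbitrary (not
  necessarily homogeneous) sequences.
\<close>

definition depth :: "(('n::finite, 'k::field) mpoly, 'm, 'z) module_scheme \<Rightarrow> enat"
  where "depth M =
    Sup {enat (length fs) | fs. set fs \<subseteq> graded_maximal_ideal \<and> regular_sequence M fs}"

definition cohen_macaulay :: "(('n::finite, 'k::field) mpoly, 'm, 'z) module_scheme \<Rightarrow> bool"
  where "cohen_macaulay M \<longleftrightarrow> carrier M \<noteq> {\<zero>\<^bsub>M\<^esub>} \<and> depth M = module_dim mpoly_ring M"


section \<open>Multigraded modules\<close>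

text \<open>A module together with the family of its homogeneous components.\<close>

record ('a, 'b, 'g) graded_module = "('a, 'b) module" +
  component :: "'g \<Rightarrow> 'b set"

text \<open>Modules over the polynomial ring, graded by \<open>\<int>\<^sup>n\<close>.\<close>

type_synonym ('n, 'k, 'm) multigraded_module =
  "(('n, 'k) mpoly, 'm, 'n \<Rightarrow> int) graded_module"

definition mpoly_module :: "('n::finite, 'k::field, ('n, 'k) mpoly) multigraded_module"
  where "mpoly_module = \<lparr>carrier = UNIV, monoid.mult = (*), one = 1, ring.zero = 0, add = (+),
    module.smult = (*),
    component = (\<lambda>b. {f. \<forall>t \<in> Poly_Mapping.keys f. \<forall>i. int (Poly_Mapping.lookup t i) = b i})\<rparr>"

definition graded_submodule :: "'m set \<Rightarrow> ('n::finite, 'k::field, 'm) multigraded_module \<Rightarrow> bool"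
  where "graded_submodule N M \<longleftrightarrow> submodule N mpoly_ring M \<and>
    (\<forall>x \<in> N. \<exists>A y. finite A \<and> (\<forall>b \<in> A. y b \<in> N \<inter> component M b) \<and> x = (\<Oplus>\<^bsub>M\<^esub> b \<in> A. y b))"

definition restrict_module ::
    "('n::finite, 'k::field, 'm) multigraded_module \<Rightarrow> 'm set \<Rightarrow> ('n, 'k, 'm) multigraded_module"
  where "restrict_module M N = M\<lparr>carrier := N, component := (\<lambda>b. component M b \<inter> N)\<rparr>"

text \<open>
  The quotient module, on the additive cosets of \<open>N\<close>. The ring multiplication that the record
  inherits plays no role for modules.
\<close>

definition quotient_module ::
    "('n::finite, 'k::field, 'm) multigraded_module \<Rightarrow> 'm set \<Rightarrow> ('n, 'k, 'm set) multigraded_module"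
  where "quotient_module M N = \<lparr>carrier = a_rcosets\<^bsub>M\<^esub> N,
    monoid.mult = undefined, one = undefined,
    ring.zero = N, add = set_add M,
    module.smult = (\<lambda>f C. \<Union>x \<in> C. N +>\<^bsub>M\<^esub> (f \<odot>\<^bsub>M\<^esub> x)),
    component = (\<lambda>b. (\<lambda>x. N +>\<^bsub>M\<^esub> x) ` component M b)\<rparr>"

text \<open>The shifted module \<open>M(-a)\<close>, with components \<open>M(-a)\<^sub>b = M\<^sub>b\<^sub>-\<^sub>a\<close>.\<close>

definition shift_module ::
    "('n::finite, 'k::field, 'm) multigraded_module \<Rightarrow> ('n \<Rightarrow> int) \<Rightarrow> ('n, 'k, 'm) multigraded_module"
  where "shift_module M a = M\<lparr>component := (\<lambda>b. component M (\<lambda>i. b i - a i))\<rparr>"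

definition graded_isomorphic ::
    "('n::finite, 'k::field, 'm) multigraded_module \<Rightarrow> ('n, 'k, 'p) multigraded_module \<Rightarrow> bool"
  where "graded_isomorphic M N \<longleftrightarrow> (\<exists>\<phi>. bij_betw \<phi> (carrier M) (carrier N) \<and>
    (\<forall>x \<in> carrier M. \<forall>y \<in> carrier M. \<phi> (x \<oplus>\<^bsub>M\<^esub> y) = \<phi> x \<oplus>\<^bsub>N\<^esub> \<phi> y) \<and>
    (\<forall>f. \<forall>x \<in> carrier M. \<phi> (f \<odot>\<^bsub>M\<^esub> x) = f \<odot>\<^bsub>N\<^esub> \<phi> x) \<and>
    (\<forall>b. \<phi> ` component M b = component N b))"

text \<open>The multigraded module \<open>U/I\<close> for monomial ideals \<open>I \<subseteq> U\<close>.\<close>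

definition ideal_quotient ::
    "('n::finite, 'k::field) mpoly set \<Rightarrow> ('n, 'k) mpoly set \<Rightarrow> ('n, 'k, ('n, 'k) mpoly set) multigraded_module"
  where "ideal_quotient U I = quotient_module (restrict_module mpoly_module U) I"


section \<open>Prime filtrations\<close>

text \<open>
  A filtration of length \<open>r\<close> is given by the list \<open>[M\<^sub>0, \<dots>, M\<^sub>r]\<close> of submodules together with
  the list \<open>[P\<^sub>1, \<dots>, P\<^sub>r]\<close> of primes, so that \<open>Supp\<close> is the set of the elements of the latter.
\<close>

definition prime_filtration ::
    "('n::finite, 'k::field, 'm) multigraded_module \<Rightarrow> 'm set list \<Rightarrow> ('n, 'k) mpoly set list \<Rightarrow> bool"
  where "prime_filtration M Ms Ps \<longleftrightarrow>
    length Ms = Suc (length Ps) \<and> hd Ms = {\<zero>\<^bsub>M\<^esub>} \<and> last Ms = carrier M \<and>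
    (\<forall>N \<in> set Ms. graded_submodule N M) \<and>
    (\<forall>i < length Ps. Ms ! i \<subset> Ms ! Suc i \<and>
       monomial_ideal (Ps ! i) \<and> primeideal (Ps ! i) mpoly_ring \<and>
       (\<exists>a :: 'n \<Rightarrow> nat. graded_isomorphic
          (quotient_module (restrict_module M (Ms ! Suc i)) (Ms ! i))
          (shift_module (quotient_module mpoly_module (Ps ! i)) (\<lambda>j. int (a j)))))"

definition clean :: "('n::finite, 'k::field, 'm) multigraded_module \<Rightarrow> bool"
  where "clean M \<longleftrightarrow>
    (\<exists>Ms Ps. prime_filtration M Ms Ps \<and> set Ps = minimal_primes mpoly_ring M)"

definition filtration_fdepth :: "('n::finite, 'k::field) mpoly set list \<Rightarrow> enat"
  where "filtration_fdepth Ps = Inf ((\<lambda>P. krull_dim (mpoly_ring Quot P)) ` set Ps)"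

text \<open>
  For a nonzero module the values below are at most \<open>n\<close>, so the supremum is a maximum as soon as
  there is a prime filtration; likewise for Stanley decompositions.
\<close>

definition fdepth :: "('n::finite, 'k::field, 'm) multigraded_module \<Rightarrow> enat"
  where "fdepth M = Sup {filtration_fdepth Ps | Ms Ps. prime_filtration M Ms Ps}"


section \<open>Stanley decompositions\<close>

definition free_module :: "('a, 'r) ring_scheme \<Rightarrow> ('a, 'm, 'z) module_scheme \<Rightarrow> bool"
  where "free_module R M \<longleftrightarrow> (\<exists>B \<subseteq> carrier M. \<forall>x \<in> carrier M.
    \<exists>!c. c ` B \<subseteq> carrier R \<and> (\<forall>b. b \<notin> B \<longrightarrow> c b = \<zero>\<^bsub>R\<^esub>) \<and> finite {b. c b \<noteq> \<zero>\<^bsub>R\<^esub>} \<and>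
      x = (\<Oplus>\<^bsub>M\<^esub> b \<in> {b. c b \<noteq> \<zero>\<^bsub>R\<^esub>}. c b \<odot>\<^bsub>M\<^esub> b))"

text \<open>The subspace \<open>yK[Z] = {yf : f \<in> K[Z]}\<close>.\<close>

definition cyclic_subspace ::
    "('n::finite, 'k::field, 'm) multigraded_module \<Rightarrow> 'm \<Rightarrow> 'n set \<Rightarrow> 'm set"
  where "cyclic_subspace M y Z = (\<lambda>f. f \<odot>\<^bsub>M\<^esub> y) ` polys_in Z"

definition stanley_space ::
    "('n::finite, 'k::field, 'm) multigraded_module \<Rightarrow> 'm \<Rightarrow> 'n set \<Rightarrow> bool"
  where "stanley_space M y Z \<longleftrightarrow> (\<exists>b. y \<in> component M b) \<and>
    free_module (mpoly_ring\<lparr>carrier := polys_in Z\<rparr>) (M\<lparr>carrier := cyclic_subspace M y Z\<rparr>)"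

text \<open>
  The last condition says that \<open>M\<close> is the internal direct sum of the subspaces
  \<open>y\<^sub>iK[Z\<^sub>i]\<close>.
\<close>

definition stanley_decomposition ::
    "('n::finite, 'k::field, 'm) multigraded_module \<Rightarrow> ('m \<times> 'n set) list \<Rightarrow> bool"
  where "stanley_decomposition M D \<longleftrightarrow>
    (\<forall>(y, Z) \<in> set D. y \<in> carrier M \<and> stanley_space M y Z) \<and>
    (\<forall>x \<in> carrier M.
       \<exists>!w. w \<in> (\<Pi>\<^sub>E i \<in> {..<length D}. cyclic_subspace M (fst (D ! i)) (snd (D ! i))) \<and>
            x = (\<Oplus>\<^bsub>M\<^esub> i \<in> {..<length D}. w i))"

definition decomposition_sdepth :: "('m \<times> 'n::finite set) list \<Rightarrow> enat"
  where "decomposition_sdepth D = Inf ((\<lambda>(y, Z). enat (card Z)) ` set D)"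

definition sdepth :: "('n::finite, 'k::field, 'm) multigraded_module \<Rightarrow> enat"
  where "sdepth M = Sup {decomposition_sdepth D | D. stanley_decomposition M D}"

end

(* Let Z be the set of the variables that are nonzerodivisors modulo I and V the set of the other
   ones, which are nilpotent modulo I. Whether a monomial lies in I depends only on its V-part, so
   M = U/I splits, over K[Z], into the monomial ideals formed by the monomials of U with a given
   V-part not in I. Every prime containing ann M contains P = (x_i : i in V), so M has dimension
   at least |Z|. The Koszul cohomology of M on the variables of Z vanishes below the length of any
   regular sequence in (x_1, ..., x_n), because each f in this ideal is nilpotent on it. Vanishing up
   to degree |Z| is impossible, hence depth M <= |Z| and the Cohen-Macaulay property gives
   depth M = dim M = |Z|. Vanishing in degree |Z| - 1 makes each of the monomial ideals principal.
   Their generators g, ordered by decreasing degree in the variables of V, yield a prime filtration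
   with all factors isomorphic to S/P up to shifts, and M is the direct sum of the Stanley spaces
   g K[Z]. No Stanley decomposition does better, as the variables of V act nilpotently. *)

theory Submission
  imports Defs
begin

section \<open>The Koszul complex\<close>

text \<open>For a monomial ideal J of K[Z], Koszul cohomology in degree |Z| - i is Tor_i(J, K) over
  K[Z]. In degree |Z| this is J/(Z)J, nonzero for nonzero J by Nakayama's lemma; vanishing in degree
  |Z| - 1 says that J has no first syzygies, so J is free, of rank one. This is the graded principle
  that a Cohen-Macaulay module is free over its parameter ring. The obstacle is that
  \<open>depth\<close> admits arbitrary sequences in (x_1, ..., x_n), neither homogeneous nor inside
  K[Z], which cannot be exchanged for the variables of Z by hand. Cohomology mediates: an f that is
  regular on M acts injectively on the lowest cohomology not yet known to vanish, whereas a power of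
  f lies in (Z) modulo I and acts as zero. Cochains are functions into U, and all identities are
  read modulo ideals between I and U, so neither quotients nor Tor groups are formed.\<close>

definition ideal_set :: "'a::comm_ring_1 set \<Rightarrow> bool"
  where "ideal_set N \<longleftrightarrow> 0 \<in> N \<and> (\<forall>a\<in>N. \<forall>b\<in>N. a + b \<in> N) \<and> (\<forall>r. \<forall>a\<in>N. r * a \<in> N)"

lemma ideal_setD:
  assumes "ideal_set N"
  shows "0 \<in> N" "a \<in> N \<Longrightarrow> b \<in> N \<Longrightarrow> a + b \<in> N" "a \<in> N \<Longrightarrow> r * a \<in> N" "a \<in> N \<Longrightarrow> a * r \<in> N"
    "a \<in> N \<Longrightarrow> - a \<in> N" "a \<in> N \<Longrightarrow> b \<in> N \<Longrightarrow> a - b \<in> N"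
proof -
  show *: "0 \<in> N" "\<And>a b. a \<in> N \<Longrightarrow> b \<in> N \<Longrightarrow> a + b \<in> N" "\<And>r a. a \<in> N \<Longrightarrow> r * a \<in> N"
    using assms by (auto simp: ideal_set_def)
  show "a \<in> N \<Longrightarrow> a * r \<in> N" using *(3)[of a r] by (simp add: mult.commute)
  show neg: "\<And>a. a \<in> N \<Longrightarrow> - a \<in> N" using *(3)[of _ "-1"] by simp
  show "a \<in> N \<Longrightarrow> b \<in> N \<Longrightarrow> a - b \<in> N" using *(2)[of a "- b"] neg by simp
qed

lemma ideal_set_sum:
  assumes "ideal_set N" and "\<And>i. i \<in> A \<Longrightarrow> g i \<in> N"
  shows "sum g A \<in> N"
  using assms(2) by (induction A rule: infinite_finite_induct) (auto intro: ideal_setD[OF assms(1)])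

text \<open>The exterior algebra sign of e_a inside e_A. The index type carries no order, so
  positions are compared along \<open>to_nat\<close>.\<close>

definition koszul_sign :: "'n::finite \<Rightarrow> 'n set \<Rightarrow> 'a::comm_ring_1"
  where "koszul_sign a A = (- 1) ^ card {b \<in> A. to_nat b < to_nat a}"

text \<open>
  Cochains of all degrees are treated at once, as functions on the subsets of the index type;
  an index that is to be left out is given the ring element \<open>0\<close>.
\<close>

definition koszul_d :: "('n::finite \<Rightarrow> 'a::comm_ring_1) \<Rightarrow> ('n set \<Rightarrow> 'a) \<Rightarrow> 'n set \<Rightarrow> 'a"
  where "koszul_d x \<phi> A = (\<Sum>a\<in>A. koszul_sign a A * x a * \<phi> (A - {a}))"

text \<open>Interior product with the dual of e_z, the homotopy for multiplication by
  \<open>x z\<close>.\<close>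

definition koszul_contract :: "'n::finite \<Rightarrow> ('n set \<Rightarrow> 'a::comm_ring_1) \<Rightarrow> 'n set \<Rightarrow> 'a"
  where "koszul_contract z \<phi> A = (if z \<in> A then 0 else koszul_sign z (insert z A) * \<phi> (insert z A))"

lemma koszul_sign_square [simp]: "koszul_sign a A * koszul_sign a A = (1::'a::comm_ring_1)"
  by (simp add: koszul_sign_def flip: power_add mult_2)

lemma koszul_sign_square_left [simp]:
  "koszul_sign a A * (koszul_sign a A * r) = (r::'a::comm_ring_1)"
  by (simp flip: mult.assoc)

text \<open>Deleting the earlier of the two indices moves the later one by one place, while deleting
  the later leaves the earlier where it is. This single shift is the minus sign.\<close>

lemma koszul_sign_swap:
  assumes "a \<in> A" "b \<in> A" "a \<noteq> b"
  shows "koszul_sign a A * koszul_sign b (A - {a})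
    = - (koszul_sign b A * koszul_sign a (A - {b}) :: 'a::comm_ring_1)"
proof -
  have *: "koszul_sign a A * koszul_sign b (A - {a})
      = - (koszul_sign b A * koszul_sign a (A - {b}) :: 'a)"
    if "a \<in> A" "b \<in> A" "to_nat a < to_nat b" for a b
  proof -
    have 1: "{c \<in> A - {b}. to_nat c < to_nat a} = {c \<in> A. to_nat c < to_nat a}"
      using that by auto
    have 2: "{c \<in> A. to_nat c < to_nat b} = insert a {c \<in> A - {a}. to_nat c < to_nat b}"
      using that by auto
    have "card {c \<in> A. to_nat c < to_nat b} = Suc (card {c \<in> A - {a}. to_nat c < to_nat b})"
      unfolding 2 by (subst card_insert_disjoint) auto
    then show ?thesis unfolding koszul_sign_def 1 by simp
  qed
  have "to_nat a < to_nat b \<or> to_nat b < to_nat a"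
    using assms(3) by (metis linorder_neqE_nat inj_to_nat injD)
  then show ?thesis using *[of a b] *[of b a] assms(1,2) by auto
qed

text \<open>The ordered pairs are split by which index comes first under \<open>to_nat\<close>, and
  the two halves cancel. Adding the sum to itself would only show that its double is zero, which
  says nothing in characteristic 2.\<close>

lemma antisymmetric_sum_eq_0:
  fixes g :: "'n::finite \<Rightarrow> 'n \<Rightarrow> 'a::ab_group_add"
  assumes "\<And>a b. a \<in> A \<Longrightarrow> b \<in> A \<Longrightarrow> a \<noteq> b \<Longrightarrow> g a b = - g b a"
  shows "(\<Sum>a\<in>A. \<Sum>b\<in>A - {a}. g a b) = 0"
proof -
  have split: "A - {a} = {b\<in>A. to_nat a < to_nat b} \<union> {b\<in>A. to_nat b < to_nat a}" for a
    by (auto) (metis linorder_neqE_nat inj_to_nat injD)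
  have "(\<Sum>a\<in>A. \<Sum>b\<in>A - {a}. g a b)
      = (\<Sum>a\<in>A. \<Sum>b\<in>{b\<in>A. to_nat a < to_nat b}. g a b) + (\<Sum>a\<in>A. \<Sum>b\<in>{b\<in>A. to_nat b < to_nat a}. g a b)"
    unfolding split by (subst sum.union_disjoint) (auto simp: sum.distrib)
  also have "(\<Sum>a\<in>A. \<Sum>b\<in>{b\<in>A. to_nat b < to_nat a}. g a b) = (\<Sum>b\<in>A. \<Sum>a\<in>{a\<in>A. to_nat b < to_nat a}. g a b)"
    by (rule sum.swap_restrict) auto
  also have "\<dots> = (\<Sum>b\<in>A. \<Sum>a\<in>{a\<in>A. to_nat b < to_nat a}. - g b a)"
    by (intro sum.cong refl) (use assms in auto)
  finally show ?thesis by (simp add: sum_negf)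
qed

lemma koszul_d_d: "koszul_d x (koszul_d x \<phi>) A = 0"
proof -
  have "koszul_d x (koszul_d x \<phi>) A
     = (\<Sum>a\<in>A. \<Sum>b\<in>A - {a}. koszul_sign a A * koszul_sign b (A - {a}) * (x a * x b * \<phi> (A - {a} - {b})))"
    by (simp add: koszul_d_def sum_distrib_left algebra_simps)
  also have "\<dots> = 0"
  proof (rule antisymmetric_sum_eq_0)
    fix a b assume "a \<in> A" "b \<in> A" "a \<noteq> b"
    moreover have "A - {a} - {b} = A - {b} - {a}" by auto
    ultimately show "koszul_sign a A * koszul_sign b (A - {a}) * (x a * x b * \<phi> (A - {a} - {b}))
       = - (koszul_sign b A * koszul_sign a (A - {b}) * (x b * x a * \<phi> (A - {b} - {a})))"
      by (simp add: koszul_sign_swap[of a A b] mult.commute)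
  qed
  finally show ?thesis .
qed

lemma koszul_d_add: "koszul_d x (\<lambda>B. \<phi> B + \<psi> B) A = koszul_d x \<phi> A + koszul_d x \<psi> A"
  by (simp add: koszul_d_def algebra_simps sum.distrib)

lemma koszul_d_scale: "koszul_d x (\<lambda>B. r * \<phi> B) A = r * koszul_d x \<phi> A"
  by (simp add: koszul_d_def algebra_simps sum_distrib_left)

lemma koszul_d_sum: "koszul_d x (\<lambda>B. \<Sum>z\<in>Z. \<phi> z B) A = (\<Sum>z\<in>Z. koszul_d x (\<phi> z) A)"
  by (simp add: koszul_d_def sum_distrib_left) (rule sum.swap)

lemma koszul_d_in:
  assumes "ideal_set N" "\<And>B. \<phi> B \<in> N"
  shows "koszul_d x \<phi> A \<in> N"
  unfolding koszul_d_def by (intro ideal_set_sum[OF assms(1)] ideal_setD(3)[OF assms(1)] assms(2))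

text \<open>Each \<open>x\<^sub>z\<close> is null-homotopic, hence acts as zero on the cohomology.\<close>

lemma koszul_homotopy:
  fixes x :: "'n::finite \<Rightarrow> 'a::comm_ring_1"
  shows
  "x z * \<phi> A = koszul_d x (koszul_contract z \<phi>) A + koszul_contract z (koszul_d x \<phi>) A"
proof (cases "z \<in> A")
  case True
  have "koszul_d x (koszul_contract z \<phi>) A
      = (\<Sum>a\<in>A. if a = z then koszul_sign z A * x z * (koszul_sign z A * \<phi> A) else 0)"
    unfolding koszul_d_def koszul_contract_def using True
    by (intro sum.cong) (auto simp: insert_absorb)
  then show ?thesis using True
    by (simp add: koszul_contract_def algebra_simps)
next
  case False
  have "koszul_contract z (koszul_d x \<phi>) A
     = koszul_sign z (insert z A) * (\<Sum>a\<in>insert z A. koszul_sign a (insert z A) * x a * \<phi> (insert z A - {a}))"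
    using False by (simp add: koszul_contract_def koszul_d_def)
  also have "\<dots> = x z * \<phi> A + (\<Sum>a\<in>A. koszul_sign z (insert z A) * koszul_sign a (insert z A) * x a * \<phi> (insert z A - {a}))"
    using False by (subst sum.insert) (auto simp: algebra_simps sum_distrib_left)
  finally have 1: "koszul_contract z (koszul_d x \<phi>) A = x z * \<phi> A
     + (\<Sum>a\<in>A. koszul_sign z (insert z A) * koszul_sign a (insert z A) * x a * \<phi> (insert z A - {a}))" .
  have "koszul_d x (koszul_contract z \<phi>) A
     = (\<Sum>a\<in>A. - (koszul_sign z (insert z A) * koszul_sign a (insert z A) * x a * \<phi> (insert z A - {a})))"
    unfolding koszul_d_def
  proof (intro sum.cong refl)
    fix a assume a: "a \<in> A"
    with False have ne: "z \<noteq> a" by auto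
    have i: "insert z (A - {a}) = insert z A - {a}" using ne by auto
    have j: "insert z A - {z} = A" using False by auto
    have s: "koszul_sign z (insert z A) * koszul_sign a A
       = - (koszul_sign a (insert z A) * koszul_sign z (insert z A - {a}) :: 'a)"
      using koszul_sign_swap[of z "insert z A" a] a ne j by auto
    \<comment> \<open>The swap rule \<open>s\<close> has one sign on the wrong side; inserting a
      squared sign, which is 1, solves for the product needed below.\<close>
    have "koszul_sign a A * koszul_sign z (insert z A - {a})
       = ((koszul_sign z (insert z A) * (koszul_sign z (insert z A) * koszul_sign a A)) * koszul_sign z (insert z A - {a}) :: 'a)"
      by simp
    also have "\<dots> = - (koszul_sign z (insert z A) * koszul_sign a (insert z A))"
      unfolding s by (simp add: algebra_simps)
    finally have t: "koszul_sign a A * koszul_sign z (insert z A - {a})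
        = - (koszul_sign z (insert z A) * koszul_sign a (insert z A) :: 'a)" .
    have "koszul_sign a A * x a * koszul_contract z \<phi> (A - {a})
       = (koszul_sign a A * koszul_sign z (insert z A - {a})) * (x a * \<phi> (insert z A - {a}))"
      using False a by (simp add: koszul_contract_def i algebra_simps)
    then show "koszul_sign a A * x a * koszul_contract z \<phi> (A - {a})
      = - (koszul_sign z (insert z A) * koszul_sign a (insert z A) * x a * \<phi> (insert z A - {a}))"
      unfolding t by (simp add: algebra_simps)
  qed
  then show ?thesis unfolding 1 by (simp add: sum_negf)
qed

text \<open>\<open>U\<close> modulo \<open>N j\<close> stands for M/(f_0, ..., f_{j-1})M. The
  assumption \<open>nilpotent\<close> places a power of \<open>f j\<close> in the ideal of the
  \<open>x z\<close>, up to an element that kills \<open>U\<close> modulo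
  \<open>N j\<close>.\<close>

locale weak_regular_chain =
  fixes x :: "'n::finite \<Rightarrow> 'a::comm_ring_1" and U :: "'a set" and N :: "nat \<Rightarrow> 'a set"
    and f :: "nat \<Rightarrow> 'a" and r :: nat
  assumes U: "ideal_set U" and N: "ideal_set (N j)"
    and nonzerodivisor: "j < r \<Longrightarrow> u \<in> U \<Longrightarrow> f j * u \<in> N j \<Longrightarrow> u \<in> N j"
    and N_Suc: "N (Suc j) = {n + f j * u | n u. n \<in> N j \<and> u \<in> U}"
    and nilpotent: "j < r \<Longrightarrow> \<exists>D c i. f j ^ D = (\<Sum>z\<in>UNIV. c z * x z) + i \<and> (\<forall>u\<in>U. i * u \<in> N j)"
begin

text \<open>The long exact sequence of multiplication by \<open>f j\<close> on U / N j, read off on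
  elements: vanishing at j + 1 one degree lower makes \<open>f j\<close> injective on cohomology at
  j, where one of its powers acts as zero. \<open>p\<close> is one more than the degree, so that the
  induction starts in degree -1, where every cochain is zero.\<close>

lemma cocycle_is_coboundary:
  assumes "p + j \<le> r" "\<And>A. \<phi> A \<in> U" "\<And>A. \<phi> A \<noteq> 0 \<Longrightarrow> card A + 1 = p"
    and "\<And>A. koszul_d x \<phi> A \<in> N j"
  obtains \<psi> where "\<And>A. \<psi> A \<in> U" "\<And>A. \<psi> A \<noteq> 0 \<Longrightarrow> card A + 2 = p"
    "\<And>A. \<phi> A - koszul_d x \<psi> A \<in> N j"
proof -
  define cob where "cob p j \<phi> \<longleftrightarrow> (\<exists>\<psi>. (\<forall>A. \<psi> A \<in> U) \<and> (\<forall>A. \<psi> A \<noteq> 0 \<longrightarrow> card A + 2 = p) \<and>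
    (\<forall>A. \<phi> A - koszul_d x \<psi> A \<in> N j))" for p j and \<phi> :: "'n set \<Rightarrow> 'a"
  have "cob p j \<phi>" using assms
  proof (induction p arbitrary: j \<phi>)
    case 0
    then have "\<phi> A = 0" for A by fastforce
    then show ?case unfolding cob_def
      by (intro exI[of _ "\<lambda>_. 0"]) (auto simp: koszul_d_def ideal_setD(1)[OF U] ideal_setD(1)[OF N])
  next
    case (Suc p)
    note U' = ideal_setD[OF U] and N' = ideal_setD[OF N]
    from Suc.prems(1) have j: "j < r" by simp
    \<comment> \<open>Injectivity of \<open>f j\<close> on cohomology. If f_j \<phi> = d \<psi>
      modulo N_j, then \<psi> is a cocycle modulo N_{j+1}, hence \<psi> = d \<eta> + n + f_j u by
      the induction hypothesis. Applying d leaves f_j (\<phi> - d u) in N_j, and f_j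
      cancels.\<close>
    have inj: "cob (Suc p) j \<phi>"
      if "\<And>A. \<phi> A \<in> U" and \<phi>: "cob (Suc p) j (\<lambda>A. f j * \<phi> A)"
        and "\<And>A. \<phi> A \<noteq> 0 \<Longrightarrow> card A + 1 = Suc p" for \<phi>
    proof -
      from \<phi> obtain \<psi> where \<psi>: "\<And>A. \<psi> A \<in> U" "\<And>A. \<psi> A \<noteq> 0 \<Longrightarrow> card A + 1 = p"
        "\<And>A. f j * \<phi> A - koszul_d x \<psi> A \<in> N j" unfolding cob_def by fastforce
      have "koszul_d x \<psi> A \<in> N (Suc j)" for A
      proof -
        have "koszul_d x \<psi> A = - (f j * \<phi> A - koszul_d x \<psi> A) + f j * \<phi> A" by simp
        then show ?thesis unfolding N_Suc using that(1) N'(5)[OF \<psi>(3)] by blast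
      qed
      with Suc.IH[of "Suc j" \<psi>] \<psi> Suc.prems(1) have "cob p (Suc j) \<psi>" by simp
      then obtain \<eta> where \<eta>: "\<And>A. \<psi> A - koszul_d x \<eta> A \<in> N (Suc j)"
        unfolding cob_def by blast
      then have "\<forall>A. \<exists>n u. \<psi> A - koszul_d x \<eta> A = n + f j * u \<and> n \<in> N j \<and> u \<in> U"
        unfolding N_Suc by fast
      then obtain n u where nu: "\<And>A. \<psi> A - koszul_d x \<eta> A = n A + f j * u A"
        "\<And>A. n A \<in> N j" "\<And>A. u A \<in> U" by metis
      \<comment> \<open>\<open>u\<close> was chosen set by set without regard to degree; only its
        part in degree p - 1 may serve as a primitive.\<close>
      define u' where "u' A = (if card A + 1 = p then u A else 0)" for A :: "'n set"
      have d\<psi>: "koszul_d x \<psi> A = koszul_d x n A + f j * koszul_d x u A" for A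
      proof -
        have e: "\<psi> = (\<lambda>B. koszul_d x \<eta> B + (n B + f j * u B))"
          using nu(1) by (auto simp: fun_eq_iff algebra_simps)
        show ?thesis by (subst e) (simp add: koszul_d_add koszul_d_scale koszul_d_d)
      qed
      have "f j * (\<phi> A - koszul_d x u A) \<in> N j" for A
      proof -
        have "f j * (\<phi> A - koszul_d x u A) = (f j * \<phi> A - koszul_d x \<psi> A) + koszul_d x n A"
          unfolding d\<psi> by (simp add: algebra_simps)
        then show ?thesis using N'(2)[OF \<psi>(3) koszul_d_in[where \<phi> = n, OF N nu(2)]] by simp
      qed
      then have *: "\<phi> A - koszul_d x u A \<in> N j" for A
        using nonzerodivisor[OF j U'(6)[OF that(1) koszul_d_in[where \<phi> = u, OF U nu(3)]]] by simp
      have d: "koszul_d x u' A = (if card A = p then koszul_d x u A else 0)" for A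
      proof -
        have "card (A - {a}) + 1 = card A" if "a \<in> A" for a
          using card_Suc_Diff1[of A a] that by (simp del: card_Diff_insert)
        then have "u' (A - {a}) = (if card A = p then u (A - {a}) else 0)" if "a \<in> A" for a
          using that by (simp add: u'_def)
        then show ?thesis by (simp add: koszul_d_def cong: sum.cong)
      qed
      have "\<phi> A - koszul_d x u' A \<in> N j" for A
        using *[of A] that(3)[of A] N'(1)[of j] unfolding d by (cases "\<phi> A = 0") auto
      then show ?thesis unfolding cob_def
        by (intro exI[of _ u']) (auto simp: u'_def nu(3) U'(1))
    qed
    note prems = Suc.prems
    have powers: "cob (Suc p) j \<phi>" if "cob (Suc p) j (\<lambda>A. f j ^ D * \<phi> A)" for D
      using that
    proof (induction D)
      case (Suc D)
      have "cob (Suc p) j (\<lambda>A. f j ^ D * \<phi> A)"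
      proof (rule inj)
        show "cob (Suc p) j (\<lambda>A. f j * (f j ^ D * \<phi> A))" using Suc.prems by (simp add: mult.assoc)
        show "card A + 1 = Suc p" if "f j ^ D * \<phi> A \<noteq> 0" for A
          by (rule prems(3)) (use that in auto)
      qed (rule U'(3)[OF prems(2)])
      then show ?case by (rule Suc.IH)
    qed simp
    from nilpotent[OF j] obtain D c i where
      D: "f j ^ D = (\<Sum>z\<in>UNIV. c z * x z) + i" "\<And>u. u \<in> U \<Longrightarrow> i * u \<in> N j" by blast
    \<comment> \<open>Combining the contractions with the coefficients of \<open>f j ^ D\<close>
      gives a null-homotopy of that power, up to the term \<open>i\<close>, which kills U modulo
      N_j.\<close>
    define \<psi> where "\<psi> A = (\<Sum>z\<in>UNIV. c z * koszul_contract z \<phi> A)" for A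
    have "f j ^ D * \<phi> A - koszul_d x \<psi> A \<in> N j" for A
    proof -
      have "f j ^ D * \<phi> A = (\<Sum>z\<in>UNIV. c z * (x z * \<phi> A)) + i * \<phi> A"
        unfolding D(1) by (simp add: algebra_simps sum_distrib_left)
      also have "\<dots> = koszul_d x \<psi> A + ((\<Sum>z\<in>UNIV. c z * koszul_contract z (koszul_d x \<phi>) A) + i * \<phi> A)"
        unfolding koszul_homotopy[of x _ \<phi>] \<psi>_def koszul_d_sum koszul_d_scale
        by (simp add: algebra_simps sum.distrib)
      finally have "f j ^ D * \<phi> A - koszul_d x \<psi> A
          = (\<Sum>z\<in>UNIV. c z * koszul_contract z (koszul_d x \<phi>) A) + i * \<phi> A" by simp
      also have "\<dots> \<in> N j"
      proof (intro N'(2) D(2) prems(2) ideal_set_sum[OF N] N'(3))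
        show "koszul_contract z (koszul_d x \<phi>) A \<in> N j" for z
          unfolding koszul_contract_def using N'(1) N'(3)[OF prems(4)] by simp
      qed
      finally show ?thesis .
    qed
    moreover have "\<psi> A \<in> U" for A
      unfolding \<psi>_def koszul_contract_def
      using U'(1) U'(3)[OF prems(2)] by (intro ideal_set_sum[OF U] U'(3)) simp
    moreover have "card A + 2 = Suc p" if "\<psi> A \<noteq> 0" for A
    proof -
      from that obtain z where "c z * koszul_contract z \<phi> A \<noteq> 0"
        unfolding \<psi>_def by (rule sum.not_neutral_contains_not_neutral)
      then have "koszul_contract z \<phi> A \<noteq> 0" by auto
      then have "z \<notin> A" "\<phi> (insert z A) \<noteq> 0" by (auto simp: koszul_contract_def split: if_splits)
      with prems(3)[of "insert z A"] show ?thesis by simp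
    qed
    ultimately have "cob (Suc p) j (\<lambda>A. f j ^ D * \<phi> A)" unfolding cob_def by blast
    then show ?case by (rule powers)
  qed
  then show thesis using that unfolding cob_def by blast
qed

end

section \<open>Monomial ideals and their exponents\<close>

lemma mpoly_ring_simps [simp]:
  "carrier (mpoly_ring :: ('n::finite, 'k::field) mpoly ring) = UNIV"
  "(f :: ('n, 'k) mpoly) \<otimes>\<^bsub>mpoly_ring\<^esub> g = f * g"
  "(f :: ('n, 'k) mpoly) \<oplus>\<^bsub>mpoly_ring\<^esub> g = f + g"
  "\<zero>\<^bsub>mpoly_ring\<^esub> = (0 :: ('n, 'k) mpoly)"
  "\<one>\<^bsub>mpoly_ring\<^esub> = (1 :: ('n, 'k) mpoly)"
  by (simp_all add: ring_of_type_algebra_def)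

lemma cring_mpoly: "cring (mpoly_ring :: ('n::finite, 'k::field) mpoly ring)"
  by (rule cring_from_type_algebra)

lemma mpoly_ring_pow [simp]: "(f :: ('n::finite, 'k::field) mpoly) [^]\<^bsub>mpoly_ring\<^esub> (m::nat) = f ^ m"
  by (induction m) (simp_all add: nat_pow_def mult.commute)

lemma ideal_mpoly_iff: "ideal N (mpoly_ring :: ('n::finite, 'k::field) mpoly ring) \<longleftrightarrow> ideal_set N"
proof
  assume "ideal N (mpoly_ring :: ('n, 'k) mpoly ring)"
  then interpret ideal N "mpoly_ring :: ('n, 'k) mpoly ring" .
  show "ideal_set N"
    unfolding ideal_set_def
  proof (intro conjI ballI allI)
    show "0 \<in> N" using additive_subgroup.zero_closed[OF is_additive_subgroup] by simp
    show "a + b \<in> N" if "a \<in> N" "b \<in> N" for a b using additive_subgroup.a_closed[OF is_additive_subgroup that] by simp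
    show "r * a \<in> N" if "a \<in> N" for r a using I_l_closed[OF that, of r] by simp
  qed
next
  assume N: "ideal_set N"
  interpret cring "mpoly_ring :: ('n, 'k) mpoly ring" by (rule cring_mpoly)
  show "ideal N (mpoly_ring :: ('n, 'k) mpoly ring)"
  proof (rule idealI[OF ring_axioms])
    show "subgroup N (add_monoid mpoly_ring)"
    proof (rule add.subgroupI)
      fix a assume "a \<in> N"
      moreover have "\<ominus>\<^bsub>mpoly_ring\<^esub> a = - a" by (rule add.inv_equality) auto
      ultimately show "\<ominus>\<^bsub>mpoly_ring\<^esub> a \<in> N" using ideal_setD[OF N] by simp
    qed (use ideal_setD[OF N] in auto)
  qed (use ideal_setD[OF N] in auto)
qed

definition up_closed :: "('n::finite \<Rightarrow>\<^sub>0 nat) set \<Rightarrow> bool"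
  where "up_closed E \<longleftrightarrow> (\<forall>s\<in>E. \<forall>u. s + u \<in> E)"

lemma up_closedD: "up_closed E \<Longrightarrow> s \<in> E \<Longrightarrow> s + u \<in> E" "up_closed E \<Longrightarrow> s \<in> E \<Longrightarrow> u + s \<in> E"
  by (auto simp: up_closed_def add.commute)

text \<open>For up-closed \<open>E\<close> these are exactly the monomial ideals, so membership in
  one becomes a condition on \<open>keys\<close>.\<close>

definition supported_in :: "('n::finite \<Rightarrow>\<^sub>0 nat) set \<Rightarrow> ('n, 'k::field) mpoly set"
  where "supported_in E = {f. Poly_Mapping.keys f \<subseteq> E}"

definition exponents :: "('n::finite, 'k::field) mpoly set \<Rightarrow> ('n \<Rightarrow>\<^sub>0 nat) set"
  where "exponents I = {t. monomial t \<in> I}"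

lemma monomial_mult [simp]: "monomial s * monomial t = (monomial (s + t) :: ('n::finite, 'k::field) mpoly)"
  by (simp add: monomial_def mult_single)

lemma monomial_0: "monomial 0 = (1 :: ('n::finite, 'k::field) mpoly)"
  by (simp add: monomial_def)

lemma keys_monomial [simp]: "Poly_Mapping.keys (monomial t :: ('n::finite, 'k::field) mpoly) = {t}"
  by (simp add: monomial_def)

lemma lookup_monomial_mult:
  "Poly_Mapping.lookup (monomial s * f) (s + t) = Poly_Mapping.lookup (f :: ('n::finite, 'k::field) mpoly) t"
  by (simp add: monomial_def lookup_mult lookup_single when_mult)

lemma mpoly_eq_sum_monomials:
  "f = (\<Sum>t\<in>Poly_Mapping.keys f. Poly_Mapping.single 0 (Poly_Mapping.lookup f t) * monomial t)"
  for f :: "('n::finite, 'k::field) mpoly"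
  by (rule poly_mapping_eqI)
    (simp add: monomial_def mult_single lookup_sum lookup_single when_def not_in_keys_iff_lookup_eq_zero)

lemma mpoly_ideal_induct:
  fixes f :: "('n::finite, 'k::field) mpoly"
  assumes N: "ideal_set N" and "\<And>t. t \<in> Poly_Mapping.keys f \<Longrightarrow> monomial t \<in> N"
  shows "f \<in> N"
  by (subst mpoly_eq_sum_monomials) (intro ideal_set_sum[OF N] ideal_setD(3)[OF N] assms(2))

lemma keys_monomial_mult:
  "Poly_Mapping.keys (monomial s * f) = (+) s ` Poly_Mapping.keys (f :: ('n::finite, 'k::field) mpoly)"
proof
  show "Poly_Mapping.keys (monomial s * f) \<subseteq> (+) s ` Poly_Mapping.keys f"
    using keys_mult[of "monomial s" f] by auto
  show "(+) s ` Poly_Mapping.keys f \<subseteq> Poly_Mapping.keys (monomial s * f)"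
    by (auto simp: in_keys_iff lookup_monomial_mult)
qed

lemma supported_in_ideal: "up_closed E \<Longrightarrow> ideal_set (supported_in E :: ('n::finite, 'k::field) mpoly set)"
  unfolding ideal_set_def
proof (intro conjI ballI allI)
  fix f g :: "('n, 'k) mpoly" assume f: "f \<in> supported_in E"
  show "f + g \<in> supported_in E" if "g \<in> supported_in E"
    using f that keys_add[of f g] by (auto simp: supported_in_def)
  show "g * f \<in> supported_in E" if "up_closed E"
    using f keys_mult[of g f] that by (fastforce simp: supported_in_def up_closed_def add.commute)
qed (simp add: supported_in_def)

lemma exponents_up_closed: "ideal_set I \<Longrightarrow> up_closed (exponents I)"
  using ideal_setD(4)[of I "monomial s" "monomial u" for s u] by (auto simp: up_closed_def exponents_def)

lemma exponents_supported_in [simp]: "exponents (supported_in E) = E"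
  by (simp add: exponents_def supported_in_def)

lemma genideal_monomials:
  "Idl\<^bsub>mpoly_ring\<^esub> (monomial ` T) = (supported_in {s + u | s u. s \<in> T} :: ('n::finite, 'k::field) mpoly set)"
proof -
  interpret cring "mpoly_ring :: ('n, 'k) mpoly ring" by (rule cring_mpoly)
  have up: "up_closed {s + u | s u. s \<in> T}" unfolding up_closed_def using add.assoc by blast
  show ?thesis
  proof
    show "Idl\<^bsub>mpoly_ring\<^esub> (monomial ` T) \<subseteq> (supported_in {s + u | s u. s \<in> T} :: ('n, 'k) mpoly set)"
    proof (rule genideal_minimal)
      show "monomial ` T \<subseteq> (supported_in {s + u | s u. s \<in> T} :: ('n, 'k) mpoly set)"
      proof clarify
        fix s assume "s \<in> T"
        then have "\<exists>s' u. s = s' + u \<and> s' \<in> T" by (metis add.right_neutral)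
        then show "monomial s \<in> supported_in {s + u | s u. s \<in> T}" by (simp add: supported_in_def)
      qed
    qed (simp only: ideal_mpoly_iff supported_in_ideal[OF up])
    have I: "ideal_set (Idl\<^bsub>mpoly_ring\<^esub> (monomial ` T :: ('n, 'k) mpoly set))"
      unfolding ideal_mpoly_iff[symmetric] by (rule genideal_ideal) simp
    have gen: "monomial s \<in> Idl\<^bsub>mpoly_ring\<^esub> (monomial ` T :: ('n, 'k) mpoly set)" if "s \<in> T" for s
      using genideal_self[of "monomial ` T"] that by auto
    have *: "monomial (s + u) \<in> Idl\<^bsub>mpoly_ring\<^esub> (monomial ` T :: ('n, 'k) mpoly set)" if "s \<in> T" for s u
      using ideal_setD(4)[OF I gen[OF that], of "monomial u"] by simp
    show "supported_in {s + u | s u. s \<in> T} \<subseteq> Idl\<^bsub>mpoly_ring\<^esub> (monomial ` T :: ('n, 'k) mpoly set)"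
    proof (rule subsetI, rule mpoly_ideal_induct[OF I])
      fix f :: "('n, 'k) mpoly" and t
      assume "f \<in> supported_in {s + u | s u. s \<in> T}" "t \<in> Poly_Mapping.keys f"
      then have "t \<in> {s + u | s u. s \<in> T}" unfolding supported_in_def by blast
      then obtain s u where "t = s + u" "s \<in> T" by blast
      with * show "monomial t \<in> Idl\<^bsub>mpoly_ring\<^esub> (monomial ` T :: ('n, 'k) mpoly set)" by simp
    qed
  qed
qed

lemma monomial_ideal_supported_in:
  "up_closed E \<Longrightarrow> monomial_ideal (supported_in E :: ('n::finite, 'k::field) mpoly set)"
proof -
  assume E: "up_closed E"
  have "{s + u | s u. s \<in> E} = E"
  proof
    show "E \<subseteq> {s + u | s u. s \<in> E}" by clarify (metis add.right_neutral)
  qed (use E in \<open>auto simp: up_closed_def\<close>)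
  then show ?thesis unfolding monomial_ideal_def genideal_monomials by (intro exI[of _ E]) simp
qed

lemma monomial_idealE:
  assumes "monomial_ideal (I :: ('n::finite, 'k::field) mpoly set)"
  shows "I = supported_in (exponents I)" "up_closed (exponents I)" "ideal_set I"
proof -
  from assms obtain T where I: "I = supported_in {s + u | s u. s \<in> T}"
    by (auto simp: monomial_ideal_def genideal_monomials)
  show "I = supported_in (exponents I)" unfolding I exponents_supported_in by (rule refl)
  have up: "up_closed {s + u | s u. s \<in> T}" unfolding up_closed_def using add.assoc by blast
  then show "up_closed (exponents I)" unfolding I exponents_supported_in .
  show "ideal_set I" unfolding I by (rule supported_in_ideal[OF up])
qed

section \<open>Prime ideals generated by variables\<close>

definition variable_prime :: "'n::finite set \<Rightarrow> ('n, 'k::field) mpoly set"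
  where "variable_prime V = supported_in {t. Poly_Mapping.keys t \<inter> V \<noteq> {}}"

lemma keys_add_nat: "Poly_Mapping.keys (s + u :: 'n \<Rightarrow>\<^sub>0 nat) = Poly_Mapping.keys s \<union> Poly_Mapping.keys u"
  by (auto simp: in_keys_iff lookup_add)

lemma variable_prime_up_closed: "up_closed {t. Poly_Mapping.keys t \<inter> V \<noteq> {}}"
  by (auto simp: up_closed_def keys_add_nat)

lemma variable_prime_ideal: "ideal_set (variable_prime V :: ('n::finite, 'k::field) mpoly set)"
  unfolding variable_prime_def by (intro supported_in_ideal variable_prime_up_closed)

lemma variable_prime_monomial: "monomial_ideal (variable_prime V)"
  unfolding variable_prime_def by (intro monomial_ideal_supported_in variable_prime_up_closed)

text \<open>The index type carries no order, so a monomial order is pulled back along \<open>to_nat\<close>.\<close>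

lemma exists_monomial_order:
  obtains w :: "('n::finite \<Rightarrow>\<^sub>0 nat) \<Rightarrow> (nat \<Rightarrow>\<^sub>0 nat)" where "inj w" "\<forall>s t. w (s + t) = w s + w t"
proof (rule that)
  let ?w = "\<lambda>t :: 'n \<Rightarrow>\<^sub>0 nat. \<Sum>i\<in>UNIV. Poly_Mapping.single (to_nat i) (Poly_Mapping.lookup t i)"
  show "\<forall>s t. ?w (s + t) = ?w s + ?w t"
    by (simp add: lookup_add single_add sum.distrib)
  have "Poly_Mapping.lookup (?w t) (to_nat i) = Poly_Mapping.lookup t i" for t i
    by (simp add: lookup_sum lookup_single when_def)
  then show "inj ?w" by (intro injI poly_mapping_eqI) metis
qed

text \<open>A polynomial outside the ideal has terms free of V. The largest such terms of f and g,
  for the monomial order pulled back along \<open>w\<close>, multiply to a term of f * g that is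
  again free of V and that nothing can cancel.\<close>

lemma variable_prime_primeideal:
  "primeideal (variable_prime V) (mpoly_ring :: ('n::finite, 'k::field) mpoly ring)"
proof -
  obtain w :: "('n \<Rightarrow>\<^sub>0 nat) \<Rightarrow> (nat \<Rightarrow>\<^sub>0 nat)" where w: "inj w" "\<forall>s t. w (s + t) = w s + w t"
    by (rule exists_monomial_order)
  have lead: "\<exists>a. a \<in> Poly_Mapping.keys f \<and> Poly_Mapping.keys a \<inter> V = {} \<and>
      (\<forall>t\<in>Poly_Mapping.keys f. Poly_Mapping.keys t \<inter> V = {} \<longrightarrow> t \<noteq> a \<longrightarrow> w t < w a)"
    if "f \<notin> variable_prime V" for f :: "('n, 'k) mpoly"
  proof -
    let ?A = "{t \<in> Poly_Mapping.keys f. Poly_Mapping.keys t \<inter> V = {}}"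
    have "?A \<noteq> {}" using that by (auto simp: variable_prime_def supported_in_def)
    then have "Max (w ` ?A) \<in> w ` ?A" by (intro Max_in) auto
    then obtain a where a: "a \<in> ?A" "w a = Max (w ` ?A)" by auto
    have "w t < w a" if "t \<in> ?A" "t \<noteq> a" for t
      using Max_ge[of "w ` ?A" "w t"] that a(2) w(1) by (auto simp: inj_def order.order_iff_strict)
    with a show ?thesis by blast
  qed
  have prime: "f * g \<notin> variable_prime V"
    if f: "f \<notin> variable_prime V" and g: "g \<notin> variable_prime V" for f g :: "('n, 'k) mpoly"
  proof -
    obtain a where a: "a \<in> Poly_Mapping.keys f" "Poly_Mapping.keys a \<inter> V = {}"
      "\<And>t. t \<in> Poly_Mapping.keys f \<Longrightarrow> Poly_Mapping.keys t \<inter> V = {} \<Longrightarrow> t \<noteq> a \<Longrightarrow> w t < w a"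
      using lead[OF f] by blast
    obtain b where b: "b \<in> Poly_Mapping.keys g" "Poly_Mapping.keys b \<inter> V = {}"
      "\<And>t. t \<in> Poly_Mapping.keys g \<Longrightarrow> Poly_Mapping.keys t \<inter> V = {} \<Longrightarrow> t \<noteq> b \<Longrightarrow> w t < w b"
      using lead[OF g] by blast
    define ca where "ca = Poly_Mapping.single a (Poly_Mapping.lookup f a)"
    define cb where "cb = Poly_Mapping.single b (Poly_Mapping.lookup g b)"
    \<comment> \<open>The exponent a + b arises from the two leading terms only: both factors are
      free of V because a + b is, and any other choice of them has a smaller sum under
      \<open>w\<close>.\<close>
    have unique: "t = a \<and> u = b"
      if "t \<in> Poly_Mapping.keys f" "u \<in> Poly_Mapping.keys g" "t + u = a + b" for t u
    proof -
      have "Poly_Mapping.keys t \<inter> V = {}" "Poly_Mapping.keys u \<inter> V = {}"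
        using that(3) a(2) b(2) by (metis Int_Un_distrib2 Un_empty keys_add_nat)+
      then have "w t < w a \<or> t = a" "w u < w b \<or> u = b" using a(3) b(3) that by auto
      moreover have "w t + w u = w a + w b" using that(3) w(2) by metis
      ultimately show ?thesis
        by (metis add_strict_mono less_irrefl add_less_cancel_left add_less_cancel_right)
    qed
    have kf: "Poly_Mapping.keys (f - ca) \<subseteq> Poly_Mapping.keys f - {a}"
      by (auto simp: ca_def in_keys_iff lookup_minus lookup_single when_def split: if_splits)
    have kg: "Poly_Mapping.keys (g - cb) \<subseteq> Poly_Mapping.keys g - {b}"
      by (auto simp: cb_def in_keys_iff lookup_minus lookup_single when_def split: if_splits)
    have kc: "Poly_Mapping.keys ca \<subseteq> Poly_Mapping.keys f"
      using a(1) by (auto simp: ca_def split: if_splits)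
    have "a + b \<notin> Poly_Mapping.keys ((f - ca) * g)"
      using keys_mult[of "f - ca" g] kf unique by fastforce
    moreover have "a + b \<notin> Poly_Mapping.keys (ca * (g - cb))"
      using keys_mult[of ca "g - cb"] kg kc unique by fastforce
    moreover have "Poly_Mapping.lookup (ca * cb) (a + b) \<noteq> 0"
      using a(1) b(1) by (simp add: ca_def cb_def mult_single in_keys_iff)
    moreover have "f * g = (f - ca) * g + ca * (g - cb) + ca * cb" by (simp add: algebra_simps)
    ultimately have "a + b \<in> Poly_Mapping.keys (f * g)"
      by (simp add: in_keys_iff lookup_add)
    moreover have "Poly_Mapping.keys (a + b) \<inter> V = {}" using a(2) b(2) by (auto simp: keys_add_nat)
    ultimately show ?thesis by (auto simp: variable_prime_def supported_in_def)
  qed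
  show ?thesis
  proof (rule primeidealI)
    show "ideal (variable_prime V) (mpoly_ring :: ('n, 'k) mpoly ring)"
      by (simp add: ideal_mpoly_iff variable_prime_ideal)
    show "cring (mpoly_ring :: ('n, 'k) mpoly ring)" by (rule cring_mpoly)
    have "(1 :: ('n, 'k) mpoly) \<notin> variable_prime V" by (simp add: variable_prime_def supported_in_def)
    then show "carrier mpoly_ring \<noteq> (variable_prime V :: ('n, 'k) mpoly set)" by auto
  qed (use prime in auto)
qed

lemma variable_prime_subset_iff:
  "variable_prime V \<subseteq> (variable_prime W :: ('n::finite, 'k::field) mpoly set) \<longleftrightarrow> V \<subseteq> W"
proof
  assume *: "variable_prime V \<subseteq> (variable_prime W :: ('n, 'k) mpoly set)"
  show "V \<subseteq> W"
  proof
    fix i assume "i \<in> V"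
    then have "(variable i :: ('n, 'k) mpoly) \<in> variable_prime V"
      by (simp add: variable_prime_def supported_in_def variable_def)
    with * have "(variable i :: ('n, 'k) mpoly) \<in> variable_prime W" by blast
    then show "i \<in> W" by (simp add: variable_prime_def supported_in_def variable_def split: if_splits)
  qed
qed (auto simp: variable_prime_def supported_in_def)

lemma variable_prime_subset:
  assumes "ideal_set N" "\<And>i. i \<in> V \<Longrightarrow> variable i \<in> N"
  shows "variable_prime V \<subseteq> (N :: ('n::finite, 'k::field) mpoly set)"
proof
  fix f :: "('n, 'k) mpoly" assume f: "f \<in> variable_prime V"
  show "f \<in> N"
  proof (rule mpoly_ideal_induct[OF assms(1)])
    fix t assume "t \<in> Poly_Mapping.keys f"
    with f obtain i where i: "i \<in> Poly_Mapping.keys t" "i \<in> V"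
      by (auto simp: variable_prime_def supported_in_def)
    have "t = Poly_Mapping.single i 1 + (t - Poly_Mapping.single i 1)"
      using i(1) by (intro poly_mapping_eqI) (auto simp: lookup_add lookup_minus lookup_single when_def in_keys_iff)
    then have "monomial t = (variable i * monomial (t - Poly_Mapping.single i 1) :: ('n, 'k) mpoly)"
      unfolding variable_def monomial_mult by simp
    then show "monomial t \<in> N" using ideal_setD(4)[OF assms(1) assms(2)[OF i(2)]] by simp
  qed
qed

lemma variable_power: "variable i ^ m = (monomial (Poly_Mapping.single i m) :: ('n::finite, 'k::field) mpoly)"
  by (induction m) (simp_all add: monomial_0 variable_def add.commute flip: single_add)

lemma sum_single: "t = (\<Sum>i\<in>UNIV. Poly_Mapping.single i (Poly_Mapping.lookup t i))"
  for t :: "'n::finite \<Rightarrow>\<^sub>0 nat"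
  by (rule poly_mapping_eqI) (simp add: lookup_sum lookup_single when_def)

text \<open>
  \<open>V\<close> is the set of variables in the radical; the other variables are nonzerodivisors modulo a
  primary ideal.
\<close>

lemma primary_monomial_idealE:
  assumes "primary_ideal mpoly_ring (I :: ('n::finite, 'k::field) mpoly set)"
  obtains V m where "\<And>i. i \<in> V \<Longrightarrow> Poly_Mapping.single i m \<in> exponents I"
    "\<And>t u. t + u \<in> exponents I \<Longrightarrow> Poly_Mapping.keys u \<inter> V = {} \<Longrightarrow> t \<in> exponents I"
proof -
  define V where "V = {i. \<exists>m. Poly_Mapping.single i m \<in> exponents I}"
  have I: "ideal_set I" using assms by (simp add: primary_ideal_def ideal_mpoly_iff)
  have "\<forall>i\<in>V. \<exists>m. Poly_Mapping.single i m \<in> exponents I" by (simp add: V_def)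
  then obtain k where k: "\<And>i. i \<in> V \<Longrightarrow> Poly_Mapping.single i (k i) \<in> exponents I" by metis
  \<comment> \<open>The sum is a crude common bound, so that one exponent serves all variables of
    V.\<close>
  define m where "m = (\<Sum>i\<in>UNIV. k i)"
  have 1: "Poly_Mapping.single i m \<in> exponents I" if "i \<in> V" for i
  proof -
    have "k i \<le> m" unfolding m_def by (rule member_le_sum) auto
    then have "Poly_Mapping.single i m = Poly_Mapping.single i (k i) + Poly_Mapping.single i (m - k i)"
      by (simp flip: single_add)
    then show ?thesis using up_closedD(1)[OF exponents_up_closed[OF I] k[OF that]] by simp
  qed
  \<comment> \<open>Primariness is applied to a single variable: no power of it lies in I, so it can
    be cancelled, and this is repeated \<open>c\<close> times.\<close>
  have step: "t \<in> exponents I" if "t + Poly_Mapping.single i c \<in> exponents I" "i \<notin> V" for t i c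
    using that(1)
  proof (induction c)
    case (Suc c)
    have "monomial (t + Poly_Mapping.single i c) * variable i \<in> I"
      using Suc.prems by (simp add: exponents_def variable_def add.assoc flip: single_add)
    moreover have "variable i ^ m \<notin> I" for m
      using that(2) by (auto simp: V_def variable_power exponents_def)
    ultimately have "t + Poly_Mapping.single i c \<in> exponents I"
      using assms unfolding primary_ideal_def by (auto simp: exponents_def)
    then show ?case by (rule Suc.IH)
  qed simp
  have 2: "t \<in> exponents I" if "t + u \<in> exponents I" "Poly_Mapping.keys u \<inter> V = {}" for t u
  proof -
    have "t \<in> exponents I" if "finite A" "A \<subseteq> Poly_Mapping.keys u"
      "t + (\<Sum>i\<in>A. Poly_Mapping.single i (Poly_Mapping.lookup u i)) \<in> exponents I" for A
      using that
    proof (induction A)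
      case (insert i A)
      then have "i \<notin> V" using \<open>Poly_Mapping.keys u \<inter> V = {}\<close> by auto
      with insert show ?case
        using step[of "t + (\<Sum>i\<in>A. Poly_Mapping.single i (Poly_Mapping.lookup u i))" i "Poly_Mapping.lookup u i"]
        by (simp add: add_ac)
    qed simp
    moreover have "u = (\<Sum>i\<in>Poly_Mapping.keys u. Poly_Mapping.single i (Poly_Mapping.lookup u i))"
      by (subst sum_single) (rule sum.mono_neutral_right, auto simp: in_keys_iff)
    ultimately show ?thesis using that(1) by (metis finite_keys order_refl)
  qed
  from 1 2 show thesis by (rule that)
qed

section \<open>Presentations of subquotients\<close>

text \<open>
  \<open>presents Q c U I\<close> says that \<open>c\<close> induces an isomorphism of the graded module \<open>U/I\<close> onto \<open>Q\<close>.
  It replaces computations with nested cosets by computations with polynomials.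
\<close>

definition presents ::
    "('n::finite, 'k::field, 'm) multigraded_module \<Rightarrow> (('n, 'k) mpoly \<Rightarrow> 'm) \<Rightarrow>
      ('n, 'k) mpoly set \<Rightarrow> ('n, 'k) mpoly set \<Rightarrow> bool"
  where "presents Q c U I \<longleftrightarrow> ideal_set U \<and> ideal_set I \<and> I \<subseteq> U \<and>
    carrier Q = c ` U \<and> \<zero>\<^bsub>Q\<^esub> = c 0 \<and>
    (\<forall>a\<in>U. \<forall>b\<in>U. c a \<oplus>\<^bsub>Q\<^esub> c b = c (a + b)) \<and>
    (\<forall>f. \<forall>a\<in>U. f \<odot>\<^bsub>Q\<^esub> c a = c (f * a)) \<and>
    (\<forall>a\<in>U. \<forall>b\<in>U. c a = c b \<longleftrightarrow> a - b \<in> I) \<and>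
    (\<forall>e. component Q e = c ` (U \<inter> component mpoly_module e))"

lemma presentsD:
  assumes "presents Q c U I"
  shows "ideal_set U" "ideal_set I" "I \<subseteq> U" "carrier Q = c ` U" "\<zero>\<^bsub>Q\<^esub> = c 0"
    "a \<in> U \<Longrightarrow> b \<in> U \<Longrightarrow> c a \<oplus>\<^bsub>Q\<^esub> c b = c (a + b)"
    "a \<in> U \<Longrightarrow> f \<odot>\<^bsub>Q\<^esub> c a = c (f * a)"
    "a \<in> U \<Longrightarrow> b \<in> U \<Longrightarrow> c a = c b \<longleftrightarrow> a - b \<in> I"
    "component Q e = c ` (U \<inter> component mpoly_module e)"
  using assms by (simp_all add: presents_def)

lemma presents_eq_zero: "presents Q c U I \<Longrightarrow> a \<in> U \<Longrightarrow> c a = c 0 \<longleftrightarrow> a \<in> I"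
  using presentsD(8)[of Q c U I a 0] ideal_setD(1)[OF presentsD(1), of Q c U I] by simp

lemma presents_mem_image:
  assumes Q: "presents Q c U I" and N: "ideal_set N" "I \<subseteq> N" "N \<subseteq> U" and "a \<in> U"
  shows "c a \<in> c ` N \<longleftrightarrow> a \<in> N"
proof
  assume "c a \<in> c ` N"
  then obtain n where n: "n \<in> N" "c a = c n" by blast
  then have "a - n \<in> N" using presentsD(8)[OF Q] assms by blast
  then show "a \<in> N" using ideal_setD(2)[OF N(1) _ n(1), of "a - n"] by simp
qed simp

lemma presents_mpoly: "presents mpoly_module id UNIV {0}"
  by (simp add: presents_def mpoly_module_def ideal_set_def)

text \<open>The third isomorphism theorem: the class of c a modulo the image of N is the image of
  the coset of a modulo N, because N contains I. Applied to \<open>mpoly_module\<close> it presents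
  \<open>ideal_quotient\<close>; applied once more it presents the factors of a filtration.\<close>

lemma presents_quotient:
  assumes Q: "presents Q c U I" and N: "ideal_set N" "ideal_set N'" "I \<subseteq> N" "N \<subseteq> N'" "N' \<subseteq> U"
  shows "presents (quotient_module (restrict_module Q (c ` N')) (c ` N)) (\<lambda>a. c ` (\<lambda>n. n + a) ` N) N' N"
proof -
  note q = presentsD[OF Q] and NI = ideal_setD[OF N(1)] and NI' = ideal_setD[OF N(2)]
  let ?R = "restrict_module Q (c ` N')"
  define k where "k a = c ` (\<lambda>n. n + a) ` N" for a
  have subs: "\<And>a. a \<in> N \<Longrightarrow> a \<in> N'" "\<And>a. a \<in> N' \<Longrightarrow> a \<in> U" using N by auto
  have car: "carrier ?R = c ` N'" "\<And>x y. x \<oplus>\<^bsub>?R\<^esub> y = x \<oplus>\<^bsub>Q\<^esub> y" "\<And>f x. f \<odot>\<^bsub>?R\<^esub> x = f \<odot>\<^bsub>Q\<^esub> x"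
    "\<And>e. component ?R e = component Q e \<inter> c ` N'"
    by (simp_all add: restrict_module_def)
  have coset: "(c ` N) +>\<^bsub>?R\<^esub> c a = k a" if "a \<in> N'" for a
    using that subs q(6) by (auto simp: a_r_coset_def' car k_def image_iff)
  have shift: "k (n + a) = k a" if "n \<in> N" for n a
  proof -
    have "(\<lambda>m. m + (n + a)) ` N = (\<lambda>m. m + a) ` N"
    proof
      show "(\<lambda>m. m + (n + a)) ` N \<subseteq> (\<lambda>m. m + a) ` N"
        using NI(2)[OF _ that] by (auto simp: image_iff simp flip: add.assoc)
      show "(\<lambda>m. m + a) ` N \<subseteq> (\<lambda>m. m + (n + a)) ` N"
      proof clarify
        fix m assume "m \<in> N"
        then have "m - n \<in> N" using NI(6) that by blast
        then show "m + a \<in> (\<lambda>m. m + (n + a)) ` N" by (rule rev_image_eqI) simp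
      qed
    qed
    then show ?thesis by (simp add: k_def)
  qed
  have mem: "c a \<in> k a" for a using NI(1) by (force simp: k_def)
  have add: "set_add ?R (k a) (k b) = k (a + b)" if "a \<in> N'" "b \<in> N'" for a b
  proof -
    have "c (n + a) \<oplus>\<^bsub>Q\<^esub> c (m + b) = c ((n + m) + (a + b))" if "n \<in> N" "m \<in> N" for n m
      using q(6)[of "n + a" "m + b"] that \<open>a \<in> N'\<close> \<open>b \<in> N'\<close> subs NI'(2) by (simp add: algebra_simps)
    then have "set_add ?R (k a) (k b) = (\<Union>n\<in>N. \<Union>m\<in>N. {c ((n + m) + (a + b))})"
      by (auto simp: set_add_def' car k_def)
    also have "\<dots> = k (a + b)"
    proof
      show "(\<Union>n\<in>N. \<Union>m\<in>N. {c ((n + m) + (a + b))}) \<subseteq> k (a + b)"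
        using NI(2) by (auto simp: k_def)
      show "k (a + b) \<subseteq> (\<Union>n\<in>N. \<Union>m\<in>N. {c ((n + m) + (a + b))})"
        using NI(1) by (force simp: k_def)
    qed
    finally show ?thesis .
  qed
  have smult: "(\<Union>x\<in>k a. (c ` N) +>\<^bsub>?R\<^esub> (f \<odot>\<^bsub>?R\<^esub> x)) = k (f * a)" if "a \<in> N'" for f a
  proof -
    have "(c ` N) +>\<^bsub>?R\<^esub> (f \<odot>\<^bsub>?R\<^esub> c (n + a)) = k (f * a)" if "n \<in> N" for n
    proof -
      have "n + a \<in> N'" using subs that \<open>a \<in> N'\<close> NI'(2) by blast
      then have "(c ` N) +>\<^bsub>?R\<^esub> (f \<odot>\<^bsub>?R\<^esub> c (n + a)) = k (f * n + f * a)"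
        using q(7) subs coset[OF NI'(3), of "n + a" f] by (simp add: car distrib_left)
      also have "\<dots> = k (f * a)" by (rule shift) (rule NI(3)[OF that])
      finally show ?thesis .
    qed
    then show ?thesis using NI(1) by (auto simp: k_def)
  qed
  have eq: "k a = k b \<longleftrightarrow> a - b \<in> N" if "a \<in> N'" "b \<in> N'" for a b
  proof
    assume "k a = k b"
    then have "c a \<in> k b" using mem by blast
    then obtain n where n: "n \<in> N" "c a = c (n + b)" by (auto simp: k_def)
    then have "a - (n + b) \<in> N" using q(8)[of a "n + b"] subs that NI'(2) N(3) by blast
    from NI(2)[OF this n(1)] show "a - b \<in> N" by (simp add: algebra_simps)
  next
    assume "a - b \<in> N" from shift[OF this, of b] show "k a = k b" by simp
  qed
  have comp: "(\<lambda>x. (c ` N) +>\<^bsub>?R\<^esub> x) ` component ?R e = k ` (N' \<inter> component mpoly_module e)" for e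
  proof -
    have "component Q e \<inter> c ` N' = c ` (N' \<inter> component mpoly_module e)"
      unfolding q(9) using presents_mem_image[OF Q N(2)] N subs by auto
    then show ?thesis using coset by (force simp: car image_image intro!: image_cong)
  qed
  show ?thesis
    unfolding presents_def k_def[symmetric]
  proof (intro conjI ballI allI)
    show "carrier (quotient_module ?R (c ` N)) = k ` N'"
      using coset by (auto simp: quotient_module_def A_RCOSETS_def' car)
    show "\<zero>\<^bsub>quotient_module ?R (c ` N)\<^esub> = k 0" by (simp add: quotient_module_def k_def)
    show "component (quotient_module ?R (c ` N)) e = k ` (N' \<inter> component mpoly_module e)" for e
      using comp by (simp add: quotient_module_def)
  qed (use N add smult eq in \<open>auto simp: quotient_module_def\<close>)
qed

lemma presents_ideal_quotient:
  assumes "ideal_set U" "ideal_set I" "I \<subseteq> U"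
  obtains c where "presents (ideal_quotient U I) c U I"
  using presents_quotient[OF presents_mpoly assms(2,1) _ assms(3)] ideal_setD(1)[OF assms(2)]
  by (auto simp: ideal_quotient_def)

lemma presents_quotient_mpoly:
  assumes "ideal_set I"
  obtains c where "presents (quotient_module mpoly_module I) c UNIV I"
proof -
  have "restrict_module mpoly_module UNIV = mpoly_module"
    by (simp add: restrict_module_def mpoly_module_def)
  then show thesis
    using presents_ideal_quotient[of UNIV I] assms that
    by (metis UNIV_I ideal_quotient_def ideal_set_def subset_UNIV)
qed

text \<open>\<open>W\<close> need only be closed under addition, because a Stanley space yK[Z] is in
  general no S-submodule. Freeness of such a space is stated with sums in the record whose carrier
  has been shrunk to it.\<close>

lemma presents_restrict_finsum:
  assumes Q: "presents Q c U I" and W: "W \<subseteq> U" "0 \<in> W" "\<And>a b. a \<in> W \<Longrightarrow> b \<in> W \<Longrightarrow> a + b \<in> W"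
  shows "abelian_monoid (Q\<lparr>carrier := c ` W\<rparr>)"
    and "finite A \<Longrightarrow> (\<And>i. i \<in> A \<Longrightarrow> g i \<in> W) \<Longrightarrow>
      finsum (Q\<lparr>carrier := c ` W\<rparr>) (\<lambda>i. c (g i)) A = c (\<Sum>i\<in>A. g i)"
proof -
  note q = presentsD[OF Q]
  have WU: "\<And>a. a \<in> W \<Longrightarrow> a \<in> U" using W(1) by auto
  show am: "abelian_monoid (Q\<lparr>carrier := c ` W\<rparr>)"
    by (rule abelian_monoidI) (use W WU q(5,6) in \<open>auto simp: algebra_simps\<close>)
  interpret abelian_monoid "Q\<lparr>carrier := c ` W\<rparr>" by (rule am)
  have "finsum (Q\<lparr>carrier := c ` W\<rparr>) (\<lambda>i. c (g i)) A = c (\<Sum>i\<in>A. g i) \<and> (\<Sum>i\<in>A. g i) \<in> W"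
    if "finite A" "\<And>i. i \<in> A \<Longrightarrow> g i \<in> W"
    using that
  proof (induction A)
    case empty
    then show ?case using W(2) q(5) by simp
  next
    case (insert j A)
    then show ?case using W(3) WU q(6) by (subst finsum_insert) auto
  qed
  then show "finite A \<Longrightarrow> (\<And>i. i \<in> A \<Longrightarrow> g i \<in> W) \<Longrightarrow>
      finsum (Q\<lparr>carrier := c ` W\<rparr>) (\<lambda>i. c (g i)) A = c (\<Sum>i\<in>A. g i)" by blast
qed

lemma presents_finsum:
  assumes Q: "presents Q c U I" and "finite A" "\<And>i. i \<in> A \<Longrightarrow> g i \<in> U"
  shows "finsum Q (\<lambda>i. c (g i)) A = c (\<Sum>i\<in>A. g i)"
proof -
  have "Q\<lparr>carrier := c ` U\<rparr> = Q" using presentsD(4)[OF Q] by simp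
  then show ?thesis
    using presents_restrict_finsum(2)[OF Q order_refl _ _ assms(2,3)] ideal_setD(1,2)[OF presentsD(1)[OF Q]]
    by simp
qed

lemma presents_module:
  assumes Q: "presents Q c U I"
  shows "module mpoly_ring Q"
proof -
  note q = presentsD[OF Q] and u = ideal_setD[OF presentsD(1)[OF Q]]
  have "abelian_group Q"
  proof (rule abelian_groupI)
    fix x assume "x \<in> carrier Q"
    then obtain a where "a \<in> U" "x = c a" by (auto simp: q(4))
    then show "\<exists>y\<in>carrier Q. y \<oplus>\<^bsub>Q\<^esub> x = \<zero>\<^bsub>Q\<^esub>"
      using u(5) q(4,5,6) by (intro bexI[of _ "c (- a)"]) auto
  qed (use u q(4,5,6) in \<open>auto simp: algebra_simps\<close>)
  then show ?thesis
    by (rule moduleI[OF cring_mpoly]) (use u q(4,6,7) in \<open>auto simp: distrib_left distrib_right mult.assoc\<close>)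
qed

lemma presents_annihilator:
  assumes Q: "presents Q c U I"
  shows "annihilator mpoly_ring Q = {f. \<forall>a\<in>U. f * a \<in> I}"
proof -
  note q = presentsD[OF Q]
  have "f \<odot>\<^bsub>Q\<^esub> c a = \<zero>\<^bsub>Q\<^esub> \<longleftrightarrow> f * a \<in> I" if "a \<in> U" for f a
    using that q(5,7) presents_eq_zero[OF Q] ideal_setD(3)[OF q(1)] by simp
  then show ?thesis by (auto simp: annihilator_def q(4))
qed

lemma component_mpoly: "component mpoly_module e
    = {f :: ('n::finite, 'k::field) mpoly. \<forall>t \<in> Poly_Mapping.keys f. \<forall>i. int (Poly_Mapping.lookup t i) = e i}"
  by (simp add: mpoly_module_def)

lemma single_component:
  "Poly_Mapping.single t a \<in> component mpoly_module (\<lambda>i. int (Poly_Mapping.lookup t i))"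
  by (simp add: component_mpoly)

text \<open>Membership in \<open>supported_in E\<close> is decided term by term, so the terms of a
  representative are homogeneous summands inside the submodule.\<close>

lemma presents_graded_submodule:
  fixes Q :: "('n::finite, 'k::field, 'm) multigraded_module"
  assumes Q: "presents Q c U I" and E: "up_closed E" "I \<subseteq> supported_in E" "supported_in E \<subseteq> U"
  shows "graded_submodule (c ` supported_in E) Q"
  unfolding graded_submodule_def
proof
  interpret module mpoly_ring Q by (rule presents_module[OF Q])
  note q = presentsD[OF Q] and n = ideal_setD[OF supported_in_ideal[OF E(1)]]
  have EU: "\<And>a. a \<in> supported_in E \<Longrightarrow> a \<in> U" using E(3) by auto
  show "submodule (c ` supported_in E) mpoly_ring Q"
  proof (rule submoduleI)
    fix x assume "x \<in> c ` supported_in E"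
    then obtain a where a: "a \<in> supported_in E" "x = c a" by blast
    have "\<ominus>\<^bsub>Q\<^esub> x = c (- a)"
      by (rule M.minus_equality) (use EU[OF a(1)] EU[OF n(5)[OF a(1)]] a q(4,5,6) in auto)
    then show "\<ominus>\<^bsub>Q\<^esub> x \<in> c ` supported_in E" using n(5)[OF a(1)] by blast
  qed (use EU q(4,5,6,7) imageI[OF n(1)] imageI[OF n(2)] imageI[OF n(3)] in auto)
  show "\<forall>x\<in>c ` supported_in E. \<exists>A y. finite A \<and> (\<forall>b\<in>A. y b \<in> c ` supported_in E \<inter> component Q b) \<and>
     x = (\<Oplus>\<^bsub>Q\<^esub>b\<in>A. y b)"
  proof
    fix x assume "x \<in> c ` supported_in E"
    then obtain a where a: "a \<in> supported_in E" "x = c a" by blast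
    define e where "e t i = int (Poly_Mapping.lookup t i)" for t :: "'n \<Rightarrow>\<^sub>0 nat" and i
    \<comment> \<open>The decomposition must be indexed by degrees rather than by exponents;
      \<open>d\<close> recovers the exponent from its degree.\<close>
    define d where "d b = inv_into UNIV e b" for b
    have inj: "inj e" by (rule injI, rule poly_mapping_eqI) (auto simp: e_def fun_eq_iff)
    define g where "g t = Poly_Mapping.single t (Poly_Mapping.lookup a t)" for t
    have gE: "g t \<in> supported_in E" if "t \<in> Poly_Mapping.keys a" for t
      using a(1) that by (auto simp: supported_in_def g_def)
    have "a = (\<Sum>t\<in>Poly_Mapping.keys a. g t)"
      by (rule poly_mapping_eqI)
        (simp add: g_def lookup_sum lookup_single when_def not_in_keys_iff_lookup_eq_zero)
    also have "\<dots> = (\<Sum>b\<in>e ` Poly_Mapping.keys a. g (d b))"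
      by (subst sum.reindex) (use inj in \<open>auto simp: d_def inj_on_def\<close>)
    finally have "x = c (\<Sum>b\<in>e ` Poly_Mapping.keys a. g (d b))" using a(2) by simp
    also have "\<dots> = (\<Oplus>\<^bsub>Q\<^esub>b\<in>e ` Poly_Mapping.keys a. c (g (d b)))"
      by (rule presents_finsum[OF Q, symmetric]) (use gE EU inj in \<open>auto simp: d_def\<close>)
    finally have "x = (\<Oplus>\<^bsub>Q\<^esub>b\<in>e ` Poly_Mapping.keys a. c (g (d b)))" .
    moreover have "c (g (d b)) \<in> c ` supported_in E \<inter> component Q b" if "b \<in> e ` Poly_Mapping.keys a" for b
    proof -
      from that obtain t where t: "t \<in> Poly_Mapping.keys a" "b = e t" by blast
      have "g t \<in> component mpoly_module (e t)"
        unfolding g_def e_def by (rule single_component)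
      then show ?thesis using t gE[OF t(1)] EU inj by (auto simp: q(9) d_def)
    qed
    ultimately show "\<exists>A y. finite A \<and> (\<forall>b\<in>A. y b \<in> c ` supported_in E \<inter> component Q b) \<and>
     x = (\<Oplus>\<^bsub>Q\<^esub>b\<in>A. y b)" by (intro exI[of _ "e ` Poly_Mapping.keys a"] exI[of _ "\<lambda>b. c (g (d b))"]) auto
  qed
qed

text \<open>The map \<open>h\<close> on representatives, such as multiplication by a monomial, runs
  from U' to U, whereas the isomorphism runs from Q to Q'. It is therefore defined by choosing a
  preimage under c after h. Of the conditions on \<open>h\<close>, the equivalence gives injectivity
  and the existence statement gives surjectivity modulo I.\<close>

lemma presents_graded_isomorphic:
  fixes h :: "('n::finite, 'k::field) mpoly \<Rightarrow> ('n, 'k) mpoly"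
  assumes Q: "presents Q c U I" and Q': "presents Q' c' U' I'"
    and h: "\<And>a. a \<in> U' \<Longrightarrow> h a \<in> U" "\<And>a b. a \<in> U' \<Longrightarrow> b \<in> U' \<Longrightarrow> h (a + b) = h a + h b"
      "\<And>f a. a \<in> U' \<Longrightarrow> h (f * a) = f * h a" "\<And>a. a \<in> U' \<Longrightarrow> h a \<in> I \<longleftrightarrow> a \<in> I'"
      "\<And>u. u \<in> U \<Longrightarrow> \<exists>a\<in>U'. u - h a \<in> I"
    and e: "\<And>e. c ` (U \<inter> component mpoly_module e)
      = c ` h ` (U' \<inter> component mpoly_module (\<lambda>j. e j - s j))"
  shows "graded_isomorphic Q (shift_module Q' s)"
proof -
  note q = presentsD[OF Q] and q' = presentsD[OF Q'] and u' = ideal_setD[OF presentsD(1)[OF Q']]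
  define \<phi> where "\<phi> x = c' (SOME a. a \<in> U' \<and> x = c (h a))" for x
  have h_diff: "h (a - b) = h a - h b" if "a \<in> U'" "b \<in> U'" for a b
    using h(2)[of "a - b" b] u'(6) that by (simp add: algebra_simps)
  have ch: "c (h a) = c (h b) \<longleftrightarrow> c' a = c' b" if "a \<in> U'" "b \<in> U'" for a b
    using that h(1) h(4)[of "a - b"] q(8) q'(8) h_diff u'(6) by simp
  have \<phi>: "\<phi> (c (h a)) = c' a" if "a \<in> U'" for a
  proof -
    let ?b = "SOME b. b \<in> U' \<and> c (h a) = c (h b)"
    have "?b \<in> U' \<and> c (h a) = c (h ?b)" by (rule someI[of _ a]) (use that in simp)
    then have "c' a = c' ?b" using ch[OF that, of ?b] by blast
    then show ?thesis unfolding \<phi>_def by (rule sym)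
  qed
  have car: "carrier Q = c ` h ` U'"
  proof
    show "carrier Q \<subseteq> c ` h ` U'"
    proof
      fix x assume "x \<in> carrier Q"
      then obtain u where u: "u \<in> U" "x = c u" by (auto simp: q(4))
      from h(5)[OF u(1)] obtain a where "a \<in> U'" "u - h a \<in> I" by blast
      then show "x \<in> c ` h ` U'" using q(8) u h(1) by auto
    qed
  qed (use h(1) q(4) in auto)
  show ?thesis unfolding graded_isomorphic_def
  proof (intro exI[of _ \<phi>] conjI ballI allI)
    show "bij_betw \<phi> (carrier Q) (carrier (shift_module Q' s))"
      unfolding bij_betw_def
    proof
      show "inj_on \<phi> (carrier Q)" unfolding car inj_on_def using \<phi> ch by auto
      show "\<phi> ` carrier Q = carrier (shift_module Q' s)"
        using \<phi> by (force simp: car shift_module_def q'(4) image_image intro!: image_cong)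
    qed
    show "\<phi> ` component Q e = component (shift_module Q' s) e" for e
      unfolding q(9) e using \<phi> by (force simp: shift_module_def q'(9) image_image intro!: image_cong)
  next
    fix x y assume "x \<in> carrier Q" "y \<in> carrier Q"
    then obtain a b where ab: "a \<in> U'" "b \<in> U'" "x = c (h a)" "y = c (h b)" by (auto simp: car)
    then have "x \<oplus>\<^bsub>Q\<^esub> y = c (h (a + b))" using h(1,2) q(6) by simp
    then show "\<phi> (x \<oplus>\<^bsub>Q\<^esub> y) = \<phi> x \<oplus>\<^bsub>shift_module Q' s\<^esub> \<phi> y"
      using ab \<phi> u'(2) q'(6) by (simp add: shift_module_def)
  next
    fix f x assume "x \<in> carrier Q"
    then obtain a where a: "a \<in> U'" "x = c (h a)" by (auto simp: car)
    then have "f \<odot>\<^bsub>Q\<^esub> x = c (h (f * a))" using h(1,3) q(7) by simp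
    then show "\<phi> (f \<odot>\<^bsub>Q\<^esub> x) = f \<odot>\<^bsub>shift_module Q' s\<^esub> \<phi> x"
      using a \<phi> u'(3) q'(7) by (simp add: shift_module_def)
  qed
qed

section \<open>Regular sequences and fibres\<close>

definition total_degree :: "('n::finite \<Rightarrow>\<^sub>0 nat) \<Rightarrow> nat"
  where "total_degree t = (\<Sum>i\<in>UNIV. Poly_Mapping.lookup t i)"

lemma total_degree_add [simp]: "total_degree (s + t) = total_degree s + total_degree t"
  by (simp add: total_degree_def lookup_add sum.distrib)

lemma total_degree_single [simp]: "total_degree (Poly_Mapping.single i k) = k"
  by (simp add: total_degree_def lookup_single when_def)

lemma total_degree_mono:
  "(\<And>i. Poly_Mapping.lookup s i \<le> Poly_Mapping.lookup t i) \<Longrightarrow> total_degree s \<le> total_degree t"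
  by (simp add: total_degree_def sum_mono)

lemma total_degree_strict_mono:
  "(\<And>i. Poly_Mapping.lookup s i \<le> Poly_Mapping.lookup t i) \<Longrightarrow>
    Poly_Mapping.lookup s j < Poly_Mapping.lookup t j \<Longrightarrow> total_degree s < total_degree t"
  unfolding total_degree_def by (rule sum_strict_mono_ex1) auto

lemma up_closed_le:
  assumes "up_closed E" "s \<in> E" "\<And>i. Poly_Mapping.lookup s i \<le> Poly_Mapping.lookup t i"
  shows "t \<in> E"
proof -
  have "t = s + (t - s)" using assms(3) by (intro poly_mapping_eqI) (simp add: lookup_add lookup_minus)
  then show ?thesis using up_closedD(1)[OF assms(1,2), of "t - s"] by simp
qed

lemma power_keys_degree:
  fixes f :: "('n::finite, 'k::field) mpoly"
  assumes "f \<in> graded_maximal_ideal" "t \<in> Poly_Mapping.keys (f ^ D)"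
  shows "D \<le> total_degree t"
  using assms(2)
proof (induction D arbitrary: t)
  case (Suc D)
  have "variable ` UNIV = (monomial ` range (\<lambda>i. Poly_Mapping.single i 1) :: ('n, 'k) mpoly set)"
    by (auto simp: variable_def image_image)
  then have "f \<in> supported_in {s + u | s u. s \<in> range (\<lambda>i. Poly_Mapping.single i 1)}"
    using assms(1) by (simp only: graded_maximal_ideal_def genideal_monomials)
  then have f: "\<exists>i u. s = Poly_Mapping.single i 1 + u" if "s \<in> Poly_Mapping.keys f" for s
    using that unfolding supported_in_def by blast
  from Suc.prems obtain s u where *: "t = s + u" "s \<in> Poly_Mapping.keys f" "u \<in> Poly_Mapping.keys (f ^ D)"
    using keys_mult[of f "f ^ D"] by auto
  then show ?case using f[OF *(2)] Suc.IH[OF *(3)] by auto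
qed simp

text \<open>A monomial of large degree either contains a variable outside V or has a large exponent
  at some variable of V, and then it lies in I.\<close>

lemma primary_monomial_ideal_nilpotent:
  fixes f :: "('n::finite, 'k::field) mpoly"
  assumes E: "up_closed E" and m: "\<And>i. i \<in> V \<Longrightarrow> Poly_Mapping.single i m \<in> E"
    and f: "f \<in> graded_maximal_ideal"
  obtains D c w where "f ^ D = (\<Sum>z\<in>UNIV. c z * (if z \<in> V then 0 else variable z)) + w"
    "w \<in> supported_in E"
proof -
  let ?x = "\<lambda>z. if z \<in> V then 0 else variable z :: ('n, 'k) mpoly"
  \<comment> \<open>The ideal generated by the variables outside V and the monomials of E. Writing
    it with coefficients at all indices gives the sums the shape required by
    \<open>nilpotent\<close>.\<close>
  define J where "J = {(\<Sum>z\<in>UNIV. c z * ?x z) + w | c w. w \<in> supported_in E}"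
  note I = ideal_setD[OF supported_in_ideal[OF E]]
  have J: "ideal_set J" unfolding ideal_set_def
  proof (intro conjI ballI allI)
    show "0 \<in> J" unfolding J_def using I(1) by (intro CollectI exI[of _ "\<lambda>_. 0"] exI[of _ 0]) simp
  next
    fix a b assume "a \<in> J" "b \<in> J"
    then obtain c w c' w' where "a = (\<Sum>z\<in>UNIV. c z * ?x z) + w" "w \<in> supported_in E"
      "b = (\<Sum>z\<in>UNIV. c' z * ?x z) + w'" "w' \<in> supported_in E" unfolding J_def by blast
    then show "a + b \<in> J" unfolding J_def using I(2)
      by (intro CollectI exI[of _ "\<lambda>z. c z + c' z"] exI[of _ "w + w'"]) (simp add: distrib_right sum.distrib)
  next
    fix r a assume "a \<in> J"
    then obtain c w where "a = (\<Sum>z\<in>UNIV. c z * ?x z) + w" "w \<in> supported_in E" unfolding J_def by blast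
    then show "r * a \<in> J" unfolding J_def using I(3)
      by (intro CollectI exI[of _ "\<lambda>z. r * c z"] exI[of _ "r * w"]) (simp add: distrib_left sum_distrib_left mult.assoc)
  qed
  \<comment> \<open>Pigeonhole: a monomial in the variables of V of degree above n * m has an
    exponent above m.\<close>
  define D where "D = CARD('n) * m + 1"
  have "f ^ D \<in> J"
  proof (rule mpoly_ideal_induct[OF J])
    fix t assume "t \<in> Poly_Mapping.keys (f ^ D)"
    then have D: "D \<le> total_degree t" using power_keys_degree[OF f] by blast
    show "monomial t \<in> J"
    proof (cases "Poly_Mapping.keys t \<subseteq> V")
      case True
      have "\<exists>i. m < Poly_Mapping.lookup t i"
      proof (rule ccontr)
        assume "\<nexists>i. m < Poly_Mapping.lookup t i"
        then have "total_degree t \<le> (\<Sum>i\<in>(UNIV::'n set). m)"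
          unfolding total_degree_def by (intro sum_mono) (auto simp: not_less)
        with D show False by (simp add: D_def)
      qed
      then obtain i where i: "m < Poly_Mapping.lookup t i" by blast
      then have "i \<in> V" using True by (auto simp: in_keys_iff)
      have "t \<in> E" by (rule up_closed_le[OF E m[OF \<open>i \<in> V\<close>]]) (use i in \<open>auto simp: lookup_single when_def\<close>)
      then have "monomial t \<in> supported_in E" by (simp add: supported_in_def)
      then show ?thesis unfolding J_def by (intro CollectI exI[of _ "\<lambda>_. 0"] exI[of _ "monomial t"]) simp
    next
      case False
      then obtain y where y: "y \<in> Poly_Mapping.keys t" "y \<notin> V" by blast
      have "variable y = (\<Sum>z\<in>UNIV. (if z = y then 1 else 0) * ?x z) + 0"
        using y(2) by (simp add: if_distrib[where f = "\<lambda>r. r * _"] cong: if_cong)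
      then have "variable y \<in> J" unfolding J_def
        by (intro CollectI exI[of _ "\<lambda>z. if z = y then 1 else 0"] exI[of _ 0] conjI I(1))
      moreover have "t = Poly_Mapping.single y 1 + (t - Poly_Mapping.single y 1)"
        using y(1) by (intro poly_mapping_eqI) (auto simp: lookup_add lookup_minus lookup_single when_def in_keys_iff)
      then have "monomial t = (variable y * monomial (t - Poly_Mapping.single y 1) :: ('n, 'k) mpoly)"
        unfolding variable_def monomial_mult by simp
      ultimately show ?thesis using ideal_setD(4)[OF J] by simp
    qed
  qed
  then show thesis unfolding J_def using that by blast
qed

section \<open>Quotients by a primary monomial ideal and their fibres over V-parts of
  exponents\<close>

locale primary_quotient =
  fixes Q :: "('n::finite, 'k::field, 'm) multigraded_module" and c :: "('n, 'k) mpoly \<Rightarrow> 'm"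
    and F E :: "('n \<Rightarrow>\<^sub>0 nat) set" and V :: "'n set" and m :: nat
  assumes Q: "presents Q c (supported_in F) (supported_in E)"
    and F_up: "up_closed F" and E_up: "up_closed E" and E_subset: "E \<subseteq> F" and E_ne: "E \<noteq> F"
    and power_in: "i \<in> V \<Longrightarrow> Poly_Mapping.single i m \<in> E"
    and cancel: "t + u \<in> E \<Longrightarrow> Poly_Mapping.keys u \<inter> V = {} \<Longrightarrow> t \<in> E"
begin

text \<open>Monomials of U outside I with a common V-part span one of the K[Z]-summands of M,
  isomorphic to a monomial ideal of K[Z]. A fibre is the set of their exponents.\<close>

definition same_fibre :: "('n \<Rightarrow>\<^sub>0 nat) \<Rightarrow> ('n \<Rightarrow>\<^sub>0 nat) \<Rightarrow> bool"
  where "same_fibre s t \<longleftrightarrow> (\<forall>i\<in>V. Poly_Mapping.lookup s i = Poly_Mapping.lookup t i)"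

text \<open>Passing from s to the minimum of s and t, which truncated subtraction writes as s - (s -
  t), removes only variables outside V. So \<open>cancel\<close> puts the minimum into E, and t is a
  multiple of it.\<close>

lemma same_fibre_E:
  assumes "same_fibre s t" "s \<in> E"
  shows "t \<in> E"
proof -
  let ?g = "s - (s - t)"
  have "s = ?g + (s - ?g)" by (rule poly_mapping_eqI) (simp add: lookup_add lookup_minus)
  moreover have "Poly_Mapping.keys (s - ?g) \<inter> V = {}"
    using assms(1) by (auto simp: same_fibre_def in_keys_iff lookup_minus)
  ultimately have "?g \<in> E" using cancel assms(2) by metis
  then show ?thesis by (rule up_closed_le[OF E_up]) (simp add: lookup_minus)
qed

lemmas U = supported_in_ideal[OF F_up, where ?'k = 'k]
  and I = supported_in_ideal[OF E_up, where ?'k = 'k]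

lemma I_subset_U: "supported_in E \<subseteq> (supported_in F :: ('n, 'k) mpoly set)"
  using E_subset by (auto simp: supported_in_def)

definition free_variable :: "'n \<Rightarrow> ('n, 'k) mpoly"
  where "free_variable z = (if z \<in> V then 0 else variable z)"

text \<open>The preimage in U of (f_0, ..., f_{j-1}) M.\<close>

definition seq_ideal :: "('n, 'k) mpoly list \<Rightarrow> nat \<Rightarrow> ('n, 'k) mpoly set"
  where "seq_ideal fs j = {(\<Sum>i<j. fs ! i * u i) + w | u w. (\<forall>i. u i \<in> supported_in F) \<and> w \<in> supported_in E}"

lemma seq_ideal_0: "seq_ideal fs 0 = supported_in E"
  using ideal_setD(1)[OF U] by (auto simp: seq_ideal_def)

lemma seq_ideal_ideal: "ideal_set (seq_ideal fs j)"
  unfolding ideal_set_def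
proof (intro conjI ballI allI)
  note u = ideal_setD[OF U] and i = ideal_setD[OF I]
  show "0 \<in> seq_ideal fs j" unfolding seq_ideal_def
    using u(1) i(1) by (intro CollectI exI[of _ "\<lambda>_. 0"] exI[of _ 0]) simp
next
  fix a b assume "a \<in> seq_ideal fs j" "b \<in> seq_ideal fs j"
  then obtain u w u' w' where "a = (\<Sum>i<j. fs ! i * u i) + w" "\<forall>i. u i \<in> supported_in F" "w \<in> supported_in E"
    "b = (\<Sum>i<j. fs ! i * u' i) + w'" "\<forall>i. u' i \<in> supported_in F" "w' \<in> supported_in E"
    unfolding seq_ideal_def by blast
  then show "a + b \<in> seq_ideal fs j" unfolding seq_ideal_def
    using ideal_setD(2)[OF U] ideal_setD(2)[OF I]
    by (intro CollectI exI[of _ "\<lambda>i. u i + u' i"] exI[of _ "w + w'"]) (simp add: distrib_left sum.distrib)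
next
  fix r a assume "a \<in> seq_ideal fs j"
  then obtain u w where "a = (\<Sum>i<j. fs ! i * u i) + w" "\<forall>i. u i \<in> supported_in F" "w \<in> supported_in E"
    unfolding seq_ideal_def by blast
  then show "r * a \<in> seq_ideal fs j" unfolding seq_ideal_def
    using ideal_setD(3)[OF U] ideal_setD(3)[OF I]
    by (intro CollectI exI[of _ "\<lambda>i. r * u i"] exI[of _ "r * w"])
      (simp add: distrib_left sum_distrib_left mult.left_commute)
qed

lemma I_subset_seq_ideal: "supported_in E \<subseteq> seq_ideal fs j"
  unfolding seq_ideal_def using ideal_setD(1)[OF U]
  by (intro subsetI CollectI exI[of _ "\<lambda>_. 0"]) auto

lemma seq_ideal_subset_U: "seq_ideal fs j \<subseteq> supported_in F"
  unfolding seq_ideal_def using I_subset_U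
  by (auto intro!: ideal_setD(2)[OF U] ideal_set_sum[OF U] ideal_setD(3)[OF U])

lemma seq_ideal_Suc:
  "seq_ideal fs (Suc j) = {n + fs ! j * u | n u. n \<in> seq_ideal fs j \<and> u \<in> supported_in F}"
proof
  show "seq_ideal fs (Suc j) \<subseteq> {n + fs ! j * u | n u. n \<in> seq_ideal fs j \<and> u \<in> supported_in F}"
  proof
    fix a assume "a \<in> seq_ideal fs (Suc j)"
    then obtain u w where u: "a = (\<Sum>i<Suc j. fs ! i * u i) + w" "\<forall>i. u i \<in> supported_in F" "w \<in> supported_in E"
      unfolding seq_ideal_def by blast
    then have "a = ((\<Sum>i<j. fs ! i * u i) + w) + fs ! j * u j" by (simp add: algebra_simps)
    moreover have "(\<Sum>i<j. fs ! i * u i) + w \<in> seq_ideal fs j" unfolding seq_ideal_def using u by blast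
    ultimately show "a \<in> {n + fs ! j * u | n u. n \<in> seq_ideal fs j \<and> u \<in> supported_in F}" using u(2) by blast
  qed
  show "{n + fs ! j * u | n u. n \<in> seq_ideal fs j \<and> u \<in> supported_in F} \<subseteq> seq_ideal fs (Suc j)"
  proof clarify
    fix n v :: "('n, 'k) mpoly" assume "n \<in> seq_ideal fs j" and v: "v \<in> supported_in F"
    then obtain u w where u: "n = (\<Sum>i<j. fs ! i * u i) + w" "\<forall>i. u i \<in> supported_in F" "w \<in> supported_in E"
      unfolding seq_ideal_def by blast
    have "n + fs ! j * v = (\<Sum>i<Suc j. fs ! i * (u(j := v)) i) + w" by (simp add: u(1) algebra_simps)
    then show "n + fs ! j * v \<in> seq_ideal fs (Suc j)" unfolding seq_ideal_def using u v
      by (intro CollectI exI[of _ "u(j := v)"] exI[of _ w]) auto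
  qed
qed

lemma seq_multiple_eq:
  assumes "j \<le> length fs"
  shows "seq_multiple Q (take j fs) = c ` seq_ideal fs j"
proof -
  note q = presentsD[OF Q]
  have l: "length (take j fs) = j" using assms by simp
  have sum: "(\<Oplus>\<^bsub>Q\<^esub>i\<in>{..<j}. c (fs ! i * u i)) = c (\<Sum>i<j. fs ! i * u i)"
    if "\<And>i. i < j \<Longrightarrow> u i \<in> supported_in F" for u
    by (rule presents_finsum[OF Q]) (use that ideal_setD(3)[OF U] in auto)
  interpret module mpoly_ring Q by (rule presents_module[OF Q])
  have eq: "(\<Oplus>\<^bsub>Q\<^esub>i\<in>{..<j}. (take j fs ! i) \<odot>\<^bsub>Q\<^esub> c (u i)) = c (\<Sum>i<j. fs ! i * u i)"
    if u: "\<And>i. i < j \<Longrightarrow> u i \<in> supported_in F" for u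
  proof -
    have "(\<Oplus>\<^bsub>Q\<^esub>i\<in>{..<j}. (take j fs ! i) \<odot>\<^bsub>Q\<^esub> c (u i)) = (\<Oplus>\<^bsub>Q\<^esub>i\<in>{..<j}. c (fs ! i * u i))"
    proof (rule M.finsum_cong')
      show "(\<lambda>i. c (fs ! i * u i)) \<in> {..<j} \<rightarrow> carrier Q"
        using u ideal_setD(3)[OF U] by (auto simp: q(4))
    qed (use u q(7) in auto)
    then show ?thesis using sum[OF u] by simp
  qed
  show ?thesis
  proof
    show "seq_multiple Q (take j fs) \<subseteq> c ` seq_ideal fs j"
      unfolding seq_multiple_def l
    proof clarify
      fix x assume "x \<in> {..<j} \<rightarrow> carrier Q"
      then have "\<forall>i. \<exists>u. i < j \<longrightarrow> u \<in> supported_in F \<and> x i = c u" by (auto simp: q(4) Pi_def)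
      then obtain u where u: "\<And>i. i < j \<Longrightarrow> u i \<in> supported_in F \<and> x i = c (u i)" by metis
      have "(\<Oplus>\<^bsub>Q\<^esub>i\<in>{..<j}. (take j fs ! i) \<odot>\<^bsub>Q\<^esub> x i)
          = (\<Oplus>\<^bsub>Q\<^esub>i\<in>{..<j}. (take j fs ! i) \<odot>\<^bsub>Q\<^esub> c (u i))"
      proof (rule M.finsum_cong')
        show "(\<lambda>i. (take j fs ! i) \<odot>\<^bsub>Q\<^esub> c (u i)) \<in> {..<j} \<rightarrow> carrier Q"
          using u by (intro Pi_I smult_closed) (auto simp: q(4))
      qed (use u in auto)
      also have "\<dots> = c (\<Sum>i<j. fs ! i * u i)" by (rule eq) (use u in auto)
      \<comment> \<open>The witnesses beyond \<open>j\<close> are arbitrary, but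
        \<open>seq_ideal\<close> wants every \<open>u i\<close> in U; they are replaced by
        0.\<close>
      also have "(\<Sum>i<j. fs ! i * u i) = (\<Sum>i<j. fs ! i * (if i < j then u i else 0)) + 0"
        by simp
      finally have eqx: "(\<Oplus>\<^bsub>Q\<^esub>i\<in>{..<j}. (take j fs ! i) \<odot>\<^bsub>Q\<^esub> x i)
        = c ((\<Sum>i<j. fs ! i * (if i < j then u i else 0)) + 0)" .
      have "(\<Sum>i<j. fs ! i * (if i < j then u i else 0)) + 0 \<in> seq_ideal fs j"
        unfolding seq_ideal_def using u ideal_setD(1)[OF U] ideal_setD(1)[OF I]
        by (intro CollectI exI[of _ "\<lambda>i. if i < j then u i else 0"] exI[of _ 0]) auto
      then show "(\<Oplus>\<^bsub>Q\<^esub>i\<in>{..<j}. (take j fs ! i) \<odot>\<^bsub>Q\<^esub> x i) \<in> c ` seq_ideal fs j"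
        unfolding eqx by (rule imageI)
    qed
    show "c ` seq_ideal fs j \<subseteq> seq_multiple Q (take j fs)"
    proof clarify
      fix a assume "a \<in> seq_ideal fs j"
      then obtain u w where u: "a = (\<Sum>i<j. fs ! i * u i) + w" "\<forall>i. u i \<in> supported_in F" "w \<in> supported_in E"
        unfolding seq_ideal_def by blast
      have s: "(\<Sum>i<j. fs ! i * u i) \<in> supported_in F"
        by (intro ideal_set_sum[OF U] ideal_setD(3)[OF U]) (use u in auto)
      then have "a \<in> supported_in F" unfolding u(1) using ideal_setD(2)[OF U] u(3) I_subset_U by blast
      then have "c a = c (\<Sum>i<j. fs ! i * u i)" using q(8)[OF _ s, of a] u by simp
      then show "c a \<in> seq_multiple Q (take j fs)"
        unfolding seq_multiple_def l using eq[of u] u(2)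
        by (intro CollectI exI[of _ "\<lambda>i. c (u i)"]) (auto simp: q(4))
    qed
  qed
qed

lemma weak_regular_chain_seq_ideal:
  assumes "set fs \<subseteq> graded_maximal_ideal" "regular_sequence Q fs"
  shows "weak_regular_chain free_variable (supported_in F) (seq_ideal fs) ((!) fs) (length fs)"
proof
  show "ideal_set (supported_in F :: ('n, 'k) mpoly set)" by (rule U)
  show "ideal_set (seq_ideal fs j)" for j by (rule seq_ideal_ideal)
  show "seq_ideal fs (Suc j) = {n + fs ! j * u | n u. n \<in> seq_ideal fs j \<and> u \<in> supported_in F}" for j
    by (rule seq_ideal_Suc)
next
  fix j u assume j: "j < length fs" and u: "u \<in> supported_in F" "fs ! j * u \<in> seq_ideal fs j"
  note q = presentsD[OF Q]
  have "fs ! j \<odot>\<^bsub>Q\<^esub> c u \<in> seq_multiple Q (take j fs)"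
    using j u q(7) seq_multiple_eq by simp
  then have "c u \<in> seq_multiple Q (take j fs)"
    using assms(2) j u(1) q(4) by (auto simp: regular_sequence_def)
  then show "u \<in> seq_ideal fs j"
    using presents_mem_image[OF Q seq_ideal_ideal I_subset_seq_ideal seq_ideal_subset_U u(1)] j
    by (simp add: seq_multiple_eq)
next
  fix j assume j: "j < length fs"
  then have "fs ! j \<in> graded_maximal_ideal" using assms(1) by auto
  then obtain D b w where *: "fs ! j ^ D = (\<Sum>z\<in>UNIV. b z * (if z \<in> V then 0 else variable z)) + w"
    "w \<in> supported_in E"
    using primary_monomial_ideal_nilpotent[OF E_up power_in] by blast
  have "w * u \<in> seq_ideal fs j" for u using ideal_setD(4)[OF I *(2)] I_subset_seq_ideal by blast
  then show "\<exists>D c i. fs ! j ^ D = (\<Sum>z\<in>UNIV. c z * free_variable z) + i \<and>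
      (\<forall>u\<in>supported_in F. i * u \<in> seq_ideal fs j)"
    using *(1) unfolding free_variable_def by blast
qed

lemma exists_fibre: obtains t where "t \<in> F - E"
  using E_subset E_ne by blast

lemma lookup_variable_mult_eq_0:
  assumes "\<And>w. w \<in> Poly_Mapping.keys f \<Longrightarrow> t \<noteq> Poly_Mapping.single i 1 + w"
  shows "Poly_Mapping.lookup (variable i * f) t = (0 :: 'k)"
proof -
  have "t \<notin> Poly_Mapping.keys (variable i * f)"
    unfolding variable_def keys_monomial_mult using assms by blast
  then show ?thesis by (simp add: in_keys_iff)
qed

text \<open>Nakayama in top degree. The cochain x^t placed at \<open>- V\<close> is a cocycle, since
  a larger set involves an index of V, where \<open>free_variable\<close> is 0. A coboundary takes
  values in (Z)U at \<open>- V\<close>, and x^t does not lie in (Z)U + I when t has least degree in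
  F - E.\<close>

lemma length_regular_sequence_le:
  assumes fs: "set fs \<subseteq> graded_maximal_ideal" "regular_sequence Q fs"
  shows "length fs \<le> card (- V)"
proof (rule ccontr)
  assume "\<not> length fs \<le> card (- V)"
  \<comment> \<open>Here p = |Z| + 1 and j = 0, so the degree of the cochain is p - 1 = |Z|.\<close>
  then have len: "card (- V) + 1 + 0 \<le> length fs" by simp
  interpret W: weak_regular_chain free_variable "supported_in F" "seq_ideal fs" "(!) fs" "length fs"
    by (rule weak_regular_chain_seq_ideal[OF fs])
  obtain t0 where t0: "t0 \<in> F - E" by (rule exists_fibre)
  obtain t where t: "t \<in> F - E" "\<And>s. s \<in> F - E \<Longrightarrow> total_degree t \<le> total_degree s"
    using ex_has_least_nat[of "\<lambda>t. t \<in> F - E" t0 total_degree] t0 by blast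
  define \<phi> where "\<phi> A = (if A = - V then monomial t else 0 :: ('n, 'k) mpoly)" for A
  have "koszul_d free_variable \<phi> A = 0" for A
    unfolding koszul_d_def
  proof (intro sum.neutral ballI)
    fix a assume "a \<in> A"
    then show "koszul_sign a A * free_variable a * \<phi> (A - {a}) = 0"
      by (cases "A - {a} = - V") (auto simp: \<phi>_def free_variable_def)
  qed
  then have "koszul_d free_variable \<phi> A \<in> seq_ideal fs 0" for A
    using ideal_setD(1)[OF I] by (simp add: seq_ideal_0)
  moreover have "\<phi> A \<in> supported_in F" for A using t(1) by (simp add: \<phi>_def supported_in_def)
  moreover have "card A + 1 = card (- V) + 1" if "\<phi> A \<noteq> 0" for A
    using that by (auto simp: \<phi>_def split: if_splits)
  ultimately obtain \<psi> where \<psi>: "\<And>A. \<psi> A \<in> supported_in F"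
    "\<And>A. \<phi> A - koszul_d free_variable \<psi> A \<in> seq_ideal fs 0"
    using W.cocycle_is_coboundary[OF len, of \<phi>] by metis
  have "monomial t - koszul_d free_variable \<psi> (- V) \<in> supported_in E"
    using \<psi>(2)[of "- V"] by (simp add: \<phi>_def seq_ideal_0)
  then have "Poly_Mapping.lookup (monomial t - koszul_d free_variable \<psi> (- V)) t = 0"
    using t(1) by (auto simp: supported_in_def in_keys_iff)
  moreover have "Poly_Mapping.lookup (koszul_d free_variable \<psi> (- V)) t = 0"
    unfolding koszul_d_def lookup_sum
  proof (intro sum.neutral ballI)
    fix a assume a: "a \<in> - V"
    let ?f = "koszul_sign a (- V) * \<psi> (- V - {a})"
    have f: "?f \<in> supported_in F" using ideal_setD(3)[OF U \<psi>(1)] by blast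
    have "t \<noteq> Poly_Mapping.single a 1 + w" if "w \<in> Poly_Mapping.keys ?f" for w
    proof
      assume tw: "t = Poly_Mapping.single a 1 + w"
      have "w \<in> F" using f that by (auto simp: supported_in_def)
      moreover have "w \<notin> E" using t(1) up_closedD(2)[OF E_up] unfolding tw by blast
      ultimately have "total_degree t \<le> total_degree w" using t(2) by blast
      then show False unfolding tw by simp
    qed
    then have "Poly_Mapping.lookup (variable a * ?f) t = 0" by (rule lookup_variable_mult_eq_0)
    then show "Poly_Mapping.lookup (koszul_sign a (- V) * free_variable a * \<psi> (- V - {a})) t = 0"
      using a by (simp add: free_variable_def mult_ac)
  qed
  ultimately show False by (simp add: lookup_minus monomial_def)
qed

text \<open>
  The pointwise minimum and maximum of \<open>p\<close> and \<open>q\<close> are \<open>p - (p - q)\<close> and \<open>p + (q - p)\<close>. If the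
  former is not in \<open>F\<close>, then \<open>x\<^sup>e / x\<^sub>a\<close> and \<open>x\<^sup>e / x\<^sub>b\<close>, where \<open>e\<close> is the maximum, \<open>p\<^sub>a < q\<^sub>a\<close> and
  \<open>q\<^sub>b < p\<^sub>b\<close>, form a cocycle in degree \<open>card (- V) - 1\<close>. It is detected by the sum of the
  \<open>x\<^sup>e\<close>-coefficients over those \<open>z\<close> with \<open>p\<^sub>z < q\<^sub>z\<close>, a functional that vanishes on coboundaries
  by the induction hypothesis.
\<close>

lemma min_in_F:
  assumes fs: "set fs \<subseteq> graded_maximal_ideal" "regular_sequence Q fs" "card (- V) \<le> length fs"
    and "p \<in> F - E" "q \<in> F - E" "same_fibre p q"
  shows "p - (p - q) \<in> F"
  using assms(4-6)
\<comment> \<open>The measure is not symmetric in p and q. One use of the hypothesis keeps p and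
  shrinks the maximum; the other shrinks p and does not enlarge the maximum.\<close>
proof (induction "total_degree (p + (q - p)) + total_degree p" arbitrary: p q rule: less_induct)
  case less
  interpret W: weak_regular_chain free_variable "supported_in F" "seq_ideal fs" "(!) fs" "length fs"
    by (rule weak_regular_chain_seq_ideal[OF fs(1,2)])
  show ?case
  proof (rule ccontr)
    assume notin: "p - (p - q) \<notin> F"
    define e where "e = p + (q - p)"
    have look_e: "Poly_Mapping.lookup e i = max (Poly_Mapping.lookup p i) (Poly_Mapping.lookup q i)" for i
      by (simp add: e_def lookup_add lookup_minus)
    have e_fibre: "same_fibre e p" using less.prems(3) by (simp add: same_fibre_def look_e)
    have e_E: "e \<notin> E" using same_fibre_E[OF e_fibre] less.prems(1) by blast
    have "\<exists>a. Poly_Mapping.lookup p a < Poly_Mapping.lookup q a"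
    proof (rule ccontr)
      assume "\<nexists>a. Poly_Mapping.lookup p a < Poly_Mapping.lookup q a"
      then have "p - (p - q) = q" by (intro poly_mapping_eqI) (auto simp: lookup_minus not_less)
      then show False using notin less.prems(2) by simp
    qed
    then obtain a where a: "Poly_Mapping.lookup p a < Poly_Mapping.lookup q a" by blast
    have "\<exists>b. Poly_Mapping.lookup q b < Poly_Mapping.lookup p b"
    proof (rule ccontr)
      assume "\<nexists>b. Poly_Mapping.lookup q b < Poly_Mapping.lookup p b"
      then have "p - (p - q) = p" by (intro poly_mapping_eqI) (auto simp: lookup_minus not_less)
      then show False using notin less.prems(1) by simp
    qed
    then obtain b where b: "Poly_Mapping.lookup q b < Poly_Mapping.lookup p b" by blast
    have abV: "a \<notin> V" "b \<notin> V" "a \<noteq> b" using a b less.prems(3) by (auto simp: same_fibre_def)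
    define A where "A = {i. Poly_Mapping.lookup p i < Poly_Mapping.lookup q i}"
    have AV: "A \<subseteq> - V" using less.prems(3) by (auto simp: A_def same_fibre_def)
    have aA: "a \<in> A" "b \<notin> A" using a b by (auto simp: A_def)
    define x where "x z = e - Poly_Mapping.single z 1" for z
    have xe: "Poly_Mapping.single z 1 + x z = e" if "z \<in> {a, b}" for z
      using that a b by (intro poly_mapping_eqI) (auto simp: x_def lookup_add lookup_minus lookup_single look_e when_def)
    have "x a \<in> F"
      by (rule up_closed_le[OF F_up, of p]) (use less.prems(1) a in \<open>auto simp: x_def lookup_minus lookup_single look_e when_def\<close>)
    moreover have "x b \<in> F"
      by (rule up_closed_le[OF F_up, of q]) (use less.prems(2) b in \<open>auto simp: x_def lookup_minus lookup_single look_e when_def\<close>)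
    ultimately have xF: "monomial (x a) \<in> (supported_in F :: ('n, 'k) mpoly set)" "monomial (x b) \<in> (supported_in F :: ('n, 'k) mpoly set)"
      by (simp_all add: supported_in_def)
    define \<phi> :: "'n set \<Rightarrow> ('n, 'k) mpoly" where
      "\<phi> B = (if B = - V - {a} then koszul_sign a (- V) * monomial (x a)
        else if B = - V - {b} then - koszul_sign b (- V) * monomial (x b) else 0)" for B
    have ne: "- V - {a} \<noteq> - V - {b}" using abV by auto
    have xm: "free_variable z * monomial (x z) = monomial e" if "z \<in> {a, b}" for z
    proof -
      have "z \<notin> V" using that abV by auto
      then have "free_variable z * monomial (x z) = monomial (Poly_Mapping.single z 1 + x z)"
        by (simp add: free_variable_def variable_def)
      then show ?thesis by (simp only: xe[OF that])
    qed
    have \<phi>z: "koszul_sign z (- V) * free_variable z * \<phi> (- V - {z})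
        = (if z = a then monomial e else if z = b then - monomial e else 0)" if "z \<in> - V" for z
    proof -
      have "- V - {z} = - V - {y} \<longleftrightarrow> z = y" if "y \<in> {a, b}" for y
        using that \<open>z \<in> - V\<close> abV by auto
      then show ?thesis using xm[of a] xm[of b] ne by (auto simp: \<phi>_def mult_ac)
    qed
    have cocycle: "koszul_d free_variable \<phi> B \<in> seq_ideal fs 0" for B
    proof (cases "B = - V")
      case True
      have "koszul_d free_variable \<phi> B = (\<Sum>z\<in>- V. if z = a then monomial e else if z = b then - monomial e else 0)"
        unfolding koszul_d_def True using \<phi>z by (intro sum.cong) auto
      also have "\<dots> = (\<Sum>z\<in>- V. (if z = a then monomial e else 0) + (if z = b then - monomial e else 0))"
        using abV by (intro sum.cong) auto
      also have "\<dots> = 0" using abV by (simp add: sum.distrib)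
      finally show ?thesis using ideal_setD(1)[OF I] by (simp add: seq_ideal_0)
    next
      case False
      have "koszul_sign z B * free_variable z * \<phi> (B - {z}) = 0" if "z \<in> B" for z
      proof (cases "z \<in> V")
        case False
        have "B - {z} \<noteq> - V - {y}" if "y \<in> {a, b}" for y
        proof
          assume *: "B - {z} = - V - {y}"
          have "y \<in> - V" using that abV by auto
          then have "z = y" using * False \<open>z \<in> B\<close> by blast
          then have "B = - V" using * \<open>z \<in> B\<close> \<open>y \<in> - V\<close> by blast
          then show False using \<open>B \<noteq> - V\<close> by blast
        qed
        then show ?thesis by (simp add: \<phi>_def)
      qed (simp add: free_variable_def)
      then have "koszul_d free_variable \<phi> B = 0" by (simp add: koszul_d_def)
      then show ?thesis using ideal_setD(1)[OF I] by (simp add: seq_ideal_0)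
    qed
    have \<phi>U: "\<phi> B \<in> supported_in F" for B
      unfolding \<phi>_def using xF ideal_setD(1,3,5)[OF U] by simp
    have \<phi>c: "card B + 1 = card (- V)" if "\<phi> B \<noteq> 0" for B
    proof -
      from that obtain y where "y \<in> {a, b}" "B = - V - {y}" by (auto simp: \<phi>_def split: if_splits)
      then show ?thesis using card_Suc_Diff1[of "- V" y] abV by auto
    qed
    have len: "card (- V) + 0 \<le> length fs" using fs(3) by simp
    obtain \<psi> where \<psi>: "\<And>B. \<psi> B \<in> supported_in F"
      "\<And>B. \<phi> B - koszul_d free_variable \<psi> B \<in> seq_ideal fs 0"
      using W.cocycle_is_coboundary[OF len \<phi>U \<phi>c cocycle] by metis
    \<comment> \<open>The part of the top differential that runs over A. It keeps the contribution
      of a and drops that of b, which cancel each other in the full differential.\<close>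
    define T where "T g = (\<Sum>z\<in>A. koszul_sign z (- V) * free_variable z * g (- V - {z}))"
      for g :: "'n set \<Rightarrow> ('n, 'k) mpoly"
    have "T (\<lambda>B. \<phi> B - koszul_d free_variable \<psi> B) \<in> supported_in E"
      unfolding T_def using \<psi>(2) by (intro ideal_set_sum[OF I] ideal_setD(3)[OF I]) (simp add: seq_ideal_0)
    then have "Poly_Mapping.lookup (T (\<lambda>B. \<phi> B - koszul_d free_variable \<psi> B)) e = 0"
      using e_E by (auto simp: supported_in_def in_keys_iff)
    moreover have "T (\<lambda>B. \<phi> B - koszul_d free_variable \<psi> B) = T \<phi> - T (koszul_d free_variable \<psi>)"
      by (simp add: T_def right_diff_distrib sum_subtractf)
    moreover have "T \<phi> = monomial e"
    proof -
      have "T \<phi> = (\<Sum>z\<in>A. if z = a then monomial e else 0)"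
        unfolding T_def using \<phi>z AV aA by (intro sum.cong) auto
      then show ?thesis using aA by simp
    qed
    moreover have "Poly_Mapping.lookup (T (koszul_d free_variable \<psi>)) e = 0"
    proof -
      define t where "t z y = koszul_sign z (- V) * koszul_sign y (- V - {z}) *
        (free_variable z * free_variable y * \<psi> (- V - {z} - {y}))" for z y
      have "T (koszul_d free_variable \<psi>) = (\<Sum>z\<in>A. \<Sum>y\<in>- V - {z}. t z y)"
        by (simp add: T_def koszul_d_def t_def sum_distrib_left mult_ac)
      also have "\<dots> = (\<Sum>z\<in>A. (\<Sum>y\<in>A - {z}. t z y) + (\<Sum>y\<in>- V - A. t z y))"
      proof (intro sum.cong refl)
        fix z assume "z \<in> A"
        then have "- V - {z} = (A - {z}) \<union> (- V - A)" using AV by auto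
        then show "(\<Sum>y\<in>- V - {z}. t z y) = (\<Sum>y\<in>A - {z}. t z y) + (\<Sum>y\<in>- V - A. t z y)"
          by (simp add: sum.union_disjoint[symmetric] Int_Diff) (subst sum.union_disjoint; auto)
      qed
      also have "\<dots> = (\<Sum>z\<in>A. \<Sum>y\<in>A - {z}. t z y) + (\<Sum>z\<in>A. \<Sum>y\<in>- V - A. t z y)"
        by (rule sum.distrib)
      \<comment> \<open>Pairs inside A cancel for the same reason as in d d = 0; only pairs with z
        in A and y outside A remain.\<close>
      also have "(\<Sum>z\<in>A. \<Sum>y\<in>A - {z}. t z y) = 0"
      proof (rule antisymmetric_sum_eq_0)
        fix z y assume "z \<in> A" "y \<in> A" "z \<noteq> y"
        then have "z \<in> - V" "y \<in> - V" "z \<noteq> y" using AV by auto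
        moreover have "- V - {z} - {y} = - V - {y} - {z}" by auto
        ultimately show "t z y = - t y z"
          unfolding t_def by (simp add: koszul_sign_swap[of z "- V" y] mult.commute)
      qed
      finally have Teq: "T (koszul_d free_variable \<psi>) = (\<Sum>z\<in>A. \<Sum>y\<in>- V - A. t z y)" by simp
      \<comment> \<open>A remaining term with exponent e would come from some w in F - E of the same
        fibre, below e both at z and at y. The hypothesis then puts min(p, w) into F, next the
        minimum of that with q, and the latter divides min(p, q).\<close>
      have "Poly_Mapping.lookup (t z y) e = 0" if z: "z \<in> A" and y: "y \<in> - V - A" for z y
      proof -
        define f where "f = koszul_sign z (- V) * koszul_sign y (- V - {z}) * \<psi> (- V - {z} - {y})"
        have f: "f \<in> supported_in F" unfolding f_def using ideal_setD(3)[OF U \<psi>(1)] .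
        have "z \<notin> V" using z AV by auto
        have "t z y = variable z * (variable y * f)"
          using y \<open>z \<notin> V\<close> by (simp add: t_def f_def free_variable_def mult_ac)
        moreover have "Poly_Mapping.lookup (variable z * (variable y * f)) e = 0"
        proof (rule lookup_variable_mult_eq_0)
          fix w' assume "w' \<in> Poly_Mapping.keys (variable y * f)"
          then obtain w where w: "w \<in> Poly_Mapping.keys f" "w' = Poly_Mapping.single y 1 + w"
            unfolding variable_def keys_monomial_mult by blast
          show "e \<noteq> Poly_Mapping.single z 1 + w'"
          proof
            assume ew: "e = Poly_Mapping.single z 1 + w'"
            have le: "Poly_Mapping.lookup w i \<le> Poly_Mapping.lookup e i" for i
              by (simp add: ew w lookup_add)
            have wz: "Poly_Mapping.lookup w z < Poly_Mapping.lookup e z"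
              and wy: "Poly_Mapping.lookup w y < Poly_Mapping.lookup e y"
              by (simp_all add: ew w lookup_add)
            have "w \<in> F" using f w by (auto simp: supported_in_def)
            moreover have "w \<notin> E"
            proof
              assume "w \<in> E"
              then show False using e_E unfolding ew w(2) by (blast intro: up_closedD(2)[OF E_up])
            qed
            ultimately have wFE: "w \<in> F - E" by blast
            have wfib: "same_fibre p w"
              unfolding same_fibre_def
            proof
              fix i assume i: "i \<in> V"
              have "z \<noteq> i" "y \<noteq> i" using i \<open>z \<notin> V\<close> y by auto
              then have "Poly_Mapping.lookup e i = Poly_Mapping.lookup w i"
                by (simp add: ew w lookup_add lookup_single)
              then show "Poly_Mapping.lookup p i = Poly_Mapping.lookup w i"
                using e_fibre i by (simp add: same_fibre_def)
            qed
            \<comment> \<open>Since z lies in A, e exceeds p at z, and the drop of w there lowers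
              the maximum. Since y lies outside A, e equals p at y, and the drop of w there lowers
              the minimum.\<close>
            have "total_degree (p + (w - p)) < total_degree e"
            proof (rule total_degree_strict_mono)
              show "Poly_Mapping.lookup (p + (w - p)) i \<le> Poly_Mapping.lookup e i" for i
                using le[of i] by (simp add: lookup_add lookup_minus look_e)
              show "Poly_Mapping.lookup (p + (w - p)) z < Poly_Mapping.lookup e z"
                using z wz by (simp add: lookup_add lookup_minus look_e A_def)
            qed
            then have g: "p - (p - w) \<in> F"
              using less.hyps[OF _ less.prems(1) wFE wfib] by (simp add: e_def)
            define g where "g = p - (p - w)"
            have look_g: "Poly_Mapping.lookup g i = min (Poly_Mapping.lookup p i) (Poly_Mapping.lookup w i)" for i
              by (simp add: g_def lookup_minus)
            have gfib: "same_fibre g p" using wfib by (simp add: same_fibre_def look_g)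
            then have gFE: "g \<in> F - E" using g same_fibre_E less.prems(1) by (auto simp: g_def)
            have "same_fibre g q" using gfib less.prems(3) by (simp add: same_fibre_def)
            moreover have "total_degree g < total_degree p"
            proof (rule total_degree_strict_mono)
              show "Poly_Mapping.lookup g i \<le> Poly_Mapping.lookup p i" for i by (simp add: look_g)
              show "Poly_Mapping.lookup g y < Poly_Mapping.lookup p y"
                using y wy by (simp add: look_g look_e A_def)
            qed
            moreover have "total_degree (g + (q - g)) \<le> total_degree e"
              by (rule total_degree_mono) (auto simp: lookup_add lookup_minus look_e look_g)
            ultimately have "g - (g - q) \<in> F"
              using less.hyps[OF _ gFE less.prems(2)] by (simp add: e_def)
            then have "p - (p - q) \<in> F"
              by (rule up_closed_le[OF F_up]) (simp add: lookup_minus look_g)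
            then show False using notin by blast
          qed
        qed
        ultimately show ?thesis by simp
      qed
      then show ?thesis unfolding Teq lookup_sum by simp
    qed
    ultimately show False by (simp add: lookup_minus monomial_def)
  qed
qed

section \<open>Monomial generators of the fibres\<close>

definition generators :: "('n \<Rightarrow>\<^sub>0 nat) set"
  where "generators = {g \<in> F - E. \<forall>q \<in> F - E. same_fibre q g \<longrightarrow>
    (\<forall>i. Poly_Mapping.lookup g i \<le> Poly_Mapping.lookup q i)}"

lemma generators_subset: "generators \<subseteq> F - E"
  by (auto simp: generators_def)

lemma generators_unique:
  assumes "g \<in> generators" "h \<in> generators" "same_fibre g h"
  shows "g = h"
proof (rule poly_mapping_eqI)
  have "same_fibre h g" using assms(3) by (simp add: same_fibre_def)
  then show "Poly_Mapping.lookup g i = Poly_Mapping.lookup h i" for i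
    using assms by (intro antisym) (auto simp: generators_def)
qed

text \<open>An element of least degree in its fibre is least in every coordinate: otherwise its
  minimum with some q, which stays in F - E and in the fibre, would have smaller degree.\<close>

lemma exists_generator:
  assumes fs: "set fs \<subseteq> graded_maximal_ideal" "regular_sequence Q fs" "card (- V) \<le> length fs"
    and t: "t \<in> F - E"
  obtains g where "g \<in> generators" "same_fibre g t" "\<And>i. Poly_Mapping.lookup g i \<le> Poly_Mapping.lookup t i"
proof -
  let ?P = "\<lambda>q. q \<in> F - E \<and> same_fibre q t"
  have "?P t" using t by (simp add: same_fibre_def)
  then obtain g where g: "?P g" "\<And>q. ?P q \<Longrightarrow> total_degree g \<le> total_degree q"
    using ex_has_least_nat[of ?P t total_degree] by blast
  have "Poly_Mapping.lookup g i \<le> Poly_Mapping.lookup q i" if "q \<in> F - E" "same_fibre q g" for q i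
  proof (rule ccontr)
    assume "\<not> Poly_Mapping.lookup g i \<le> Poly_Mapping.lookup q i"
    then have i: "Poly_Mapping.lookup q i < Poly_Mapping.lookup g i" by simp
    let ?h = "g - (g - q)"
    have "same_fibre g q" using that(2) by (simp add: same_fibre_def)
    then have "?h \<in> F" using min_in_F[OF fs] g(1) that(1) by blast
    moreover have fib: "same_fibre ?h g" using that(2) by (simp add: same_fibre_def lookup_minus)
    moreover have "?h \<notin> E" using same_fibre_E[OF fib] g(1) by blast
    ultimately have "?P ?h" using g(1) by (simp add: same_fibre_def)
    moreover have "total_degree ?h < total_degree g"
      by (rule total_degree_strict_mono[where j = i]) (use i in \<open>auto simp: lookup_minus\<close>)
    ultimately show False using g(2) by fastforce
  qed
  then have "g \<in> generators" using g(1) by (simp add: generators_def)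
  moreover have "same_fibre t g" using g(1) by (simp add: same_fibre_def)
  ultimately show thesis using that g(1) t by (auto simp: generators_def)
qed

text \<open>A generator is determined by its exponents at V, and these are at most m because x_i^m
  lies in I for i in V.\<close>

lemma finite_generators: "finite generators"
proof -
  define profile where "profile g i = (if i \<in> V then Poly_Mapping.lookup g i else 0)" for g :: "'n \<Rightarrow>\<^sub>0 nat" and i
  have "profile ` generators \<subseteq> (UNIV \<rightarrow>\<^sub>E {..m})"
  proof -
    have "Poly_Mapping.lookup g i \<le> m" if "g \<in> generators" "i \<in> V" for g i
    proof (rule ccontr)
      assume *: "\<not> Poly_Mapping.lookup g i \<le> m"
      have "g \<in> E"
        by (rule up_closed_le[OF E_up power_in[OF that(2)]]) (use * in \<open>auto simp: lookup_single when_def\<close>)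
      then show False using that(1) generators_subset by blast
    qed
    then show ?thesis by (auto simp: profile_def)
  qed
  then have "finite (profile ` generators)" by (rule finite_subset) (simp add: finite_PiE)
  moreover have "inj_on profile generators"
    by (rule inj_onI, rule generators_unique) (auto simp: profile_def same_fibre_def fun_eq_iff, metis)
  ultimately show ?thesis by (rule finite_imageD)
qed

end

section \<open>Dimension and depth\<close>

lemma (in cring) primeideal_quotient_image:
  assumes J: "ideal J R" and P: "primeideal P R" "J \<subseteq> P"
  shows "primeideal ((+>) J ` P) (R Quot J)"
    and "a \<in> carrier R \<Longrightarrow> J +> a \<in> (+>) J ` P \<longleftrightarrow> a \<in> P"
proof -
  interpret J: ideal J R by (rule J)
  interpret P: primeideal P R by (rule P(1))
  have ideal: "ideal ((+>) J ` P) (R Quot J)" by (rule ring_ideal_imp_quot_ideal[OF J P.is_ideal])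
  have "P = (\<Union>p\<in>P. J +> p)" using ideal_incl_iff[OF J P.is_ideal] P(2) by simp
  then have union: "\<Union> ((+>) J ` P) = P" by simp
  have sub: "(+>) J ` P \<subseteq> carrier (R Quot J)"
    by (rule additive_subgroup.a_subset[OF ideal.axioms(1)[OF ideal]])
  show mem: "J +> a \<in> (+>) J ` P \<longleftrightarrow> a \<in> P" if "a \<in> carrier R" for a
    using canonical_proj_vimage_mem_iff[OF J sub that] union by simp
  show "primeideal ((+>) J ` P) (R Quot J)"
  proof (rule primeidealI[OF ideal])
    show "cring (R Quot J)" by (rule J.quotient_is_cring[OF is_cring])
    show "carrier (R Quot J) \<noteq> (+>) J ` P"
    proof
      assume eq: "carrier (R Quot J) = (+>) J ` P"
      have "carrier R \<subseteq> P"
      proof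
        fix a assume a: "a \<in> carrier R"
        then have "J +> a \<in> carrier (R Quot J)" by (auto simp: FactRing_def A_RCOSETS_def')
        then show "a \<in> P" using eq mem[OF a] by simp
      qed
      then show False using P.I_notcarr P.a_subset by blast
    qed
  next
    fix A B assume "A \<in> carrier (R Quot J)" "B \<in> carrier (R Quot J)"
    then obtain a b where ab: "a \<in> carrier R" "A = J +> a" "b \<in> carrier R" "B = J +> b"
      by (auto simp: FactRing_def A_RCOSETS_def')
    assume "A \<otimes>\<^bsub>R Quot J\<^esub> B \<in> (+>) J ` P"
    then have "J +> (a \<otimes> b) \<in> (+>) J ` P" using ab J.rcoset_mult_add by (simp add: FactRing_def)
    then have "a \<in> P \<or> b \<in> P" using mem P.I_prime ab by simp
    then show "A \<in> (+>) J ` P \<or> B \<in> (+>) J ` P" using ab by blast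
  qed
qed

text \<open>The correspondence of prime ideals turns chains in the quotient into chains of primes of
  R above J, so that quotients by different ideals can be compared inside R.\<close>

lemma (in cring) krull_dim_quotient:
  assumes J: "ideal J R"
  shows "krull_dim (R Quot J) = Sup {enat k | k. \<exists>P. (\<forall>i\<le>k. primeideal (P i) R \<and> J \<subseteq> P i) \<and>
    (\<forall>i<k. P i \<subset> P (Suc i))}"
proof -
  interpret J: ideal J R by (rule J)
  interpret h: ring_hom_ring R "R Quot J" "(+>) J" by (rule J.rcos_ring_hom_ring)
  have "(\<exists>P :: nat \<Rightarrow> 'a set set. (\<forall>i\<le>k. primeideal (P i) (R Quot J)) \<and> (\<forall>i<k. P i \<subset> P (Suc i))) \<longleftrightarrow>
      (\<exists>P. (\<forall>i\<le>k. primeideal (P i) R \<and> J \<subseteq> P i) \<and> (\<forall>i<k. P i \<subset> P (Suc i)))" for k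
  proof
    assume "\<exists>P :: nat \<Rightarrow> 'a set set. (\<forall>i\<le>k. primeideal (P i) (R Quot J)) \<and> (\<forall>i<k. P i \<subset> P (Suc i))"
    then obtain P :: "nat \<Rightarrow> 'a set set" where
      P: "\<And>i. i \<le> k \<Longrightarrow> primeideal (P i) (R Quot J)" "\<And>i. i < k \<Longrightarrow> P i \<subset> P (Suc i)" by blast
    define P' where "P' i = {r \<in> carrier R. J +> r \<in> P i}" for i
    have sub: "P i \<subseteq> carrier (R Quot J)" if "i \<le> k" for i
      by (rule additive_subgroup.a_subset[OF ideal.axioms(1)[OF primeideal.axioms(1)[OF P(1)[OF that]]]])
    have "primeideal (P' i) R" if "i \<le> k" for i
      unfolding P'_def by (rule h.primeideal_vimage[OF is_cring P(1)[OF that]])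
    moreover have "J \<subseteq> P' i" if "i \<le> k" for i
    proof
      fix r assume r: "r \<in> J"
      have "J \<in> P i"
        using additive_subgroup.zero_closed[OF ideal.axioms(1)[OF primeideal.axioms(1)[OF P(1)[OF that]]]]
        unfolding FactRing_def by simp
      moreover have "J +> r = J" by (rule J.a_rcos_const[OF r])
      ultimately show "r \<in> P' i" using J.Icarr[OF r] by (simp add: P'_def)
    qed
    moreover have "P' i \<subset> P' (Suc i)" if i: "i < k" for i
    proof
      show "P' i \<subseteq> P' (Suc i)" using P(2)[OF i] by (auto simp: P'_def)
      obtain A where A: "A \<in> P (Suc i)" "A \<notin> P i" using P(2)[OF i] by blast
      then have "A \<in> carrier (R Quot J)" using sub[of "Suc i"] i by auto
      then obtain r where "r \<in> carrier R" "A = J +> r" unfolding FactRing_def A_RCOSETS_def' by auto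
      then have "r \<in> P' (Suc i)" "r \<notin> P' i" using A by (simp_all add: P'_def)
      then show "P' i \<noteq> P' (Suc i)" by blast
    qed
    ultimately show "\<exists>P. (\<forall>i\<le>k. primeideal (P i) R \<and> J \<subseteq> P i) \<and> (\<forall>i<k. P i \<subset> P (Suc i))" by blast
  next
    assume "\<exists>P. (\<forall>i\<le>k. primeideal (P i) R \<and> J \<subseteq> P i) \<and> (\<forall>i<k. P i \<subset> P (Suc i))"
    then obtain P where P: "\<And>i. i \<le> k \<Longrightarrow> primeideal (P i) R" "\<And>i. i \<le> k \<Longrightarrow> J \<subseteq> P i"
      "\<And>i. i < k \<Longrightarrow> P i \<subset> P (Suc i)" by blast
    have "(+>) J ` P i \<subset> (+>) J ` P (Suc i)" if i: "i < k" for i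
    proof
      show "(+>) J ` P i \<subseteq> (+>) J ` P (Suc i)" using P(3)[OF i] by blast
      obtain r where r: "r \<in> P (Suc i)" "r \<notin> P i" using P(3)[OF i] by blast
      have "r \<in> carrier R"
        using r(1) ideal.Icarr[OF primeideal.axioms(1)[OF P(1)[OF Suc_leI[OF i]]]] by blast
      then show "(+>) J ` P i \<noteq> (+>) J ` P (Suc i)"
        using primeideal_quotient_image(2)[OF J P(1,2), of i r] r i by auto
    qed
    then show "\<exists>P :: nat \<Rightarrow> 'a set set. (\<forall>i\<le>k. primeideal (P i) (R Quot J)) \<and> (\<forall>i<k. P i \<subset> P (Suc i))"
      using primeideal_quotient_image(1)[OF J P(1,2)] by (intro exI[of _ "\<lambda>i. (+>) J ` P i"]) auto
  qed
  then show ?thesis unfolding krull_dim_def by (simp only:)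
qed

lemma (in cring) krull_dim_quotient_mono:
  assumes "ideal J R" "ideal J' R" "\<And>P. primeideal P R \<Longrightarrow> J' \<subseteq> P \<Longrightarrow> J \<subseteq> P"
  shows "krull_dim (R Quot J') \<le> krull_dim (R Quot J)"
  unfolding krull_dim_quotient[OF assms(1)] krull_dim_quotient[OF assms(2)]
  by (rule Sup_subset_mono) (use assms(3) in blast)

lemma presents_annihilator_ideal:
  assumes Q: "presents Q c U I"
  shows "ideal (annihilator mpoly_ring Q) mpoly_ring"
  unfolding ideal_mpoly_iff presents_annihilator[OF Q] ideal_set_def
  using ideal_setD[OF presentsD(2)[OF Q]] by (simp add: distrib_right mult.assoc)

context primary_quotient
begin

text \<open>A term of \<open>f\<close> free of V could be cancelled and would put g into E. In ideal
  terms, (I : x^g) is contained in \<open>variable_prime V\<close>.\<close>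

lemma free_monomial_cancel:
  assumes "monomial g * f \<in> (supported_in E :: ('n, 'k) mpoly set)" "g \<notin> E" "t \<in> Poly_Mapping.keys f"
  shows "Poly_Mapping.keys t \<inter> V \<noteq> {}"
proof
  assume "Poly_Mapping.keys t \<inter> V = {}"
  moreover have "g + t \<in> E" using assms(1,3) by (auto simp: supported_in_def keys_monomial_mult)
  ultimately show False using cancel assms(2) by blast
qed

lemma annihilator_subset: "annihilator mpoly_ring Q \<subseteq> variable_prime V"
proof
  fix f assume f: "f \<in> annihilator mpoly_ring Q"
  obtain g where g: "g \<in> F - E" by (rule exists_fibre)
  then have "monomial g \<in> (supported_in F :: ('n, 'k) mpoly set)" by (simp add: supported_in_def)
  then have "monomial g * f \<in> supported_in E"
    using f unfolding presents_annihilator[OF Q] by (auto simp: mult.commute)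
  then show "f \<in> variable_prime V"
    using free_monomial_cancel g by (auto simp: variable_prime_def supported_in_def)
qed

lemma variable_power_annihilates:
  assumes "i \<in> V"
  shows "variable i ^ m * f \<in> (supported_in E :: ('n, 'k) mpoly set)"
proof -
  have "variable i ^ m \<in> (supported_in E :: ('n, 'k) mpoly set)"
    using power_in[OF assms] by (simp add: variable_power supported_in_def)
  then show ?thesis by (rule ideal_setD(4)[OF I])
qed

text \<open>The annihilator lies inside \<open>variable_prime V\<close> and contains x_i^m for every
  i in V, so a prime ideal cannot tell the two apart. Both the minimal primes and the dimension of M
  are read off from this.\<close>

lemma prime_contains_annihilator:
  assumes "primeideal P (mpoly_ring :: ('n, 'k) mpoly ring)"
  shows "annihilator mpoly_ring Q \<subseteq> P \<longleftrightarrow> variable_prime V \<subseteq> P"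
proof
  assume ann: "annihilator mpoly_ring Q \<subseteq> P"
  interpret primeideal P "mpoly_ring :: ('n, 'k) mpoly ring" by (rule assms)
  have P: "ideal_set P" using is_ideal by (simp add: ideal_mpoly_iff)
  have root: "f \<in> P" if "f ^ k \<in> P" for f k
    using that
  proof (induction k)
    case 0
    then have "r \<in> P" for r using ideal_setD(3)[OF P, of 1 r] by simp
    then show ?case by blast
  next
    case (Suc k)
    then show ?case using I_prime[of f "f ^ k"] by auto
  qed
  show "variable_prime V \<subseteq> P"
  proof (rule variable_prime_subset[OF P])
    fix i assume "i \<in> V"
    then have "variable i ^ m \<in> annihilator mpoly_ring Q"
      unfolding presents_annihilator[OF Q] using variable_power_annihilates by blast
    then show "variable i \<in> P" using ann root by blast
  qed
qed (use annihilator_subset in blast)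

lemma minimal_primes_eq: "minimal_primes mpoly_ring Q = {variable_prime V}"
  using prime_contains_annihilator variable_prime_primeideal[of V]
  unfolding minimal_primes_def by blast

lemma module_dim_eq: "module_dim mpoly_ring Q = krull_dim (mpoly_ring Quot (variable_prime V :: ('n, 'k) mpoly set))"
proof -
  interpret cring "mpoly_ring :: ('n, 'k) mpoly ring" by (rule cring_mpoly)
  have "ideal (variable_prime V) (mpoly_ring :: ('n, 'k) mpoly ring)"
    by (simp add: ideal_mpoly_iff variable_prime_ideal)
  then show ?thesis
    unfolding module_dim_def using presents_annihilator_ideal[OF Q] prime_contains_annihilator
    by (intro antisym krull_dim_quotient_mono) auto
qed

text \<open>Adjoining the variables outside V one at a time gives a strict chain of primes. The
  reverse inequality comes later, from \<open>depth_le\<close> and the Cohen-Macaulay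
  equality.\<close>

lemma krull_dim_variable_prime_ge:
  "enat (card (- V)) \<le> krull_dim (mpoly_ring Quot (variable_prime V :: ('n, 'k) mpoly set))"
proof -
  interpret cring "mpoly_ring :: ('n, 'k) mpoly ring" by (rule cring_mpoly)
  have J: "ideal (variable_prime V) (mpoly_ring :: ('n, 'k) mpoly ring)"
    by (simp add: ideal_mpoly_iff variable_prime_ideal)
  obtain f where f: "bij_betw f {0..<card (- V)} (- V)" using ex_bij_betw_nat_finite[of "- V"] by auto
  define W where "W k = V \<union> f ` {0..<k}" for k
  define P :: "nat \<Rightarrow> ('n, 'k) mpoly set" where "P k = variable_prime (W k)" for k
  have "P k \<subset> P (Suc k)" if k: "k < card (- V)" for k
  proof -
    have "f k \<notin> V" using f k by (auto simp: bij_betw_def)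
    moreover have "f k \<notin> f ` {0..<k}"
    proof
      assume "f k \<in> f ` {0..<k}"
      then obtain j where "j < k" "f k = f j" by auto
      then show False using inj_onD[OF bij_betw_imp_inj_on[OF f], of k j] k by simp
    qed
    ultimately have "\<not> W (Suc k) \<subseteq> W k" by (auto simp: W_def atLeast0_lessThan_Suc)
    moreover have "W k \<subseteq> W (Suc k)" by (auto simp: W_def)
    ultimately show ?thesis unfolding P_def less_le_not_le variable_prime_subset_iff by blast
  qed
  moreover have "primeideal (P k) mpoly_ring \<and> variable_prime V \<subseteq> P k" for k
    unfolding P_def variable_prime_subset_iff using variable_prime_primeideal by (auto simp: W_def)
  ultimately show ?thesis
    unfolding krull_dim_quotient[OF J] by (intro Sup_upper CollectI exI[of _ "card (- V)"] conjI refl) blast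
qed

lemma depth_le: "depth Q \<le> enat (card (- V))"
  unfolding depth_def using length_regular_sequence_le by (intro Sup_least) auto

lemma carrier_ne: "carrier Q \<noteq> {\<zero>\<^bsub>Q\<^esub>}"
proof -
  obtain g where g: "g \<in> F - E" by (rule exists_fibre)
  then have "c (monomial g) \<in> carrier Q" "c (monomial g) \<noteq> \<zero>\<^bsub>Q\<^esub>"
    using presents_eq_zero[OF Q, of "monomial g"] presentsD(4,5)[OF Q] by (auto simp: supported_in_def)
  then show ?thesis by blast
qed

text \<open>\<open>depth\<close> is a supremum, while an actual sequence of length |Z| is wanted.
  The lengths are bounded by \<open>length_regular_sequence_le\<close>, and the empty sequence is
  regular because M is nonzero, so the supremum is attained.\<close>

lemma regular_sequence_of_depth:
  assumes "cohen_macaulay Q"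
  obtains fs where "set fs \<subseteq> graded_maximal_ideal" "regular_sequence Q fs" "card (- V) \<le> length fs"
    "depth Q = enat (card (- V))" "module_dim mpoly_ring Q = enat (card (- V))"
proof -
  let ?S = "{enat (length fs) | fs. set fs \<subseteq> graded_maximal_ideal \<and> regular_sequence Q fs}"
  have dim: "depth Q = module_dim mpoly_ring Q" using assms by (simp add: cohen_macaulay_def)
  then have depth: "depth Q = enat (card (- V))"
    using depth_le krull_dim_variable_prime_ge unfolding module_dim_eq by simp
  obtain g where g: "g \<in> F - E" by (rule exists_fibre)
  then have gU: "monomial g \<in> (supported_in F :: ('n, 'k) mpoly set)" by (simp add: supported_in_def)
  have "c (monomial g) \<notin> c ` seq_ideal [] 0"
    unfolding seq_ideal_0 presents_mem_image[OF Q I order_refl I_subset_U gU]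
    using g by (simp add: supported_in_def)
  then have "c ` seq_ideal [] 0 \<noteq> carrier Q" using gU presentsD(4)[OF Q] by blast
  then have "regular_sequence Q []" using seq_multiple_eq[of 0 "[]"] by (simp add: regular_sequence_def)
  then have ne: "?S \<noteq> {}" by force
  have "?S \<subseteq> enat ` {..card (- V)}" using length_regular_sequence_le by auto
  then have fin: "finite ?S" by (rule finite_subset) simp
  have "Sup ?S = Max ?S" unfolding Sup_enat_def if_not_P[OF ne] if_P[OF fin] ..
  then have "Sup ?S \<in> ?S" using Max_in[OF fin ne] by simp
  then have "enat (card (- V)) \<in> ?S" using depth by (simp add: depth_def)
  then show thesis using that depth dim by force
qed

end

section \<open>The clean filtration\<close>

text \<open>An element that kills M kills each factor of the filtration, and in S/P only the
  elements of P kill the class of 1.\<close>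

lemma presents_annihilator_subset_prime:
  fixes M :: "('n::finite, 'k::field, 'm) multigraded_module"
  assumes M: "presents M c U I" and F: "prime_filtration M Ms Ps" and P: "P \<in> set Ps"
  shows "annihilator mpoly_ring M \<subseteq> P"
proof
  fix f assume f: "f \<in> annihilator mpoly_ring M"
  from P obtain i where i: "i < length Ps" "P = Ps ! i" by (auto simp: in_set_conv_nth)
  interpret module mpoly_ring M by (rule presents_module[OF M])
  from F i have len: "length Ms = Suc (length Ps)" and sub: "\<forall>N\<in>set Ms. graded_submodule N M"
    and Pi: "monomial_ideal P"
    by (simp_all add: prime_filtration_def)
  have "\<exists>a :: 'n \<Rightarrow> nat. graded_isomorphic (quotient_module (restrict_module M (Ms ! Suc i)) (Ms ! i))
      (shift_module (quotient_module mpoly_module P) (\<lambda>j. int (a j)))"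
    using F i(1) unfolding prime_filtration_def i(2) by blast
  then obtain a :: "'n \<Rightarrow> nat" where "graded_isomorphic (quotient_module (restrict_module M (Ms ! Suc i)) (Ms ! i))
      (shift_module (quotient_module mpoly_module P) (\<lambda>j. int (a j)))"
    by blast
  then obtain \<phi> where bij: "bij_betw \<phi> (carrier (quotient_module (restrict_module M (Ms ! Suc i)) (Ms ! i)))
      (carrier (quotient_module mpoly_module P))"
    and smult: "\<And>g x. x \<in> carrier (quotient_module (restrict_module M (Ms ! Suc i)) (Ms ! i)) \<Longrightarrow>
      \<phi> (g \<odot>\<^bsub>quotient_module (restrict_module M (Ms ! Suc i)) (Ms ! i)\<^esub> x)
        = g \<odot>\<^bsub>quotient_module mpoly_module P\<^esub> \<phi> x"
    by (auto simp: graded_isomorphic_def shift_module_def)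
  let ?q = "quotient_module (restrict_module M (Ms ! Suc i)) (Ms ! i)"
  obtain c' where c': "presents (quotient_module mpoly_module P) c' UNIV P"
    using presents_quotient_mpoly monomial_idealE(3)[OF Pi] by blast
  have "c' 1 \<in> carrier (quotient_module mpoly_module P)" using presentsD(4)[OF c'] by simp
  \<comment> \<open>\<open>C\<close> corresponds to the generator 1 of S/P. Both f and 0 send it to
    zero, and \<phi> transports this equality to S/P.\<close>
  then obtain C where C: "C \<in> carrier ?q" "\<phi> C = c' 1"
    unfolding bij_betw_imp_surj_on[OF bij, symmetric] by (elim imageE) simp
  then obtain y where y: "y \<in> Ms ! Suc i" "C = (Ms ! i) +>\<^bsub>restrict_module M (Ms ! Suc i)\<^esub> y"
    by (auto simp: quotient_module_def A_RCOSETS_def' restrict_module_def)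
  have "Ms ! i \<in> set Ms" "Ms ! Suc i \<in> set Ms" using i len by simp_all
  then have s: "submodule (Ms ! i) mpoly_ring M" "submodule (Ms ! Suc i) mpoly_ring M"
    using sub by (auto simp: graded_submodule_def)
  note s1 = submoduleE[OF s(1)] and s2 = submoduleE[OF s(2)]
  have zero: "\<zero>\<^bsub>M\<^esub> \<in> Ms ! i"
    using subgroup.one_closed[OF submodule.axioms(1)[OF s(1)]] by simp
  have kill: "g \<odot>\<^bsub>?q\<^esub> C = Ms ! i" if g: "\<And>x. x \<in> carrier M \<Longrightarrow> g \<odot>\<^bsub>M\<^esub> x = \<zero>\<^bsub>M\<^esub>" for g
  proof -
    have C_sub: "x \<in> carrier M" if "x \<in> C" for x
      using that s1(1) s2(1) y by (auto simp: a_r_coset_def' restrict_module_def)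
    have "y \<in> C" unfolding y(2) a_r_coset_def'
      using zero s2(1) y(1) by (auto simp: restrict_module_def intro!: bexI[of _ "\<zero>\<^bsub>M\<^esub>"])
    moreover have "(Ms ! i) +>\<^bsub>restrict_module M (Ms ! Suc i)\<^esub> \<zero>\<^bsub>M\<^esub> = Ms ! i"
      using s1(1) by (force simp: a_r_coset_def' restrict_module_def)
    ultimately show ?thesis using g C_sub
      by (auto simp: quotient_module_def restrict_module_def)
  qed
  have "f \<odot>\<^bsub>?q\<^esub> C = Ms ! i" by (rule kill) (use f in \<open>auto simp: annihilator_def\<close>)
  moreover have "0 \<odot>\<^bsub>?q\<^esub> C = Ms ! i" by (rule kill) (use smult_l_null in simp)
  ultimately have "f \<odot>\<^bsub>quotient_module mpoly_module P\<^esub> c' 1 = 0 \<odot>\<^bsub>quotient_module mpoly_module P\<^esub> c' 1"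
    using smult[OF C(1), of f] smult[OF C(1), of 0] C(2) by simp
  then have "c' f = c' 0" using presentsD(7)[OF c'] by simp
  then show "f \<in> P" using presents_eq_zero[OF c'] by simp
qed

context primary_quotient
begin

text \<open>Every P in the support contains the annihilator, so dim S/P is at most dim M.\<close>

lemma filtration_fdepth_le:
  assumes "prime_filtration Q Ms Ps"
  shows "filtration_fdepth Ps \<le> module_dim mpoly_ring Q"
proof -
  interpret cring "mpoly_ring :: ('n, 'k) mpoly ring" by (rule cring_mpoly)
  \<comment> \<open>The infimum over an empty list would be infinite; it is excluded because M is
    nonzero.\<close>
  have "Ps \<noteq> []"
  proof
    assume "Ps = []"
    then have "hd Ms = last Ms" using assms by (cases Ms) (auto simp: prime_filtration_def)
    moreover have "hd Ms = {\<zero>\<^bsub>Q\<^esub>}" "last Ms = carrier Q"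
      using assms unfolding prime_filtration_def by blast+
    ultimately show False using carrier_ne by simp
  qed
  then obtain P where P: "P \<in> set Ps" using hd_in_set by blast
  then obtain i where "i < length Ps" "P = Ps ! i" unfolding in_set_conv_nth by blast
  then have "monomial_ideal P" using assms unfolding prime_filtration_def by blast
  then have "ideal P mpoly_ring" by (simp add: ideal_mpoly_iff monomial_idealE(3))
  then have "krull_dim (mpoly_ring Quot P) \<le> module_dim mpoly_ring Q"
    unfolding module_dim_def using presents_annihilator_ideal[OF Q] presents_annihilator_subset_prime[OF Q assms P]
    by (intro krull_dim_quotient_mono) auto
  moreover have "filtration_fdepth Ps \<le> krull_dim (mpoly_ring Quot P)"
    unfolding filtration_fdepth_def using P by (intro Inf_lower) auto
  ultimately show ?thesis by simp
qed

text \<open>A free K[Z]-module is torsion-free, but x_j^m annihilates M for j in V. Hence a nonzero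
  Stanley space uses only variables outside V.\<close>

lemma decomposition_sdepth_le:
  assumes D: "stanley_decomposition Q D"
  shows "decomposition_sdepth D \<le> enat (card (- V))"
proof -
  interpret module mpoly_ring Q by (rule presents_module[OF Q])
  note q = presentsD[OF Q]
  \<comment> \<open>The zero space is free for every Z, with empty basis, and bounds nothing.
    Expanding a nonzero x yields a summand that is not zero.\<close>
  obtain x where x: "x \<in> carrier Q" "x \<noteq> \<zero>\<^bsub>Q\<^esub>" using carrier_ne M.zero_closed by blast
  from D have "\<forall>x \<in> carrier Q. \<exists>w. w \<in> (\<Pi>\<^sub>E i \<in> {..<length D}. cyclic_subspace Q (fst (D ! i)) (snd (D ! i))) \<and>
      x = (\<Oplus>\<^bsub>Q\<^esub> i \<in> {..<length D}. w i)"
    unfolding stanley_decomposition_def Ex1_def by blast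
  with x(1) obtain w where w: "w \<in> (\<Pi>\<^sub>E i \<in> {..<length D}. cyclic_subspace Q (fst (D ! i)) (snd (D ! i)))"
    "x = (\<Oplus>\<^bsub>Q\<^esub> i \<in> {..<length D}. w i)"
    by blast
  have "\<exists>i<length D. w i \<noteq> \<zero>\<^bsub>Q\<^esub>"
  proof (rule ccontr)
    assume "\<not> (\<exists>i<length D. w i \<noteq> \<zero>\<^bsub>Q\<^esub>)"
    then have "x = (\<Oplus>\<^bsub>Q\<^esub> i \<in> {..<length D}. \<zero>\<^bsub>Q\<^esub>)"
      unfolding w(2) by (intro M.finsum_cong') auto
    then show False using x(2) by simp
  qed
  then obtain i where i: "i < length D" "w i \<noteq> \<zero>\<^bsub>Q\<^esub>" by blast
  define y Z where "y = fst (D ! i)" and "Z = snd (D ! i)"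
  have yZ: "(y, Z) \<in> set D" using i by (simp add: y_def Z_def)
  then have y: "y \<in> carrier Q" "stanley_space Q y Z" using D by (auto simp: stanley_decomposition_def)
  have wi: "w i \<in> cyclic_subspace Q y Z" using w(1) i by (auto simp: y_def Z_def)
  from y(1) obtain a where a: "a \<in> supported_in F" "y = c a" by (auto simp: q(4))
  define W where "W = (\<lambda>f. f * a) ` (polys_in Z :: ('n, 'k) mpoly set)"
  have aU: "f * a \<in> supported_in F" for f using ideal_setD(3)[OF U a(1)] .
  have cyc: "cyclic_subspace Q y Z = c ` W"
    using q(7)[OF a(1)] by (simp add: cyclic_subspace_def W_def a(2) image_image)
  have WU: "W \<subseteq> supported_in F" using aU by (auto simp: W_def)
  have W0: "0 \<in> W" unfolding W_def by (rule image_eqI[of _ _ 0]) (simp_all add: polys_in_def)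
  have Wadd: "u + v \<in> W" if uv: "u \<in> W" "v \<in> W" for u v
  proof -
    from uv obtain f g where "f \<in> polys_in Z" "g \<in> polys_in Z" "u = f * a" "v = g * a" by (auto simp: W_def)
    moreover from this have "f + g \<in> polys_in Z" using keys_add[of f g] by (auto simp: polys_in_def)
    ultimately show ?thesis unfolding W_def by (intro image_eqI[of _ _ "f + g"]) (simp_all add: distrib_right)
  qed
  let ?M = "Q\<lparr>carrier := c ` W\<rparr>"
  interpret W: abelian_monoid ?M by (rule presents_restrict_finsum(1)[OF Q WU W0 Wadd])
  have "\<exists>B\<subseteq>c ` W. \<forall>x\<in>c ` W. \<exists>!b. b ` B \<subseteq> polys_in Z \<and>
      (\<forall>v. v \<notin> B \<longrightarrow> b v = 0) \<and> finite {v. b v \<noteq> 0} \<and> x = (\<Oplus>\<^bsub>?M\<^esub> v \<in> {v. b v \<noteq> 0}. b v \<odot>\<^bsub>Q\<^esub> v)"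
    using y(2) by (simp add: stanley_space_def free_module_def cyc)
  then obtain B where B: "B \<subseteq> c ` W" "\<forall>x\<in>c ` W. \<exists>!b. b ` B \<subseteq> polys_in Z \<and>
      (\<forall>v. v \<notin> B \<longrightarrow> b v = 0) \<and> finite {v. b v \<noteq> 0} \<and> x = (\<Oplus>\<^bsub>?M\<^esub> v \<in> {v. b v \<noteq> 0}. b v \<odot>\<^bsub>Q\<^esub> v)"
    by blast
  have "Z \<inter> V = {}"
  proof (rule ccontr)
    assume "Z \<inter> V \<noteq> {}"
    then obtain j where j: "j \<in> Z" "j \<in> V" by blast
    define r where "r = (variable j ^ m :: ('n, 'k) mpoly)"
    have r: "r \<in> polys_in Z" "r \<noteq> 0"
      using j by (auto simp: r_def variable_power polys_in_def keys_eq_empty[symmetric] simp del: keys_eq_empty split: if_splits)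
    have "B \<noteq> {}"
    proof
      assume "B = {}"
      moreover have "\<exists>b. (\<forall>v. v \<notin> B \<longrightarrow> b v = 0) \<and> w i = (\<Oplus>\<^bsub>?M\<^esub> v \<in> {v. b v \<noteq> (0 :: ('n, 'k) mpoly)}. b v \<odot>\<^bsub>Q\<^esub> v)"
        using ex1_implies_ex[OF bspec[OF B(2) wi[unfolded cyc]]] by blast
      ultimately obtain b where b: "\<forall>v. b v = (0 :: ('n, 'k) mpoly)"
        "w i = (\<Oplus>\<^bsub>?M\<^esub> v \<in> {v. b v \<noteq> 0}. b v \<odot>\<^bsub>Q\<^esub> v)" by blast
      have "{v. b v \<noteq> 0} = {}" using b(1) by simp
      then have "w i = \<zero>\<^bsub>Q\<^esub>" using b(2) by simp
      then show False using i(2) by simp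
    qed
    then obtain b where b: "b \<in> B" by blast
    then obtain u where u: "u \<in> W" "b = c u" using B(1) by blast
    have "r \<odot>\<^bsub>Q\<^esub> b = c (r * u)" using q(7) u WU by auto
    also have "\<dots> = c 0"
      using presents_eq_zero[OF Q, of "r * u"] variable_power_annihilates[OF j(2)] I_subset_U by (auto simp: r_def)
    finally have rb: "r \<odot>\<^bsub>Q\<^esub> b = \<zero>\<^bsub>Q\<^esub>" using q(5) by simp
    have zW: "\<zero>\<^bsub>Q\<^esub> \<in> c ` W" using W0 q(5) by blast
    \<comment> \<open>The coefficient r at b and the zero family both represent 0, against the
      uniqueness of coordinates.\<close>
    define f where "f v = (if v = b then r else 0)" for v
    have supp: "{v. f v \<noteq> 0} = {b}" using r(2) by (auto simp: f_def)
    have "(\<Oplus>\<^bsub>?M\<^esub> v \<in> {b}. f v \<odot>\<^bsub>Q\<^esub> v) = f b \<odot>\<^bsub>Q\<^esub> b \<oplus>\<^bsub>?M\<^esub> (\<Oplus>\<^bsub>?M\<^esub> v \<in> {}. f v \<odot>\<^bsub>Q\<^esub> v)"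
      by (subst W.finsum_insert) (use rb zW in \<open>auto simp: f_def\<close>)
    then have "(\<Oplus>\<^bsub>?M\<^esub> v \<in> {v. f v \<noteq> 0}. f v \<odot>\<^bsub>Q\<^esub> v) = \<zero>\<^bsub>Q\<^esub>"
      unfolding supp using rb W.r_zero[of "\<zero>\<^bsub>Q\<^esub>"] zW by (simp add: f_def)
    moreover have "f ` B \<subseteq> polys_in Z" using r(1) by (auto simp: f_def polys_in_def)
    moreover have "(\<Oplus>\<^bsub>?M\<^esub> v \<in> {v. (\<lambda>_. 0 :: ('n, 'k) mpoly) v \<noteq> 0}. (\<lambda>_. 0) v \<odot>\<^bsub>Q\<^esub> v) = \<zero>\<^bsub>Q\<^esub>"
      by simp
    moreover have "(\<lambda>_. 0) ` B \<subseteq> (polys_in Z :: ('n, 'k) mpoly set)" by (auto simp: polys_in_def)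
    moreover have "finite {v. f v \<noteq> 0}" unfolding supp by simp
    moreover have "\<forall>v. v \<notin> B \<longrightarrow> f v = 0" using b by (auto simp: f_def)
    moreover have unique: "b = b'" if "\<exists>!b. R b" "R b" "R b'" for R and b b' :: "'m \<Rightarrow> ('n, 'k) mpoly"
      using that by blast
    ultimately have "f = (\<lambda>_. 0)" by (intro unique[OF bspec[OF B(2) zW]]) simp_all
    then show False using r(2) by (auto simp: f_def fun_eq_iff split: if_splits)
  qed
  then have "card Z \<le> card (- V)" by (intro card_mono) auto
  moreover have "decomposition_sdepth D \<le> enat (card Z)"
    unfolding decomposition_sdepth_def using yZ by (intro Inf_lower) force
  ultimately show ?thesis using order_trans by fastforce
qed

end

text \<open>\<open>generated\<close> is what Cohen-Macaulayness contributes: each fibre is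
  principal. The sorting key looks only at exponents in V, so it is constant on fibres.\<close>

locale sorted_generators = primary_quotient Q c F E V m
  for Q :: "('n::finite, 'k::field, 'm) multigraded_module" and c :: "('n, 'k) mpoly \<Rightarrow> 'm"
    and F E V m +
  fixes gs :: "('n \<Rightarrow>\<^sub>0 nat) list"
  assumes distinct: "distinct gs" and set_gs: "set gs = generators"
    and sorted: "i \<le> j \<Longrightarrow> j < length gs \<Longrightarrow>
      (\<Sum>v\<in>V. Poly_Mapping.lookup (gs ! j) v) \<le> (\<Sum>v\<in>V. Poly_Mapping.lookup (gs ! i) v)"
    and generated: "t \<in> F - E \<Longrightarrow>
      \<exists>g\<in>generators. same_fibre g t \<and> (\<forall>i. Poly_Mapping.lookup g i \<le> Poly_Mapping.lookup t i)"
begin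

lemma nth_FE: "i < length gs \<Longrightarrow> gs ! i \<in> F - E"
  using generators_subset set_gs nth_mem by blast

lemma nth_fibre_eq: "i < length gs \<Longrightarrow> j < length gs \<Longrightarrow> same_fibre (gs ! i) (gs ! j) \<Longrightarrow> i = j"
  using generators_unique[of "gs ! i" "gs ! j"] set_gs distinct nth_mem nth_eq_iff_index_eq by blast

lemma same_fibre_sym: "same_fibre s t \<Longrightarrow> same_fibre t s"
  by (simp add: same_fibre_def)

lemma same_fibre_trans: "same_fibre s t \<Longrightarrow> same_fibre t u \<Longrightarrow> same_fibre s u"
  by (simp add: same_fibre_def)

lemma same_fibre_add: "Poly_Mapping.keys u \<inter> V = {} \<Longrightarrow> same_fibre t (t + u)"
  by (auto simp: same_fibre_def lookup_add in_keys_iff)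

lemma generated_nth:
  assumes "t \<in> F - E"
  obtains j where "j < length gs" "same_fibre (gs ! j) t"
    "\<And>i. Poly_Mapping.lookup (gs ! j) i \<le> Poly_Mapping.lookup t i"
  using generated[OF assms] set_gs by (metis in_set_conv_nth)

lemma nth_le:
  assumes "j < length gs" "t \<in> F - E" "same_fibre (gs ! j) t"
  shows "Poly_Mapping.lookup (gs ! j) i \<le> Poly_Mapping.lookup t i"
proof -
  obtain k where k: "k < length gs" "same_fibre (gs ! k) t"
    "\<And>i. Poly_Mapping.lookup (gs ! k) i \<le> Poly_Mapping.lookup t i"
    by (rule generated_nth[OF assms(2)]) blast
  have "same_fibre (gs ! k) (gs ! j)" using k(2) same_fibre_sym[OF assms(3)] same_fibre_trans by blast
  then have "k = j" using nth_fibre_eq k(1) assms(1) by blast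
  with k(3) show ?thesis by simp
qed

text \<open>The exponents of the ideal generated by I and the first k generators. Description by
  fibres makes the difference of two consecutive stages a single fibre.\<close>

definition stage :: "nat \<Rightarrow> ('n \<Rightarrow>\<^sub>0 nat) set"
  where "stage k = E \<union> {t \<in> F - E. \<exists>j<k. j < length gs \<and> same_fibre (gs ! j) t}"

lemma stage_0: "stage 0 = E"
  by (simp add: stage_def)

lemma stage_length: "stage (length gs) = F"
proof
  show "F \<subseteq> stage (length gs)"
  proof
    fix t assume t: "t \<in> F"
    show "t \<in> stage (length gs)"
    proof (cases "t \<in> E")
      case False
      then obtain j where "j < length gs" "same_fibre (gs ! j) t"
        using t generated_nth[of t] by blast
      then show ?thesis using t by (auto simp: stage_def)
    qed (simp add: stage_def)
  qed
qed (use E_subset in \<open>auto simp: stage_def\<close>)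

lemma stage_Suc: "stage k \<subseteq> stage (Suc k)"
  by (auto simp: stage_def less_Suc_eq)

lemma stage_bounds: "E \<subseteq> stage k" "stage k \<subseteq> F"
  using E_subset by (auto simp: stage_def)

text \<open>
  Multiplying by a variable of \<open>V\<close> raises the degree in these variables, hence leads to a generator
  that comes earlier in the list.
\<close>

lemma stage_up_closed: "up_closed (stage k)"
  unfolding up_closed_def
proof (intro ballI allI)
  fix t u assume t: "t \<in> stage k"
  show "t + u \<in> stage k"
  proof (cases "t + u \<in> E")
    case True then show ?thesis by (simp add: stage_def)
  next
    case False
    then have "t \<notin> E" using up_closedD(1)[OF E_up] by blast
    with t obtain j where j: "t \<in> F - E" "j < k" "j < length gs" "same_fibre (gs ! j) t"
      by (auto simp: stage_def)
    have tu: "t + u \<in> F - E" using False up_closedD(1)[OF F_up] j(1) by blast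
    show ?thesis
    proof (cases "Poly_Mapping.keys u \<inter> V = {}")
      case True
      then have "same_fibre (gs ! j) (t + u)" using same_fibre_trans[OF j(4) same_fibre_add] by blast
      then show ?thesis using tu j by (auto simp: stage_def)
    next
      case False
      obtain l where l: "l < length gs" "same_fibre (gs ! l) (t + u)"
        by (rule generated_nth[OF tu]) blast
      have "(\<Sum>v\<in>V. Poly_Mapping.lookup t v) < (\<Sum>v\<in>V. Poly_Mapping.lookup (t + u) v)"
        using False by (intro sum_strict_mono_ex1) (auto simp: lookup_add in_keys_iff)
      moreover have "(\<Sum>v\<in>V. Poly_Mapping.lookup (gs ! j) v) = (\<Sum>v\<in>V. Poly_Mapping.lookup t v)"
        "(\<Sum>v\<in>V. Poly_Mapping.lookup (gs ! l) v) = (\<Sum>v\<in>V. Poly_Mapping.lookup (t + u) v)"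
        using j(4) l(2) by (simp_all add: same_fibre_def)
      ultimately have "\<not> j \<le> l" using sorted[of j l] l(1) by auto
      then show ?thesis using l tu j(2) by (auto simp: stage_def intro!: exI[of _ l])
    qed
  qed
qed

lemma nth_in_stage_iff: "i < length gs \<Longrightarrow> gs ! i \<in> stage k \<longleftrightarrow> i < k"
  using nth_FE[of i] nth_fibre_eq[of _ i] by (auto simp: stage_def same_fibre_def)

text \<open>A factor x^t free of V keeps the product in the fibre of g_i, which enters only at the
  next stage; any other factor leaves that fibre and falls back into \<open>stage i\<close>. So
  \<open>variable_prime V\<close> is the colon ideal of x^{g_i} into the earlier stage.\<close>

lemma nth_add_in_stage_iff:
  assumes i: "i < length gs"
  shows "gs ! i + t \<in> stage i \<longleftrightarrow> Poly_Mapping.keys t \<inter> V \<noteq> {}"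
proof
  assume in_stage: "gs ! i + t \<in> stage i"
  show "Poly_Mapping.keys t \<inter> V \<noteq> {}"
  proof
    assume t: "Poly_Mapping.keys t \<inter> V = {}"
    then have "gs ! i + t \<notin> E" using cancel nth_FE[OF i] by blast
    with in_stage obtain j where j: "j < i" "same_fibre (gs ! j) (gs ! i + t)"
      by (auto simp: stage_def)
    have "same_fibre (gs ! j) (gs ! i)" using same_fibre_trans[OF j(2) same_fibre_sym[OF same_fibre_add[OF t]]] .
    then show False using nth_fibre_eq[of j i] i j(1) by simp
  qed
next
  assume t: "Poly_Mapping.keys t \<inter> V \<noteq> {}"
  then have "\<not> same_fibre (gs ! i) (gs ! i + t)"
    by (auto simp: same_fibre_def lookup_add in_keys_iff)
  moreover have "gs ! i + t \<in> stage (Suc i)"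
    using up_closedD(1)[OF stage_up_closed] nth_in_stage_iff[OF i] by blast
  ultimately show "gs ! i + t \<in> stage i"
    by (auto simp: stage_def less_Suc_eq)
qed

lemma stage_ideal: "ideal_set (supported_in (stage k) :: ('n, 'k) mpoly set)"
  by (rule supported_in_ideal[OF stage_up_closed])

lemma stage_subset:
  "supported_in E \<subseteq> (supported_in (stage k) :: ('n, 'k) mpoly set)"
  "supported_in (stage k) \<subseteq> (supported_in F :: ('n, 'k) mpoly set)"
  "supported_in (stage k) \<subseteq> (supported_in (stage (Suc k)) :: ('n, 'k) mpoly set)"
  unfolding supported_in_def using stage_bounds[of k] stage_Suc[of k] by blast+

lemma stage_Suc_cases:
  assumes i: "i < length gs" and t: "t \<in> stage (Suc i)" "t \<notin> stage i"
  shows "t = gs ! i + (t - gs ! i)"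
proof -
  have "t \<in> F - E" "same_fibre (gs ! i) t" using t by (auto simp: stage_def less_Suc_eq)
  then have "Poly_Mapping.lookup (gs ! i) j \<le> Poly_Mapping.lookup t j" for j by (intro nth_le i)
  then show ?thesis by (intro poly_mapping_eqI) (simp add: lookup_add lookup_minus)
qed

text \<open>Multiplication by x^{g_i} maps S onto the new layer, since each new monomial is a
  multiple of x^{g_i}. Its kernel is P by \<open>nth_add_in_stage_iff\<close>, and it raises degrees
  by g_i, which is the shift.\<close>

lemma stage_quotient_isomorphic:
  assumes i: "i < length gs"
  shows "graded_isomorphic
    (quotient_module (restrict_module Q (c ` supported_in (stage (Suc i)))) (c ` supported_in (stage i)))
    (shift_module (quotient_module mpoly_module (variable_prime V)) (\<lambda>j. int (Poly_Mapping.lookup (gs ! i) j)))"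
proof -
  let ?N = "supported_in (stage i) :: ('n, 'k) mpoly set"
  let ?N' = "supported_in (stage (Suc i)) :: ('n, 'k) mpoly set"
  let ?h = "\<lambda>f. monomial (gs ! i) * f :: ('n, 'k) mpoly"
  obtain k where k: "presents (quotient_module (restrict_module Q (c ` ?N')) (c ` ?N)) k ?N' ?N"
    using presents_quotient[OF Q stage_ideal stage_ideal stage_subset(1,3,2)] by blast
  obtain k' where k': "presents (quotient_module mpoly_module (variable_prime V :: ('n, 'k) mpoly set)) k' UNIV (variable_prime V)"
    using presents_quotient_mpoly[OF variable_prime_ideal] by blast
  note N = ideal_setD[OF stage_ideal[of i]]
  have hN': "?h f \<in> ?N'" for f
    using up_closedD(1)[OF stage_up_closed] nth_in_stage_iff[OF i]
    by (auto simp: supported_in_def keys_monomial_mult)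
  have hN: "?h f \<in> ?N \<longleftrightarrow> f \<in> variable_prime V" for f
    by (auto simp: supported_in_def keys_monomial_mult variable_prime_def nth_add_in_stage_iff[OF i])
  show ?thesis
  proof (rule presents_graded_isomorphic[OF k k', where h = ?h])
    fix u assume u: "u \<in> ?N'"
    \<comment> \<open>The polynomials that \<open>?h\<close> reaches modulo the earlier stage. They
      form an ideal, so only monomials have to be examined.\<close>
    define J where "J = {u. \<exists>a. u - ?h a \<in> ?N}"
    have J: "ideal_set J" unfolding ideal_set_def
    proof (intro conjI ballI allI)
      show "0 \<in> J" unfolding J_def using N(1) by (intro CollectI exI[of _ 0]) simp
    next
      fix p q assume "p \<in> J" "q \<in> J"
      then obtain a b where "p - ?h a \<in> ?N" "q - ?h b \<in> ?N" by (auto simp: J_def)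
      from N(2)[OF this] show "p + q \<in> J"
        unfolding J_def by (intro CollectI exI[of _ "a + b"]) (simp add: algebra_simps)
    next
      fix r p assume "p \<in> J"
      then obtain a where "p - ?h a \<in> ?N" by (auto simp: J_def)
      from N(3)[OF this, of r] show "r * p \<in> J"
        unfolding J_def by (intro CollectI exI[of _ "r * a"]) (simp add: algebra_simps)
    qed
    have "u \<in> J"
    proof (rule mpoly_ideal_induct[OF J])
      fix t assume "t \<in> Poly_Mapping.keys u"
      then have t: "t \<in> stage (Suc i)" using u by (auto simp: supported_in_def)
      show "monomial t \<in> J"
      proof (cases "t \<in> stage i")
        case True
        then show ?thesis unfolding J_def by (intro CollectI exI[of _ 0]) (simp add: supported_in_def)
      next
        case False
        have "monomial t = ?h (monomial (t - gs ! i))"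
          unfolding monomial_mult using stage_Suc_cases[OF i t False] by simp
        then show ?thesis unfolding J_def using N(1) by (intro CollectI exI[of _ "monomial (t - gs ! i)"]) simp
      qed
    qed
    then show "\<exists>a\<in>UNIV. u - ?h a \<in> ?N" by (simp add: J_def)
  next
    fix e
    let ?e = "\<lambda>j. e j - int (Poly_Mapping.lookup (gs ! i) j)"
    have comp: "?h f \<in> component mpoly_module e \<longleftrightarrow> f \<in> component mpoly_module ?e" for f
      by (auto simp: component_mpoly keys_monomial_mult lookup_add eq_diff_eq add.commute)
    show "k ` (?N' \<inter> component mpoly_module e) = k ` ?h ` (UNIV \<inter> component mpoly_module ?e)"
    proof
      show "k ` ?h ` (UNIV \<inter> component mpoly_module ?e) \<subseteq> k ` (?N' \<inter> component mpoly_module e)"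
        using hN' comp by auto
      show "k ` (?N' \<inter> component mpoly_module e) \<subseteq> k ` ?h ` (UNIV \<inter> component mpoly_module ?e)"
      proof clarify
        fix u assume u: "u \<in> ?N'" "u \<in> component mpoly_module e"
        show "k u \<in> k ` ?h ` (UNIV \<inter> component mpoly_module ?e)"
        proof (cases "u \<in> ?N")
          \<comment> \<open>A homogeneous u from the earlier stage need not be a multiple of
            x^{g_i}, but its class is zero, which 0 represents as well.\<close>
          case True
          then have "k u = k (?h 0)" using presents_eq_zero[OF k u(1)] by simp
          moreover have "0 \<in> component mpoly_module ?e" by (simp add: component_mpoly)
          ultimately show ?thesis by blast
        next
          case False
          then obtain t where t: "t \<in> Poly_Mapping.keys u" "t \<notin> stage i" by (auto simp: supported_in_def)
          then have "t \<in> stage (Suc i)" using u(1) by (auto simp: supported_in_def)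
          \<comment> \<open>In the fine grading a homogeneous polynomial has at most one
            term.\<close>
          have eq: "t' = t" if "t' \<in> Poly_Mapping.keys u" for t'
          proof (rule poly_mapping_eqI)
            fix j
            have "int (Poly_Mapping.lookup t' j) = int (Poly_Mapping.lookup t j)"
              using u(2) t(1) that by (simp add: component_mpoly)
            then show "Poly_Mapping.lookup t' j = Poly_Mapping.lookup t j" by simp
          qed
          have "u = Poly_Mapping.single t (Poly_Mapping.lookup u t)"
            by (rule poly_mapping_eqI) (use eq in \<open>auto simp: lookup_single when_def in_keys_iff\<close>)
          also have "\<dots> = ?h (Poly_Mapping.single (t - gs ! i) (Poly_Mapping.lookup u t))"
            using stage_Suc_cases[OF i \<open>t \<in> stage (Suc i)\<close> t(2)] by (simp add: monomial_def mult_single)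
          finally have uh: "u = ?h (Poly_Mapping.single (t - gs ! i) (Poly_Mapping.lookup u t))" .
          then have "Poly_Mapping.single (t - gs ! i) (Poly_Mapping.lookup u t) \<in> component mpoly_module ?e"
            using comp u(2) by metis
          then show ?thesis using uh by blast
        qed
      qed
    qed
  qed (use hN hN' in \<open>auto simp: algebra_simps\<close>)
qed

lemma prime_filtration_stages:
  "prime_filtration Q (map (\<lambda>k. c ` supported_in (stage k)) [0..<Suc (length gs)])
    (replicate (length gs) (variable_prime V))"
proof -
  let ?Ms = "map (\<lambda>k. c ` supported_in (stage k)) [0..<Suc (length gs)]"
  have nth: "?Ms ! i = c ` supported_in (stage i)" if "i \<le> length gs" for i
    using that by (subst nth_map) (auto simp: nth_append)
  have "c a = c 0" if "a \<in> supported_in E" for a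
    using presents_eq_zero[OF Q] that I_subset_U by blast
  then have "c ` supported_in (stage 0) = {\<zero>\<^bsub>Q\<^esub>}"
    unfolding stage_0 presentsD(5)[OF Q] using imageI[OF ideal_setD(1)[OF I], of c] by blast
  then have hd: "hd ?Ms = {\<zero>\<^bsub>Q\<^esub>}" using nth[of 0] by (subst hd_conv_nth) simp_all
  have last: "last ?Ms = carrier Q" by (simp add: stage_length presentsD(4)[OF Q])
  have sub: "graded_submodule N Q" if "N \<in> set ?Ms" for N
    using that presents_graded_submodule[OF Q stage_up_closed stage_subset(1,2)] by auto
  have strict: "c ` supported_in (stage i) \<subset> c ` (supported_in (stage (Suc i)) :: ('n, 'k) mpoly set)"
    if i: "i < length gs" for i
  proof
    show "c ` supported_in (stage i) \<subseteq> c ` (supported_in (stage (Suc i)) :: ('n, 'k) mpoly set)"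
      using stage_subset(3) by blast
    have "monomial (gs ! i) \<in> (supported_in (stage (Suc i)) :: ('n, 'k) mpoly set)"
      "monomial (gs ! i) \<notin> (supported_in (stage i) :: ('n, 'k) mpoly set)"
      using nth_in_stage_iff[OF i] by (simp_all add: supported_in_def)
    then show "c ` supported_in (stage i) \<noteq> c ` (supported_in (stage (Suc i)) :: ('n, 'k) mpoly set)"
      using presents_mem_image[OF Q stage_ideal stage_subset(1,2)] stage_subset(2) by blast
  qed
  show ?thesis
    unfolding prime_filtration_def
  proof (intro conjI ballI allI impI)
    show "length ?Ms = Suc (length (replicate (length gs) (variable_prime V)))" by simp
  next
    fix i assume "i < length (replicate (length gs) (variable_prime V :: ('n, 'k) mpoly set))"
    then have i: "i < length gs" by simp
    show "?Ms ! i \<subset> ?Ms ! Suc i" using strict[OF i] nth[of i] nth[of "Suc i"] i by simp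
    show "monomial_ideal (replicate (length gs) (variable_prime V) ! i :: ('n, 'k) mpoly set)"
      using i by (simp add: variable_prime_monomial)
    show "primeideal (replicate (length gs) (variable_prime V) ! i :: ('n, 'k) mpoly set) mpoly_ring"
      using i by (simp add: variable_prime_primeideal)
    show "\<exists>a :: 'n \<Rightarrow> nat. graded_isomorphic (quotient_module (restrict_module Q (?Ms ! Suc i)) (?Ms ! i))
        (shift_module (quotient_module mpoly_module (replicate (length gs) (variable_prime V) ! i)) (\<lambda>j. int (a j)))"
      using stage_quotient_isomorphic[OF i] nth[of i] nth[of "Suc i"] i
      by (intro exI[of _ "Poly_Mapping.lookup (gs ! i)"]) simp
  qed (use hd last sub in auto)
qed

lemma gs_ne: "gs \<noteq> []"
  using exists_fibre generated_nth by (metis length_greater_0_conv less_zeroE neq0_conv)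

lemma clean: "clean Q"
  unfolding clean_def minimal_primes_eq
proof (intro exI conjI)
  show "set (replicate (length gs) (variable_prime V)) = {variable_prime V}"
    using gs_ne by (simp add: set_replicate_conv_if)
qed (rule prime_filtration_stages)

lemma fdepth_eq: "fdepth Q = module_dim mpoly_ring Q"
proof (rule antisym)
  show "fdepth Q \<le> module_dim mpoly_ring Q"
    unfolding fdepth_def using filtration_fdepth_le by (intro Sup_least) auto
  have "filtration_fdepth (replicate (length gs) (variable_prime V :: ('n, 'k) mpoly set)) = module_dim mpoly_ring Q"
    using gs_ne by (simp add: filtration_fdepth_def set_replicate_conv_if module_dim_eq)
  then show "module_dim mpoly_ring Q \<le> fdepth Q"
    unfolding fdepth_def using prime_filtration_stages by (intro Sup_upper) (metis (mono_tags, lifting) CollectI)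
qed

end

section \<open>The Stanley decomposition\<close>

lemma polys_in_add: "f \<in> polys_in Z \<Longrightarrow> g \<in> polys_in Z \<Longrightarrow> f + g \<in> polys_in Z"
  using keys_add[of f g] by (auto simp: polys_in_def)

lemma polys_in_diff: "f \<in> polys_in Z \<Longrightarrow> g \<in> polys_in Z \<Longrightarrow> f - g \<in> polys_in Z"
  using keys_diff[of f g] by (auto simp: polys_in_def)

lemma polys_in_0: "0 \<in> polys_in Z"
  by (simp add: polys_in_def)

context primary_quotient
begin

lemma cyclic_subspace_monomial:
  assumes "g \<in> F"
  shows "cyclic_subspace Q (c (monomial g)) Z = c ` (\<lambda>f. f * monomial g) ` polys_in Z"
proof -
  have "monomial g \<in> (supported_in F :: ('n, 'k) mpoly set)" using assms by (simp add: supported_in_def)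
  then show ?thesis using presentsD(7)[OF Q] by (simp add: cyclic_subspace_def image_image)
qed

lemma monomial_multiple_in_U:
  assumes "g \<in> F"
  shows "f * monomial g \<in> (supported_in F :: ('n, 'k) mpoly set)"
  by (rule ideal_setD(3)[OF U]) (use assms in \<open>simp add: supported_in_def\<close>)

text \<open>The prime generated by V contains (I : x^g) and meets K[Z] only in 0.\<close>

lemma free_monomial_injective:
  assumes g: "g \<in> F - E" and f: "f \<in> polys_in (- V)" "f' \<in> polys_in (- V)"
    and eq: "c (f * monomial g) = c (f' * monomial g)"
  shows "f = f'"
proof -
  have "f * monomial g - f' * monomial g \<in> supported_in E"
    using presentsD(8)[OF Q] monomial_multiple_in_U g eq by blast
  then have *: "monomial g * (f - f') \<in> supported_in E" by (simp add: algebra_simps)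
  have "Poly_Mapping.keys (f - f') = {}"
  proof (rule ccontr)
    assume "Poly_Mapping.keys (f - f') \<noteq> {}"
    then obtain t where t: "t \<in> Poly_Mapping.keys (f - f')" by blast
    then have "Poly_Mapping.keys t \<inter> V \<noteq> {}" using free_monomial_cancel[OF *] g by blast
    moreover have "Poly_Mapping.keys t \<subseteq> - V" using polys_in_diff[OF f] t by (auto simp: polys_in_def)
    ultimately show False by blast
  qed
  then show ?thesis by simp
qed

lemma stanley_space_monomial:
  assumes g: "g \<in> F - E"
  shows "stanley_space Q (c (monomial g)) (- V)"
  unfolding stanley_space_def
proof
  note q = presentsD[OF Q]
  have gF: "g \<in> F" using g by simp
  have gU: "monomial g \<in> (supported_in F :: ('n, 'k) mpoly set)" using gF by (simp add: supported_in_def)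
  have "monomial g \<in> component mpoly_module (\<lambda>i. int (Poly_Mapping.lookup g i))"
    unfolding monomial_def by (rule single_component)
  then show "\<exists>b. c (monomial g) \<in> component Q b"
    unfolding q(9) using gU by blast
  define W where "W = (\<lambda>f. f * monomial g) ` (polys_in (- V) :: ('n, 'k) mpoly set)"
  have cyc: "cyclic_subspace Q (c (monomial g)) (- V) = c ` W"
    unfolding W_def by (rule cyclic_subspace_monomial[OF gF])
  have WU: "W \<subseteq> supported_in F" using monomial_multiple_in_U[OF gF] by (auto simp: W_def)
  have W0: "0 \<in> W" unfolding W_def by (rule image_eqI[of _ _ 0]) (simp_all add: polys_in_0)
  have Wadd: "u + v \<in> W" if uv: "u \<in> W" "v \<in> W" for u v
  proof -
    from uv obtain f h where "f \<in> polys_in (- V)" "h \<in> polys_in (- V)" "u = f * monomial g" "v = h * monomial g"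
      by (auto simp: W_def)
    then show ?thesis
      unfolding W_def by (intro image_eqI[of _ _ "f + h"]) (simp_all add: distrib_right polys_in_add)
  qed
  let ?M = "Q\<lparr>carrier := c ` W\<rparr>"
  let ?y = "c (monomial g)"
  have comb: "(\<Oplus>\<^bsub>?M\<^esub> v \<in> {v. b v \<noteq> 0}. b v \<odot>\<^bsub>Q\<^esub> v) = c (b ?y * monomial g)"
    if b: "\<forall>v. v \<notin> {?y} \<longrightarrow> b v = 0" "b ?y \<in> polys_in (- V)" for b :: "'m \<Rightarrow> ('n, 'k) mpoly"
  proof -
    \<comment> \<open>If the coefficient at the basis element is zero, the sum runs over the empty
      set rather than over a singleton.\<close>
    have supp: "{v. b v \<noteq> 0} = (if b ?y = 0 then {} else {?y})"
    proof (cases "b ?y = 0")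
      case True
      then have "b v = 0" for v using b(1) by (cases "v = ?y") auto
      then show ?thesis using True by simp
    qed (use b(1) in auto)
    interpret abelian_monoid ?M by (rule presents_restrict_finsum(1)[OF Q WU W0 Wadd])
    have "c (b ?y * monomial g) \<in> c ` W" using b(2) by (auto simp: W_def)
    moreover have eq: "b ?y \<odot>\<^bsub>Q\<^esub> ?y = c (b ?y * monomial g)" using q(7)[OF gU] by simp
    moreover have "(\<Oplus>\<^bsub>?M\<^esub> v \<in> {?y}. b v \<odot>\<^bsub>Q\<^esub> v) = b ?y \<odot>\<^bsub>Q\<^esub> ?y \<oplus>\<^bsub>?M\<^esub> (\<Oplus>\<^bsub>?M\<^esub> v \<in> {}. b v \<odot>\<^bsub>Q\<^esub> v)"
      by (subst finsum_insert) (use calculation in auto)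
    ultimately show ?thesis
      unfolding supp using r_zero[of "c (b ?y * monomial g)"] q(5) by simp
  qed
  show "free_module (mpoly_ring\<lparr>carrier := polys_in (- V)\<rparr>)
      (Q\<lparr>carrier := cyclic_subspace Q ?y (- V)\<rparr>)"
    unfolding free_module_def cyc
  proof (intro exI[of _ "{?y}"] conjI ballI)
    have "monomial g \<in> W" unfolding W_def
      by (rule image_eqI[of _ _ 1]) (simp_all add: polys_in_def)
    then show "{?y} \<subseteq> carrier ?M" by simp
  next
    fix x assume "x \<in> carrier ?M"
    then obtain f where f: "f \<in> polys_in (- V)" "x = c (f * monomial g)" by (auto simp: W_def)
    let ?R = "\<lambda>b :: 'm \<Rightarrow> ('n, 'k) mpoly. b ` {?y} \<subseteq> polys_in (- V) \<and> (\<forall>v. v \<notin> {?y} \<longrightarrow> b v = 0) \<and>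
      finite {v. b v \<noteq> 0} \<and> x = (\<Oplus>\<^bsub>?M\<^esub> v \<in> {v. b v \<noteq> 0}. b v \<odot>\<^bsub>Q\<^esub> v)"
    have "\<exists>!b. ?R b"
    proof (rule ex1I)
      let ?b = "\<lambda>v. if v = ?y then f else 0"
      have "finite {v. ?b v \<noteq> 0}" by (rule finite_subset[of _ "{?y}"]) auto
      moreover have "x = (\<Oplus>\<^bsub>?M\<^esub> v \<in> {v. ?b v \<noteq> 0}. ?b v \<odot>\<^bsub>Q\<^esub> v)"
        using comb[of ?b] f by simp
      ultimately show "?R ?b" using f(1) by simp
    next
      fix b assume R: "?R b"
      then have b: "\<forall>v. v \<notin> {?y} \<longrightarrow> b v = 0" "b ?y \<in> polys_in (- V)" by auto
      have "c (b ?y * monomial g) = c (f * monomial g)" using R comb[OF b] f(2) by simp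
      then have "b ?y = f" by (rule free_monomial_injective[OF g b(2) f(1)])
      then show "b = (\<lambda>v. if v = ?y then f else 0)" using b(1) by auto
    qed
    then show "\<exists>!b. b ` {?y} \<subseteq> carrier (mpoly_ring\<lparr>carrier := polys_in (- V)\<rparr>) \<and>
        (\<forall>v. v \<notin> {?y} \<longrightarrow> b v = \<zero>\<^bsub>mpoly_ring\<lparr>carrier := polys_in (- V)\<rparr>\<^esub>) \<and>
        finite {v. b v \<noteq> \<zero>\<^bsub>mpoly_ring\<lparr>carrier := polys_in (- V)\<rparr>\<^esub>} \<and>
        x = (\<Oplus>\<^bsub>?M\<^esub> v \<in> {v. b v \<noteq> \<zero>\<^bsub>mpoly_ring\<lparr>carrier := polys_in (- V)\<rparr>\<^esub>}. b v \<odot>\<^bsub>?M\<^esub> v)"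
      by simp
  qed
qed

end

context sorted_generators
begin

lemma exists_combination:
  assumes "u \<in> (supported_in F :: ('n, 'k) mpoly set)"
  obtains f where "\<And>i. f i \<in> polys_in (- V)" "u - (\<Sum>i<length gs. f i * monomial (gs ! i)) \<in> supported_in E"
proof -
  note i = ideal_setD[OF I]
  \<comment> \<open>Coefficients are confined to K[Z], so closure of J under multiplication by S is
    not evident beforehand. Hence \<open>u\<close> is assembled from its terms, scalars included,
    and not by \<open>mpoly_ideal_induct\<close>.\<close>
  define J where "J = {u :: ('n, 'k) mpoly. \<exists>f. (\<forall>i. f i \<in> polys_in (- V)) \<and>
    u - (\<Sum>i<length gs. f i * monomial (gs ! i)) \<in> supported_in E}"
  have J0: "0 \<in> J" unfolding J_def using i(1) by (intro CollectI exI[of _ "\<lambda>_. 0"]) (simp add: polys_in_0)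
  have Jadd: "p + r \<in> J" if "p \<in> J" "r \<in> J" for p r
  proof -
    from that obtain f h where fh: "\<forall>i. f i \<in> polys_in (- V)" "p - (\<Sum>i<length gs. f i * monomial (gs ! i)) \<in> supported_in E"
      "\<forall>i. h i \<in> polys_in (- V)" "r - (\<Sum>i<length gs. h i * monomial (gs ! i)) \<in> supported_in E"
      by (auto simp: J_def)
    have "(p + r) - (\<Sum>i<length gs. (f i + h i) * monomial (gs ! i)) =
      (p - (\<Sum>i<length gs. f i * monomial (gs ! i))) + (r - (\<Sum>i<length gs. h i * monomial (gs ! i)))"
      by (simp add: distrib_right sum.distrib)
    also have "\<dots> \<in> supported_in E" by (rule i(2)[OF fh(2,4)])
    finally show ?thesis unfolding J_def using fh(1,3) polys_in_add
      by (intro CollectI exI[of _ "\<lambda>i. f i + h i"]) blast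
  qed
  have Jsingle: "Poly_Mapping.single 0 k * monomial t \<in> J" if t: "t \<in> F" for t and k :: 'k
  proof (cases "t \<in> E")
    case True
    then have "Poly_Mapping.single 0 k * monomial t \<in> supported_in E"
      by (intro i(3)) (simp add: supported_in_def)
    then show ?thesis unfolding J_def by (intro CollectI exI[of _ "\<lambda>_. 0"]) (simp add: polys_in_0)
  next
    case False
    then have tFE: "t \<in> F - E" using t by simp
    obtain j where j: "j < length gs" "same_fibre (gs ! j) t"
      "\<And>i. Poly_Mapping.lookup (gs ! j) i \<le> Poly_Mapping.lookup t i"
      by (rule generated_nth[OF tFE]) blast
    have eq: "t - gs ! j + gs ! j = t"
      using j(3) by (intro poly_mapping_eqI) (simp add: lookup_add lookup_minus)
    define f where "f i = (if i = j then Poly_Mapping.single 0 k * monomial (t - gs ! j) else 0)" for i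
    have "(\<Sum>i<length gs. f i * monomial (gs ! i))
        = (\<Sum>i<length gs. if i = j then Poly_Mapping.single 0 k * monomial (t - gs ! j) * monomial (gs ! i) else 0)"
      by (intro sum.cong) (auto simp: f_def)
    also have "\<dots> = Poly_Mapping.single 0 k * monomial t"
      using j(1) by (simp add: mult.assoc eq)
    finally have "Poly_Mapping.single 0 k * monomial t - (\<Sum>i<length gs. f i * monomial (gs ! i)) \<in> supported_in E"
      using i(1) by simp
    \<comment> \<open>The quotient of x^t by x^{g_j} lies in K[Z] because t and g_j agree on
      V.\<close>
    moreover have "f i \<in> polys_in (- V)" for i
      using j(2) by (auto simp: f_def polys_in_def monomial_def mult_single same_fibre_def in_keys_iff lookup_minus split: if_splits)
    ultimately show ?thesis unfolding J_def by blast
  qed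
  have sum_in: "(\<Sum>t\<in>A. Poly_Mapping.single 0 (Poly_Mapping.lookup u t) * monomial t) \<in> J" if "A \<subseteq> F" for A
    using that by (induction A rule: infinite_finite_induct) (auto intro: J0 Jadd Jsingle)
  have "u \<in> J"
    by (subst mpoly_eq_sum_monomials) (rule sum_in, use assms in \<open>simp add: supported_in_def\<close>)
  then show thesis unfolding J_def using that by blast
qed

text \<open>The terms of f_j x^{g_j} stay in the fibre of g_j, and distinct generators lie in
  distinct fibres, so nothing cancels between summands. A term of f_i x^{g_i} would then lie in E,
  and g_i with it.\<close>

lemma combination_unique:
  assumes f: "\<And>i. f i \<in> polys_in (- V)"
    and sum: "(\<Sum>i<length gs. f i * monomial (gs ! i)) \<in> (supported_in E :: ('n, 'k) mpoly set)"
    and i: "i < length gs"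
  shows "f i = 0"
proof (rule ccontr)
  assume "f i \<noteq> 0"
  then obtain t where t: "t \<in> Poly_Mapping.keys (f i)" by fastforce
  have keys: "same_fibre (gs ! j) s" if s: "s \<in> Poly_Mapping.keys (f j * monomial (gs ! j))" for j s
  proof -
    from s obtain u where "u \<in> Poly_Mapping.keys (f j)" "s = gs ! j + u"
      unfolding mult.commute[of _ "monomial _"] keys_monomial_mult by blast
    moreover from this have "Poly_Mapping.keys u \<inter> V = {}" using f[of j] by (auto simp: polys_in_def)
    ultimately show ?thesis using same_fibre_add by blast
  qed
  let ?s = "gs ! i + t"
  have si: "?s \<in> Poly_Mapping.keys (f i * monomial (gs ! i))"
    unfolding mult.commute[of _ "monomial _"] keys_monomial_mult using t by blast
  have "?s \<notin> Poly_Mapping.keys (f j * monomial (gs ! j))" if "j < length gs" "j \<noteq> i" for j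
  proof
    assume "?s \<in> Poly_Mapping.keys (f j * monomial (gs ! j))"
    then have "same_fibre (gs ! j) (gs ! i)"
      using same_fibre_trans[OF keys same_fibre_sym[OF keys[OF si]]] by blast
    then show False using nth_fibre_eq i that by blast
  qed
  then have "Poly_Mapping.lookup (\<Sum>j<length gs. f j * monomial (gs ! j)) ?s
      = (\<Sum>j<length gs. if j = i then Poly_Mapping.lookup (f i * monomial (gs ! i)) ?s else 0)"
    unfolding lookup_sum by (intro sum.cong) (auto simp: in_keys_iff)
  also have "\<dots> \<noteq> 0" using i si by (simp add: in_keys_iff)
  finally have "?s \<in> E" using sum by (auto simp: supported_in_def in_keys_iff)
  moreover have "same_fibre ?s (gs ! i)" using same_fibre_sym[OF keys[OF si]] .
  ultimately show False using same_fibre_E nth_FE[OF i] by blast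
qed

lemma stanley_decomposition_generators:
  "stanley_decomposition Q (map (\<lambda>g. (c (monomial g), - V)) gs)"
proof -
  note q = presentsD[OF Q]
  let ?D = "map (\<lambda>g. (c (monomial g), - V)) gs"
  interpret module mpoly_ring Q by (rule presents_module[OF Q])
  have gF: "gs ! i \<in> F" if "i < length gs" for i using nth_FE[OF that] by simp
  have cyc: "cyclic_subspace Q (fst (?D ! i)) (snd (?D ! i)) = c ` (\<lambda>f. f * monomial (gs ! i)) ` polys_in (- V)"
    if "i < length gs" for i
    using cyclic_subspace_monomial[OF gF[OF that]] that by simp
  have fin: "(\<Oplus>\<^bsub>Q\<^esub> i \<in> {..<length gs}. w i) = c (\<Sum>i<length gs. f i * monomial (gs ! i))"
    if w: "\<And>i. i < length gs \<Longrightarrow> w i = c (f i * monomial (gs ! i))" for w f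
  proof -
    have "(\<Oplus>\<^bsub>Q\<^esub> i \<in> {..<length gs}. w i) = (\<Oplus>\<^bsub>Q\<^esub> i \<in> {..<length gs}. c (f i * monomial (gs ! i)))"
    proof (rule M.finsum_cong')
      show "(\<lambda>i. c (f i * monomial (gs ! i))) \<in> {..<length gs} \<rightarrow> carrier Q"
        unfolding q(4) using monomial_multiple_in_U[OF gF] by blast
    qed (use w in auto)
    also have "\<dots> = c (\<Sum>i<length gs. f i * monomial (gs ! i))"
      by (rule presents_finsum[OF Q]) (use monomial_multiple_in_U[OF gF] in auto)
    finally show ?thesis .
  qed
  have sumU: "(\<Sum>i<length gs. f i * monomial (gs ! i)) \<in> supported_in F" for f :: "nat \<Rightarrow> ('n, 'k) mpoly"
    by (rule ideal_set_sum[OF U]) (use monomial_multiple_in_U[OF gF] in auto)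
  show ?thesis
    unfolding stanley_decomposition_def
  proof (intro conjI ballI)
    fix yZ assume "yZ \<in> set ?D"
    then obtain g where g: "g \<in> generators" "yZ = (c (monomial g), - V)" using set_gs by auto
    then have "g \<in> F - E" using generators_subset by blast
    then show "case yZ of (y, Z) \<Rightarrow> y \<in> carrier Q \<and> stanley_space Q y Z"
      using stanley_space_monomial g(2) q(4) by (simp add: supported_in_def)
  next
    fix x assume "x \<in> carrier Q"
    then obtain u where u: "u \<in> supported_in F" "x = c u" by (auto simp: q(4))
    obtain f where f: "\<And>i. f i \<in> polys_in (- V)" "u - (\<Sum>i<length gs. f i * monomial (gs ! i)) \<in> supported_in E"
      using exists_combination[OF u(1)] by blast
    define w where "w = restrict (\<lambda>i. c (f i * monomial (gs ! i))) {..<length gs}"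
    show "\<exists>!w. w \<in> (\<Pi>\<^sub>E i \<in> {..<length ?D}. cyclic_subspace Q (fst (?D ! i)) (snd (?D ! i))) \<and>
        x = (\<Oplus>\<^bsub>Q\<^esub> i \<in> {..<length ?D}. w i)"
    proof (rule ex1I[of _ w], intro conjI)
      show "w \<in> (\<Pi>\<^sub>E i \<in> {..<length ?D}. cyclic_subspace Q (fst (?D ! i)) (snd (?D ! i)))"
      proof (rule PiE_I)
        fix i assume "i \<in> {..<length ?D}"
        then have "i < length gs" by simp
        then show "w i \<in> cyclic_subspace Q (fst (?D ! i)) (snd (?D ! i))"
          unfolding cyc[OF \<open>i < length gs\<close>] using f(1) by (simp add: w_def)
      qed (simp add: w_def)
      have "x = c (\<Sum>i<length gs. f i * monomial (gs ! i))"
        using q(8)[OF u(1) sumU] f(2) u(2) by simp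
      then show "x = (\<Oplus>\<^bsub>Q\<^esub> i \<in> {..<length ?D}. w i)"
        using fin[of w f] by (simp add: w_def)
    next
      fix w' assume w': "w' \<in> (\<Pi>\<^sub>E i \<in> {..<length ?D}. cyclic_subspace Q (fst (?D ! i)) (snd (?D ! i))) \<and>
        x = (\<Oplus>\<^bsub>Q\<^esub> i \<in> {..<length ?D}. w' i)"
      have "\<forall>i. \<exists>h. h \<in> polys_in (- V) \<and> (i < length gs \<longrightarrow> w' i = c (h * monomial (gs ! i)))"
      proof
        fix i
        show "\<exists>h. h \<in> polys_in (- V) \<and> (i < length gs \<longrightarrow> w' i = c (h * monomial (gs ! i)))"
        proof (cases "i < length gs")
          case True
          then have "w' i \<in> cyclic_subspace Q (fst (?D ! i)) (snd (?D ! i))"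
            using PiE_mem[OF conjunct1[OF w'], of i] by simp
          then show ?thesis unfolding cyc[OF True] by blast
        qed (use polys_in_0 in blast)
      qed
      then obtain h where h: "\<And>i. h i \<in> polys_in (- V)"
        "\<And>i. i < length gs \<Longrightarrow> w' i = c (h i * monomial (gs ! i))" by metis
      have "c u = c (\<Sum>i<length gs. h i * monomial (gs ! i))"
        using w' u(2) fin[OF h(2)] by simp
      then have "u - (\<Sum>i<length gs. h i * monomial (gs ! i)) \<in> supported_in E"
        using q(8)[OF u(1) sumU] by blast
      \<comment> \<open>Two expansions of x differ by a combination that lies in I, and then all
        coefficients of the difference vanish.\<close>
      from ideal_setD(6)[OF I this f(2)]
      have "(\<Sum>i<length gs. (f i - h i) * monomial (gs ! i)) \<in> supported_in E"
        by (simp add: left_diff_distrib sum_subtractf)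
      then have "f i - h i = 0" if "i < length gs" for i
        using combination_unique[of "\<lambda>i. f i - h i", OF polys_in_diff[OF f(1) h(1)] _ that] by blast
      then have "w' i = w i" if "i < length gs" for i
        using h(2)[OF that] that by (simp add: w_def)
      \<comment> \<open>Members of the extensional product are \<open>undefined\<close> off the
        index set, so agreement on it is equality.\<close>
      moreover have "w' i = undefined" if "\<not> i < length gs" for i
        using PiE_arb[OF conjunct1[OF w'], of i] that by simp
      ultimately show "w' = w" by (auto simp: w_def)
    qed
  qed
qed

lemma sdepth_eq: "sdepth Q = enat (card (- V))"
proof (rule antisym)
  show "sdepth Q \<le> enat (card (- V))"
    unfolding sdepth_def using decomposition_sdepth_le by (intro Sup_least) auto
  have "(\<lambda>(y, Z). enat (card Z)) ` set (map (\<lambda>g. (c (monomial g), - V)) gs) = {enat (card (- V))}"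
    using gs_ne by (auto simp: image_iff neq_Nil_conv)
  then have "decomposition_sdepth (map (\<lambda>g. (c (monomial g), - V)) gs) = enat (card (- V))"
    unfolding decomposition_sdepth_def by (simp only: cInf_singleton)
  then show "enat (card (- V)) \<le> sdepth Q"
    unfolding sdepth_def using stanley_decomposition_generators
    by (intro Sup_upper CollectI exI[of _ "map (\<lambda>g. (c (monomial g), - V)) gs"]) simp
qed

end

lemma (in primary_quotient) sorted_generators_exist:
  assumes "set fs \<subseteq> graded_maximal_ideal" "regular_sequence Q fs" "card (- V) \<le> length fs"
  obtains gs where "sorted_generators Q c F E V m gs"
proof -
  let ?d = "\<lambda>g. \<Sum>v\<in>V. Poly_Mapping.lookup g v"
  obtain xs where xs: "set xs = generators" "distinct xs"
    using finite_distinct_list[OF finite_generators] by blast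
  \<comment> \<open>\<open>sort_key\<close> sorts in ascending order, while the filtration starts
    with the highest degree in V.\<close>
  define gs where "gs = rev (sort_key ?d xs)"
  have "sorted_generators Q c F E V m gs"
  proof
    show "distinct gs" "set gs = generators" using xs by (simp_all add: gs_def)
    show "?d (gs ! j) \<le> ?d (gs ! i)" if ij: "i \<le> j" "j < length gs" for i j
    proof -
      have "sorted (map ?d (sort_key ?d xs))" by (rule sorted_sort_key)
      then have "map ?d (sort_key ?d xs) ! (length xs - Suc j) \<le> map ?d (sort_key ?d xs) ! (length xs - Suc i)"
        by (rule sorted_nth_mono) (use ij in \<open>auto simp: gs_def\<close>)
      then show ?thesis using ij by (simp add: gs_def rev_nth)
    qed
    show "\<exists>g\<in>generators. same_fibre g t \<and> (\<forall>i. Poly_Mapping.lookup g i \<le> Poly_Mapping.lookup t i)"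
      if "t \<in> F - E" for t
      using exists_generator[OF assms that] by metis
  qed
  then show thesis by (rule that)
qed

theorem theorem3p2:
  fixes U I :: "('n::finite, 'k::field) mpoly set"
  assumes "CARD('n) > 2"
    and "monomial_ideal U" and "monomial_ideal I" and "I \<subseteq> U"
    and "cohen_macaulay (ideal_quotient U I)"
    and "primary_ideal mpoly_ring I"
  shows "clean (ideal_quotient U I) \<and>
    fdepth (ideal_quotient U I) = depth (ideal_quotient U I) \<and>
    depth (ideal_quotient U I) = sdepth (ideal_quotient U I)"
proof -
  note U = monomial_idealE[OF assms(2)] and I = monomial_idealE[OF assms(3)]
  obtain c where c: "presents (ideal_quotient U I) c U I"
    by (rule presents_ideal_quotient[OF U(3) I(3) assms(4)])
  obtain V m where V: "\<And>i. i \<in> V \<Longrightarrow> Poly_Mapping.single i m \<in> exponents I"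
    "\<And>t u. t + u \<in> exponents I \<Longrightarrow> Poly_Mapping.keys u \<inter> V = {} \<Longrightarrow> t \<in> exponents I"
    by (rule primary_monomial_idealE[OF assms(6)]) blast
  \<comment> \<open>Cohen-Macaulay modules are nonzero, which keeps I apart from U.\<close>
  have "exponents I \<noteq> exponents U"
  proof
    assume "exponents I = exponents U"
    then have "I = U" using U(1) I(1) by metis
    then have "c a = c 0" if "a \<in> U" for a using presents_eq_zero[OF c that] that by simp
    then have "c ` U = (\<lambda>_. c 0) ` U" by (intro image_cong refl)
    then have "c ` U = {c 0}" using ideal_setD(1)[OF U(3)] by auto
    then show False using assms(5) presentsD(4,5)[OF c] by (simp add: cohen_macaulay_def)
  qed
  moreover have "exponents I \<subseteq> exponents U" using assms(4) by (auto simp: exponents_def)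
  moreover have "presents (ideal_quotient U I) c (supported_in (exponents U)) (supported_in (exponents I))"
    unfolding U(1)[symmetric] I(1)[symmetric] by (rule c)
  ultimately interpret primary_quotient "ideal_quotient U I" c "exponents U" "exponents I" V m
    using U(2) I(2) V by unfold_locales blast+
  obtain fs where fs: "set fs \<subseteq> graded_maximal_ideal" "regular_sequence (ideal_quotient U I) fs"
    "card (- V) \<le> length fs" and depth: "depth (ideal_quotient U I) = enat (card (- V))"
    "module_dim mpoly_ring (ideal_quotient U I) = enat (card (- V))"
    by (rule regular_sequence_of_depth[OF assms(5)])
  obtain gs where gs: "sorted_generators (ideal_quotient U I) c (exponents U) (exponents I) V m gs"
    by (rule sorted_generators_exist[OF fs])
  interpret sorted_generators "ideal_quotient U I" c "exponents U" "exponents I" V m gs by (rule gs)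
  show ?thesis using clean fdepth_eq sdepth_eq depth by simp
qed

end
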